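(* Let $R>0$ and $R_\mu>0$. There exists a positive constant $C_*=C_*(R,R_\mu)$, depending only on $R$ and $R_\mu$, with the following property. Let $(f_0,g_0)\in\mathcal{K}^2$ and let $(f,g)$ be a weak solution of the thin film Muskat problem with initial data $(f_0,g_0)$ which satisfies the local energy estimate \begin{align*} & \int_{\mathbb R}\big[ f ^2(T) + R (f+g)^2(T)\big]\zeta^2\, dx + \int_0^T\int_{\mathbb R} \Big(f \left| (1+R)\partial_x f + R \partial_xg \right|^2+ RR_\mu g \left| \partial_x f + \partial_x g \right|^2\Big)\zeta^2\, dx\, dt \\ & \leq \int_{\mathbb R}\big[ f^2 (0) + R (f+g)^2(0)\big]\zeta^2\, dx +4\int_0^T\int_{\mathbb R} \Big[f \left( (1+R)f+Rg \right)^2+RR_\mu g \left( f + g \right)^2\Big] |\partial_x\zeta|^2\, dx\, dt \end{align*} for all $T>0$ and all $\zeta\in W^1_4(\mathbb R)$, as well as for $\zeta\equiv 1$. Then $(f,g)$ has finite speed of propagation; more precisely: if $a\geq 0$, $r_0>0$ and ${\rm supp}(f_0+g_0)\cap(a-r_0,a+r_0)=\emptyset$, then $${\rm supp}(f(T)+g(T))\cap (a-r_0/2,a+r_0/2)=\emptyset \qquad\text{for all } T\in\big(0, C_* r_0^{5/2}/ \mathcal{E}^{1/2}(f_{0},g_{0})\big].$$ In particular, if ${\rm supp}(f_0+g_0)\subset [-b_0,b_0]$ with $b_0>0$, then there exists a positive constant $C^*=C^*(R_\mu,R,f_0,g_0)$ such that $${\rm supp}(f(T)+g(T))\subset\big[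 -b_0 -C^* T^{1/3} ,\,b_0+C^* T^{1/3} \big]\qquad\text{for all } T>0.$$
   Context: Set $\mathcal{K}:=\{u\in L_1(\mathbb R,(1+x^2)\,dx)\cap L_2(\mathbb R): u\ge 0\}$ and $\mathcal{K}^2:=\mathcal{K}\times\mathcal{K}$. The energy is $\mathcal{E}(f,g):=\frac12\int_{\mathbb R}[f^2+R(f+g)^2]\,dx$. $W^1_4(\mathbb R)$ is the Sobolev space of functions in $L_4(\mathbb R)$ with weak derivative in $L_4(\mathbb R)$. Supports are in the sense of measurable functions (complement of the largest open set on which the function vanishes a.e.). The thin film Muskat problem is the degenerate parabolic system, for $(t,x)\in(0,\infty)\times\mathbb R$, $$\partial_t f=\partial_x\big(f\,\partial_x((1+R)f+Rg)\big),\qquad \partial_t g=R_\mu\,\partial_x\big(g\,\partial_x(f+g)\big),\qquad f(0)=f_0,\ g(0)=g_0.$$ Given $(f_0,g_0)\in\mathcal{K}^2$, a pair $(f,g):[0,\infty)\to\mathcal{K}^2$ is a weak solution if: (i) $(f,g)\in L_\infty(0,\infty;L_2(\mathbb R;\mathbb R^2))$ and $(f,g)\in L_2(0,\infty;H^1(\mathbb R;\mathbb R^2))$; (ii) $(f,g)\in C([0,\infty);H^{-1}(\mathbb R;\mathbb R^2))$ with $(f,g)(0)=(f_0,g_0)$; and (iii) for all $\xi\in C_0^\infty(\mathbb R)$ and $t\ge0$, $$\int_{\mathbb R} f(t)\xi\,dx-\int_{\mathbb R} f_0\xi\,dx+\int_0^t\int_{\mathbb R} f(\sigma)\big[(1+R)\partial_xf+R\partial_xg\big](\sigma)\,\partial_x\xi\,dx\,d\sigma=0,$$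 $$\int_{\mathbb R} g(t)\xi\,dx-\int_{\mathbb R} g_0\xi\,dx+R_\mu\int_0^t\int_{\mathbb R} g(\sigma)\big(\partial_xf+\partial_xg\big)(\sigma)\,\partial_x\xi\,dx\,d\sigma=0.$$ *)

theory Defs
  imports "HOL-Analysis.Analysis"
begin

(* Elements of function spaces are represented by functions real => real; everything below
   depends only on their classes modulo equality almost everywhere.  A curve in such a space
   is a function of t whose value at t is some representative, with no joint measurability
   in (t, x) required; accordingly space-time integrals are iterated integrals. *)

definition Lp :: "nat \<Rightarrow> (real \<Rightarrow> real) set" where
  "Lp p = {u. u \<in> borel_measurable lebesgue \<and> integrable lebesgue (\<lambda>x. \<bar>u x\<bar> ^ p)}"

definition test_functions :: "(real \<Rightarrow> real) set" where
  "test_functions = {\<xi>. (\<forall>n x. (deriv ^^ n) \<xi> differentiable (at x)) \<and>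
                         (\<exists>K. compact K \<and> (\<forall>x. x \<notin> K \<longrightarrow> \<xi> x = 0))}"

definition has_weak_deriv :: "(real \<Rightarrow> real) \<Rightarrow> (real \<Rightarrow> real) \<Rightarrow> bool" where
  "has_weak_deriv u v \<longleftrightarrow>
     (\<forall>K. compact K \<longrightarrow> u absolutely_integrable_on K \<and> v absolutely_integrable_on K) \<and>
     (\<forall>\<xi>\<in>test_functions. (LINT x|lebesgue. u x * deriv \<xi> x) = - (LINT x|lebesgue. v x * \<xi> x))"

(* Some representative of the weak derivative (unspecified if there is none). *)
definition wderiv :: "(real \<Rightarrow> real) \<Rightarrow> real \<Rightarrow> real" where
  "wderiv u = (SOME v. has_weak_deriv u v)"

definition W1 :: "nat \<Rightarrow> (real \<Rightarrow> real) set" where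
  "W1 p = {u \<in> Lp p. \<exists>v\<in>Lp p. has_weak_deriv u v}"

abbreviation L2 :: "(real \<Rightarrow> real) set" where "L2 \<equiv> Lp 2"

abbreviation H1 :: "(real \<Rightarrow> real) set" where "H1 \<equiv> W1 2"

definition L2_norm :: "(real \<Rightarrow> real) \<Rightarrow> real" where
  "L2_norm u = sqrt (LINT x|lebesgue. (u x)\<^sup>2)"

definition H1_norm :: "(real \<Rightarrow> real) \<Rightarrow> real" where
  "H1_norm u = sqrt ((L2_norm u)\<^sup>2 + (L2_norm (wderiv u))\<^sup>2)"

(* Norm in the dual of H1, for u in L2 identified with the functional
   phi |-> integral of u * phi. *)
definition Hm1_norm :: "(real \<Rightarrow> real) \<Rightarrow> real" where
  "Hm1_norm u = (SUP \<phi>\<in>{\<phi>\<in>H1. H1_norm \<phi> \<le> 1}. \<bar>LINT x|lebesgue. u x * \<phi> x\<bar>)"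

(* Complement of the largest open set on which u vanishes almost everywhere. *)
definition ae_support :: "(real \<Rightarrow> real) \<Rightarrow> real set" where
  "ae_support u = - \<Union>{U. open U \<and> (AE x in lebesgue. x \<in> U \<longrightarrow> u x = 0)}"

(* X is a space of functions with norm N; strong measurability is approximability almost
   everywhere by simple functions. *)
definition strongly_measurable ::
    "(real \<Rightarrow> real) set \<Rightarrow> ((real \<Rightarrow> real) \<Rightarrow> real) \<Rightarrow> (real \<Rightarrow> real \<Rightarrow> real) \<Rightarrow> bool" where
  "strongly_measurable X N u \<longleftrightarrow>
     (AE t in lebesgue_on {0<..}. u t \<in> X) \<and>
     (\<exists>s :: nat \<Rightarrow> real \<Rightarrow> real \<Rightarrow> real.
        (\<forall>n. finite (range (s n)) \<and> range (s n) \<subseteq> X \<and> (\<forall>\<phi>. s n -` {\<phi>} \<in> sets lebesgue)) \<and>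
        (AE t in lebesgue_on {0<..}. (\<lambda>n. N (\<lambda>x. s n t x - u t x)) \<longlonglongrightarrow> 0))"

definition Linf_time ::
    "(real \<Rightarrow> real) set \<Rightarrow> ((real \<Rightarrow> real) \<Rightarrow> real) \<Rightarrow> (real \<Rightarrow> real \<Rightarrow> real) set" where
  "Linf_time X N = {u. strongly_measurable X N u \<and> (\<exists>C. AE t in lebesgue_on {0<..}. N (u t) \<le> C)}"

definition L2_time ::
    "(real \<Rightarrow> real) set \<Rightarrow> ((real \<Rightarrow> real) \<Rightarrow> real) \<Rightarrow> (real \<Rightarrow> real \<Rightarrow> real) set" where
  "L2_time X N = {u. strongly_measurable X N u \<and>
                     (\<integral>\<^sup>+t. ennreal ((N (u t))\<^sup>2) \<partial>lebesgue_on {0<..}) < \<infinity>}"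

(* For L2-valued curves. *)
definition continuous_Hm1 :: "(real \<Rightarrow> real \<Rightarrow> real) \<Rightarrow> bool" where
  "continuous_Hm1 u \<longleftrightarrow>
     (\<forall>t\<ge>0. ((\<lambda>s. Hm1_norm (\<lambda>x. u s x - u t x)) \<longlongrightarrow> 0) (at t within {0..}))"

definition \<K> :: "(real \<Rightarrow> real) set" where
  "\<K> = {u \<in> L2. integrable lebesgue (\<lambda>x. u x * (1 + x\<^sup>2)) \<and> (AE x in lebesgue. 0 \<le> u x)}"

definition energy :: "real \<Rightarrow> (real \<Rightarrow> real) \<Rightarrow> (real \<Rightarrow> real) \<Rightarrow> real" where
  "energy R f g = 1/2 * (LINT x|lebesgue. (f x)\<^sup>2 + R * (f x + g x)\<^sup>2)"

definition weak_solution ::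
    "real \<Rightarrow> real \<Rightarrow> (real \<Rightarrow> real) \<Rightarrow> (real \<Rightarrow> real) \<Rightarrow>
     (real \<Rightarrow> real \<Rightarrow> real) \<Rightarrow> (real \<Rightarrow> real \<Rightarrow> real) \<Rightarrow> bool" where
  "weak_solution R Rmu f0 g0 f g \<longleftrightarrow>
     (\<forall>t\<ge>0. f t \<in> \<K> \<and> g t \<in> \<K>) \<and>
     f \<in> Linf_time L2 L2_norm \<and> g \<in> Linf_time L2 L2_norm \<and>
     f \<in> L2_time H1 H1_norm \<and> g \<in> L2_time H1 H1_norm \<and>
     continuous_Hm1 f \<and> continuous_Hm1 g \<and>
     (AE x in lebesgue. f 0 x = f0 x) \<and> (AE x in lebesgue. g 0 x = g0 x) \<and>
     (\<forall>\<xi>\<in>test_functions. \<forall>t\<ge>0.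
        (LINT x|lebesgue. f t x * \<xi> x) - (LINT x|lebesgue. f0 x * \<xi> x)
        + (LINT \<sigma>:{0..t}|lebesgue. LINT x|lebesgue.
             f \<sigma> x * ((1 + R) * wderiv (f \<sigma>) x + R * wderiv (g \<sigma>) x) * deriv \<xi> x) = 0 \<and>
        (LINT x|lebesgue. g t x * \<xi> x) - (LINT x|lebesgue. g0 x * \<xi> x)
        + Rmu * (LINT \<sigma>:{0..t}|lebesgue. LINT x|lebesgue.
             g \<sigma> x * (wderiv (f \<sigma>) x + wderiv (g \<sigma>) x) * deriv \<xi> x) = 0)"

(* All integrands are nonnegative almost everywhere, so the inequality is stated in [0, \<infinity>];
   in particular finiteness of the dissipation term is part of what it asserts. *)
definition local_energy_estimate ::
    "real \<Rightarrow> real \<Rightarrow> (real \<Rightarrow> real \<Rightarrow> real) \<Rightarrow> (real \<Rightarrow> real \<Rightarrow> real) \<Rightarrow>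
     real \<Rightarrow> (real \<Rightarrow> real) \<Rightarrow> bool" where
  "local_energy_estimate R Rmu f g T \<zeta> \<longleftrightarrow>
     (\<integral>\<^sup>+x. ennreal (((f T x)\<^sup>2 + R * (f T x + g T x)\<^sup>2) * (\<zeta> x)\<^sup>2) \<partial>lebesgue)
     + (\<integral>\<^sup>+t\<in>{0..T}. (\<integral>\<^sup>+x. ennreal
          ((f t x * \<bar>(1 + R) * wderiv (f t) x + R * wderiv (g t) x\<bar>\<^sup>2
            + R * Rmu * g t x * \<bar>wderiv (f t) x + wderiv (g t) x\<bar>\<^sup>2) * (\<zeta> x)\<^sup>2)
          \<partial>lebesgue) \<partial>lebesgue)
     \<le> (\<integral>\<^sup>+x. ennreal (((f 0 x)\<^sup>2 + R * (f 0 x + g 0 x)\<^sup>2) * (\<zeta> x)\<^sup>2) \<partial>lebesgue)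
       + 4 * (\<integral>\<^sup>+t\<in>{0..T}. (\<integral>\<^sup>+x. ennreal
          ((f t x * ((1 + R) * f t x + R * g t x)\<^sup>2
            + R * Rmu * g t x * (f t x + g t x)\<^sup>2) * \<bar>wderiv \<zeta> x\<bar>\<^sup>2)
          \<partial>lebesgue) \<partial>lebesgue)"

definition energy_weak_solution ::
    "real \<Rightarrow> real \<Rightarrow> (real \<Rightarrow> real) \<Rightarrow> (real \<Rightarrow> real) \<Rightarrow>
     (real \<Rightarrow> real \<Rightarrow> real) \<Rightarrow> (real \<Rightarrow> real \<Rightarrow> real) \<Rightarrow> bool" where
  "energy_weak_solution R Rmu f0 g0 f g \<longleftrightarrow>
     weak_solution R Rmu f0 g0 f g \<and>
     (\<forall>T>0. (\<forall>\<zeta>\<in>W1 4. local_energy_estimate R Rmu f g T \<zeta>) \<and>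
             local_energy_estimate R Rmu f g T (\<lambda>x. 1))"

(* The endpoint C * r0^(5/2) / E^(1/2); in ereal the quotient is \<infinity> if the energy E vanishes,
   whereas real division would give 0. *)
definition propagation_time :: "real \<Rightarrow> real \<Rightarrow> (real \<Rightarrow> real) \<Rightarrow> (real \<Rightarrow> real) \<Rightarrow> real \<Rightarrow> ereal" where
  "propagation_time C R f0 g0 r0 = ereal (C * r0 powr (5/2)) / ereal (sqrt (energy R f0 g0))"

end

(* Write u = f + g and F = (1 + R) f + R g. The dissipation f (F_x)^2 + R Rmu g (u_x)^2 controls neither
   f^(3/2) nor g^(3/2) in H^1, but it does control psi (psi_x)^2 for the single function
   psi = max u (2 F / (1 + 2 R)), which is comparable to u: where f > g the maximum is the second term and
   f is comparable to psi, where g > f it is the first one and g is comparable to psi. Since everything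
   else in the local energy estimate is comparable to a power of u, this reduces it to a scalar one.

   For balls B' and B with distance delta of the boundaries, lying off the initial support, the estimate
   bounds the energy and the dissipation on B' by delta^(-2) Y(B), Y(B) being the space-time integral
   of u^3 over B, and one-dimensional interpolation bounds Y(B') by a superlinear function of these
   quantities. Stampacchia's iteration over shrinking balls of radius between r/2 and r then gives u(T) = 0
   on the smallest one as soon as Y <= eps r^7 / T^2 on the largest one. The global energy estimate provides
   this smallness if T is at most C r^(5/2) / E^(1/2). For the rate T^(1/3) the energy cannot be restarted
   at later times; instead the conserved mass M and absorption over growing balls give
   Y <= C T M^3 / r^2, which is small enough as soon as r^3 is at least a multiple of T M. *)

theory Submission
  imports Defs
begin

text \<open>The factor \<open>2 / (1 + 2 * R)\<close> makes \<open>F - u\<close> a multiple of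
  \<open>f - g\<close>: the terms of the maximum change roles exactly where \<open>f = g\<close>,
  and there both components are comparable to \<open>psi\<close>. The increments of
  \<open>psi^2\<close> are then bounded by integrals of \<open>psi\<close> and of the dissipation,
  with no root of a function that may vanish. The powers of r and T come from the scaling of the
  system, under which u has the size r^2 / T: then Y has the size r^7 / T^2, the energy r^5 / T^2
  and the mass r^3 / T. The first is the smallness condition, the other two are the thresholds for T
  in the two claims. The obstacle is measurability in time: the dissipation on a ball, as a function
  of t, is not known to be measurable. Interpolation is therefore used only in the form (cube
  integral) \<le> c (dissipation) + b at almost every time, with c and b constant in t. Young's
  inequality with a free parameter takes the place of Hoelder's inequality in time, and the
  superlinear gain as well as the absorption result from the choice of this parameter.\<close>

section \<open>Lower integrals and smooth functions\<close>

text \<open>The time integrands are not known to be measurable, so their integrals are lower integrals,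
  which are only superadditive in general.\<close>

lemma nn_integral_add_le:
  assumes G: "G \<in> borel_measurable M" and fin: "\<And>x. x \<in> space M \<Longrightarrow> G x < \<infinity>"
  shows "(\<integral>\<^sup>+x. F x + G x \<partial>M) \<le> (\<integral>\<^sup>+x. F x \<partial>M) + (\<integral>\<^sup>+x. G x \<partial>M)"
proof -
  have "integral\<^sup>S M h \<le> (\<integral>\<^sup>+x. F x \<partial>M) + (\<integral>\<^sup>+x. G x \<partial>M)"
    if h: "simple_function M h" "h \<le> (\<lambda>x. F x + G x)" for h
  proof -
    note [measurable] = G borel_measurable_simple_function[OF h(1)]
    have le: "h x \<le> F x + G x" for x using h(2) by (auto simp: le_fun_def)
    have "integral\<^sup>S M h = (\<integral>\<^sup>+x. h x \<partial>M)" using h(1) by (simp add: nn_integral_eq_simple_integral)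
    \<comment> \<open>\<open>h - G\<close> is measurable although \<open>F\<close> need not be, and
      finiteness of \<open>G\<close> puts it below \<open>F\<close>.\<close>
    also have "\<dots> \<le> (\<integral>\<^sup>+x. (h x - G x) + G x \<partial>M)"
    proof (intro nn_integral_mono)
      fix x show "h x \<le> h x - G x + G x"
        using ennreal_minus_le_iff[of "h x" "G x" "h x - G x"] by (cases "h x = top \<and> G x = top") (auto simp: add.commute)
    qed
    also have "\<dots> = (\<integral>\<^sup>+x. h x - G x \<partial>M) + (\<integral>\<^sup>+x. G x \<partial>M)"
      by (rule nn_integral_add) auto
    also have "(\<integral>\<^sup>+x. h x - G x \<partial>M) \<le> (\<integral>\<^sup>+x. F x \<partial>M)"
    proof (intro nn_integral_mono)
      fix x assume "x \<in> space M"
      then show "h x - G x \<le> F x" using fin[of x] le[of x] by (auto simp: ennreal_minus_le_iff add.commute)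
    qed
    finally show ?thesis by (simp add: add_right_mono)
  qed
  then show ?thesis by (auto simp: nn_integral_def[of M "\<lambda>x. F x + G x"] intro!: SUP_least)
qed

text \<open>Dividing a simple function below \<open>c * F\<close> by \<open>c\<close> gives one
  below \<open>F\<close>; as both integrals are suprema over simple functions, this works for
  arbitrary \<open>F\<close>.\<close>

lemma nn_integral_cmult_le:
  assumes c: "c > 0"
  shows "(\<integral>\<^sup>+x. ennreal c * F x \<partial>M) \<le> ennreal c * (\<integral>\<^sup>+x. F x \<partial>M)"
proof -
  have "integral\<^sup>S M h \<le> ennreal c * (\<integral>\<^sup>+x. F x \<partial>M)"
    if h: "simple_function M h" "h \<le> (\<lambda>x. ennreal c * F x)" for h
  proof -
    note [measurable] = borel_measurable_simple_function[OF h(1)]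
    have le: "h x \<le> ennreal c * F x" for x using h(2) by (auto simp: le_fun_def)
    have cc: "ennreal c * ennreal (1 / c) = 1"
      using c by (simp add: ennreal_mult[symmetric])
    have le2: "ennreal (1/c) * h x \<le> F x" for x
      using mult_left_mono[OF le[of x], of "ennreal (1/c)"] cc
      by (metis ab_semigroup_mult_class.mult_ac(1) mult.commute mult_1 zero_le)
    have "integral\<^sup>S M h = (\<integral>\<^sup>+x. h x \<partial>M)" using h(1) by (simp add: nn_integral_eq_simple_integral)
    also have "\<dots> = (\<integral>\<^sup>+x. ennreal c * (ennreal (1/c) * h x) \<partial>M)"
      using cc by (simp add: mult.assoc[symmetric])
    also have "\<dots> = ennreal c * (\<integral>\<^sup>+x. ennreal (1/c) * h x \<partial>M)"
      by (rule nn_integral_cmult) auto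
    also have "\<dots> \<le> ennreal c * (\<integral>\<^sup>+x. F x \<partial>M)"
      by (intro mult_left_mono nn_integral_mono) (auto simp: le2)
    finally show ?thesis .
  qed
  then show ?thesis by (auto simp: nn_integral_def[of M "\<lambda>x. ennreal c * F x"] intro!: SUP_least)
qed

text \<open>The shape in which the interpolation inequalities are integrated in time: the part
  without measurability carries only a constant factor, and the added term is constant, hence
  measurable.\<close>

lemma nn_integral_affine_le:
  assumes "a > 0" "b \<ge> 0" "T \<ge> 0"
  shows "(\<integral>\<^sup>+t\<in>{0..T}. (ennreal a * F t + ennreal b) \<partial>lebesgue)
    \<le> ennreal a * (\<integral>\<^sup>+t\<in>{0..T}. F t \<partial>lebesgue) + ennreal (b * T)"
proof -
  have "(\<integral>\<^sup>+t\<in>{0..T}. (ennreal a * F t + ennreal b) \<partial>lebesgue) =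
    (\<integral>\<^sup>+t. ennreal a * (F t * indicator {0..T} t) + ennreal b * indicator {0..T} t \<partial>lebesgue)"
    by (intro nn_integral_cong) (auto simp: indicator_def)
  also have "\<dots> \<le> (\<integral>\<^sup>+t. ennreal a * (F t * indicator {0..T} t) \<partial>lebesgue)
      + (\<integral>\<^sup>+t. ennreal b * indicator {0..T} t \<partial>lebesgue)"
    by (intro nn_integral_add_le borel_measurable_times_ennreal borel_measurable_indicator)
      (auto split: split_indicator)
  also have "(\<integral>\<^sup>+t. ennreal b * indicator {0..T} t \<partial>lebesgue) = ennreal (b*T)"
    using assms by (subst nn_integral_cmult_indicator) (auto simp: ennreal_mult)
  also have "(\<integral>\<^sup>+t. ennreal a * (F t * indicator {0..T} t) \<partial>lebesgue) \<le>
     ennreal a * (\<integral>\<^sup>+t\<in>{0..T}. F t \<partial>lebesgue)"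
    using assms by (intro nn_integral_cmult_le) auto
  finally show ?thesis by (simp add: add_right_mono)
qed

section \<open>Closure properties of smooth functions\<close>

definition smooth :: "(real \<Rightarrow> real) \<Rightarrow> bool" where
  "smooth f \<longleftrightarrow> (\<forall>n x. (deriv ^^ n) f differentiable (at x))"

text \<open>Coinduction for smoothness: placing \<open>f\<close> in a class of differentiable
  functions closed under \<open>deriv\<close> avoids formulas for higher derivatives.\<close>

lemma smoothI:
  assumes "f \<in> A" "\<And>h x. h \<in> A \<Longrightarrow> h differentiable (at x)" "\<And>h. h \<in> A \<Longrightarrow> deriv h \<in> A"
  shows "smooth f"
proof -
  have "(deriv ^^ n) f \<in> A" for n by (induction n) (auto simp: assms)
  then show ?thesis by (auto simp: smooth_def assms)
qed

lemma smooth_differentiable: "smooth f \<Longrightarrow> f differentiable (at x)"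
  unfolding smooth_def by (metis funpow_0)

lemma smooth_has_deriv: "smooth f \<Longrightarrow> (f has_real_derivative deriv f x) (at x)"
  by (simp add: DERIV_deriv_iff_real_differentiable smooth_differentiable)

lemma smooth_deriv: "smooth f \<Longrightarrow> smooth (deriv f)"
  unfolding smooth_def by (metis funpow_Suc_right o_apply)

lemma smooth_continuous: "smooth f \<Longrightarrow> continuous_on S f"
  by (meson continuous_at_imp_continuous_on differentiable_imp_continuous_within smooth_differentiable)

lemma smooth_antideriv:
  assumes "\<And>x. (F has_real_derivative f x) (at x)" "smooth f"
  shows "smooth F"
proof -
  have d: "deriv F = f" using assms(1) by (auto intro!: ext DERIV_imp_deriv)
  show ?thesis unfolding smooth_def
  proof (intro allI)
    fix n x show "(deriv ^^ n) F differentiable (at x)"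
    proof (cases n)
      case 0 then show ?thesis using assms(1)[of x] by (auto simp: real_differentiable_def)
    next
      case (Suc m) then show ?thesis using assms(2) d unfolding smooth_def by (simp add: funpow_swap1)
    qed
  qed
qed

lemma smooth_affine:
  assumes "smooth f"
  shows "smooth (\<lambda>x. c * f (p * x + q))"
proof (rule smoothI[where A = "{\<lambda>x. c * h (p * x + q) | c h. smooth h}"])
  show "(\<lambda>x. c * f (p * x + q)) \<in> {\<lambda>x. c * h (p * x + q) | c h. smooth h}" using assms by auto
  fix g x assume "g \<in> {\<lambda>x. c * h (p * x + q) | c h. smooth h}"
  then obtain c h where g: "g = (\<lambda>x. c * h (p * x + q))" and h: "smooth h" by auto
  have D: "(g has_real_derivative (c * p) * deriv h (p * x + q)) (at x)" for x
    unfolding g by (rule derivative_eq_intros DERIV_chain2[OF smooth_has_deriv[OF h]] refl | simp)+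
  show "g differentiable (at x)" using D by (auto simp: real_differentiable_def)
  have "deriv g = (\<lambda>x. (c * p) * deriv h (p * x + q))" using D by (auto intro!: ext DERIV_imp_deriv)
  then show "deriv g \<in> {\<lambda>x. c * h (p * x + q) | c h. smooth h}" using smooth_deriv[OF h] by auto
qed

lemma smooth_add:
  assumes "smooth f" "smooth g"
  shows "smooth (\<lambda>x. f x + g x)"
proof (rule smoothI[where A = "{\<lambda>x. f x + g x | f g. smooth f \<and> smooth g}"])
  show "(\<lambda>x. f x + g x) \<in> {\<lambda>x. f x + g x | f g. smooth f \<and> smooth g}" using assms by auto
  fix k x assume "k \<in> {\<lambda>x. f x + g x | f g. smooth f \<and> smooth g}"
  then obtain f g where k: "k = (\<lambda>x. f x + g x)" and fg: "smooth f" "smooth g" by auto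
  have D: "(k has_real_derivative deriv f x + deriv g x) (at x)" for x
    unfolding k by (intro DERIV_add smooth_has_deriv fg)
  show "k differentiable (at x)" using D by (auto simp: real_differentiable_def)
  have "deriv k = (\<lambda>x. deriv f x + deriv g x)" using D by (auto intro!: ext DERIV_imp_deriv)
  then show "deriv k \<in> {\<lambda>x. f x + g x | f g. smooth f \<and> smooth g}" using fg smooth_deriv by auto
qed

lemma smooth_scale: "smooth f \<Longrightarrow> smooth (\<lambda>x. c * f x)"
  using smooth_affine[of f c 1 0] by simp

lemma smooth_diff: "smooth f \<Longrightarrow> smooth g \<Longrightarrow> smooth (\<lambda>x. f x - g x)"
  using smooth_add[of f "\<lambda>x. -1 * g x"] smooth_scale[of g "-1"] by simp

text \<open>Products alone are not closed under \<open>deriv\<close>, but by Leibniz' rule their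
  finite sums are; this is the class to be used in \<open>smoothI\<close>.\<close>

inductive_set prod_span :: "(real \<Rightarrow> real) set" where
  base: "smooth f \<Longrightarrow> smooth g \<Longrightarrow> (\<lambda>x. f x * g x) \<in> prod_span"
| add: "h \<in> prod_span \<Longrightarrow> k \<in> prod_span \<Longrightarrow> (\<lambda>x. h x + k x) \<in> prod_span"

lemma smooth_mult:
  assumes "smooth f" "smooth g"
  shows "smooth (\<lambda>x. f x * g x)"
proof (rule smoothI)
  show "(\<lambda>x. f x * g x) \<in> prod_span" using assms by (rule prod_span.base)
  fix h assume h: "h \<in> prod_span"
  then have *: "\<exists>h'\<in>prod_span. \<forall>x. (h has_real_derivative h' x) (at x)"
  proof induction
    case (base f g)
    have "(\<lambda>x. deriv f x * g x + f x * deriv g x) \<in> prod_span"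
      by (intro prod_span.intros base smooth_deriv)
    moreover have "((\<lambda>x. f x * g x) has_real_derivative deriv f x * g x + f x * deriv g x) (at x)" for x
      using DERIV_mult[OF smooth_has_deriv[OF base(1)] smooth_has_deriv[OF base(2)], of x]
      by (simp add: mult.commute)
    ultimately show ?case by (intro bexI[of _ "\<lambda>x. deriv f x * g x + f x * deriv g x"]) auto
  next
    case (add h k)
    then obtain h' k' where "h' \<in> prod_span" "\<And>x. (h has_real_derivative h' x) (at x)"
      "k' \<in> prod_span" "\<And>x. (k has_real_derivative k' x) (at x)" by blast
    then show ?case by (intro bexI[of _ "\<lambda>x. h' x + k' x"] prod_span.add allI DERIV_add)
  qed
  then show "h differentiable (at x)" for x by (auto simp: real_differentiable_def)
  from * obtain h' where h': "h' \<in> prod_span" "\<And>x. (h has_real_derivative h' x) (at x)" by blast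
  have "deriv h = h'" by (intro ext DERIV_imp_deriv h')
  then show "deriv h \<in> prod_span" using h' by simp
qed

section \<open>A smooth step function\<close>

definition flat :: "real poly \<Rightarrow> real \<Rightarrow> real" where
  "flat p x = (if x > 0 then poly p (1/x) * exp (-1/x) else 0)"

lemma poly_exp_tendsto_0: "((\<lambda>y. poly p y / exp y) \<longlongrightarrow> (0::real)) at_top"
proof -
  have "((\<lambda>y. \<Sum>i\<le>degree p. coeff p i * (y ^ i / exp y)) \<longlongrightarrow> (\<Sum>i\<le>degree p. coeff p i * (0::real))) at_top"
    by (intro tendsto_sum tendsto_mult tendsto_const tendsto_power_div_exp_0)
  moreover have "(\<Sum>i\<le>degree p. coeff p i * (y ^ i / exp y)) = poly p y / exp y" for y
    by (simp add: poly_altdef sum_divide_distrib)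
  ultimately show ?thesis by simp
qed

text \<open>With y = 1/x, the derivative of p(y) exp(-y) in x is y^2 (p(y) - p'(y)) exp(-y), of the
  same form with another polynomial; so the range of \<open>flat\<close> serves as a class for
  \<open>smoothI\<close>.\<close>

lemma flat_has_deriv: "(flat p has_real_derivative flat ([:0,0,1:] * (p - pderiv p)) x) (at x)"
proof -
  define q where "q = [:0,0,1:] * (p - pderiv p)"
  have q: "poly q y = y\<^sup>2 * (poly p y - poly (pderiv p) y)" for y
    by (simp add: q_def power2_eq_square)
  consider "x < 0" | "x = 0" | "x > 0" by linarith
  then have "(flat p has_real_derivative flat q x) (at x)"
  proof cases
    case 1
    have "((\<lambda>x. 0) has_real_derivative flat q x) (at x)" using 1 by (simp add: flat_def)
    moreover have "\<forall>\<^sub>F y in nhds x. flat p y = 0"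
      using eventually_nhds_in_open[of "{..<0}" x] 1 by (auto simp: flat_def elim: eventually_mono)
    ultimately show ?thesis by (subst DERIV_cong_ev[OF refl _ refl])
  next
    case 2
    have "((\<lambda>y. flat p y / y) \<longlongrightarrow> 0) (at_right 0)"
    proof (rule tendsto_cong[THEN iffD2])
      show "\<forall>\<^sub>F y in at_right 0. flat p y / y = poly ([:0,1:] * p) (1/y) / exp (1/y)"
      proof (rule eventually_mono[OF eventually_at_right_less])
        fix y :: real assume y: "0 < y"
        have "exp (- 1 / y) = 1 / exp (1 / y)" by (simp add: exp_minus inverse_eq_divide)
        then show "flat p y / y = poly ([:0,1:] * p) (1/y) / exp (1/y)" using y by (simp add: flat_def)
      qed
      show "((\<lambda>y. poly ([:0,1:] * p) (1/y) / exp (1/y)) \<longlongrightarrow> (0::real)) (at_right 0)"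
        using filterlim_compose[OF poly_exp_tendsto_0[of "[:0,1:] * p"] filterlim_inverse_at_top_right]
        by (simp add: inverse_eq_divide)
    qed
    moreover have "((\<lambda>y. flat p y / y) \<longlongrightarrow> 0) (at_left 0)"
      by (rule tendsto_eventually)
        (auto simp: flat_def eventually_at_left_field intro!: exI[of _ "-1"])
    ultimately have "((\<lambda>y. flat p y / y) \<longlongrightarrow> 0) (at 0)" by (simp add: filterlim_at_split)
    then show ?thesis using 2 by (simp add: has_field_derivative_iff flat_def)
  next
    case 3
    have "((\<lambda>x. poly p (1/x) * exp (-1/x)) has_real_derivative flat q x) (at x)"
    proof -
      have 1: "((\<lambda>x. 1/x) has_real_derivative - (1/x\<^sup>2)) (at x)"
        using 3 by (auto intro!: derivative_eq_intros simp: power2_eq_square)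
      then have 2: "((\<lambda>x. -1/x) has_real_derivative 1/x\<^sup>2) (at x)"
        using DERIV_minus by fastforce
      have "flat q x = exp (-1/x) * (1/x\<^sup>2) * poly p (1/x) + poly (pderiv p) (1/x) * - (1/x\<^sup>2) * exp (-1/x)"
        using 3 by (simp add: flat_def q power_one_over algebra_simps)
      then show ?thesis
        using DERIV_mult[OF DERIV_chain2[OF poly_DERIV 1] DERIV_chain2[OF DERIV_exp 2]]
        by (simp only: add.commute mult.commute mult.left_commute)
    qed
    moreover have "\<forall>\<^sub>F y in nhds x. flat p y = poly p (1/y) * exp (-1/y)"
      using eventually_nhds_in_open[of "{0<..}" x] 3 by (auto simp: flat_def elim: eventually_mono)
    ultimately show ?thesis by (subst DERIV_cong_ev[OF refl _ refl])
  qed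
  then show ?thesis by (simp only: q_def)
qed

lemma smooth_flat: "smooth (flat p)"
proof (rule smoothI[where A="range flat"])
  fix h x assume "h \<in> range flat"
  then obtain p where p: "h = flat p" by auto
  show "h differentiable (at x)" using flat_has_deriv[of p x] p by (auto simp: real_differentiable_def)
  have "deriv h = flat ([:0,0,1:] * (p - pderiv p))"
    using flat_has_deriv[of p] p by (auto intro!: ext DERIV_imp_deriv)
  then show "deriv h \<in> range flat" by auto
qed auto

definition bump0 :: "real \<Rightarrow> real" where "bump0 x = flat 1 x * flat 1 (1 - x)"

lemma smooth_bump0: "smooth bump0"
proof -
  have "smooth (\<lambda>x. 1 * flat 1 (-1 * x + 1))" by (intro smooth_affine smooth_flat)
  then have "smooth (\<lambda>x. flat 1 (1 - x))" by simp
  from smooth_mult[OF smooth_flat[of 1] this] show ?thesis by (simp add: bump0_def[abs_def])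
qed

lemma bump0_nonneg: "bump0 x \<ge> 0"
  by (simp add: bump0_def flat_def)

lemma bump0_pos: "0 < x \<Longrightarrow> x < 1 \<Longrightarrow> bump0 x > 0"
  by (simp add: bump0_def flat_def)

lemma bump0_0: "x \<le> 0 \<or> x \<ge> 1 \<Longrightarrow> bump0 x = 0"
  by (auto simp: bump0_def flat_def)

text \<open>The base point \<open>L\<close> lies strictly left of the support of \<open>h\<close>.
  To its left the interval \<open>{L..u}\<close> is empty and the integral is 0 by convention, in
  agreement with \<open>h = 0\<close> there.\<close>

lemma integral_has_deriv_at:
  fixes h :: "real \<Rightarrow> real"
  assumes cont: "continuous_on UNIV h" and 0: "\<And>x. x \<le> K \<Longrightarrow> h x = 0" and "L < K"
  shows "((\<lambda>u. integral {L..u} h) has_real_derivative h x) (at x)"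
proof (cases "x > L")
  case True
  have "((\<lambda>u. integral {L..u} h) has_vector_derivative h x) (at x within {L..x+1})"
    using True by (intro integral_has_vector_derivative continuous_on_subset[OF cont]) auto
  then show ?thesis
    using True at_within_Icc_at[of L x "x+1"]
    by (simp add: has_real_derivative_iff_has_vector_derivative)
next
  case False
  have "integral {L..y} h = integral {L..y} (\<lambda>x. 0)" if "y < K" for y
    using that by (intro integral_cong) (auto simp: 0)
  then have "\<forall>\<^sub>F y in nhds x. integral {L..y} h = 0"
    using eventually_nhds_in_open[of "{..<K}" x] False \<open>L < K\<close> by (auto elim!: eventually_mono)
  moreover have "((\<lambda>x. 0) has_real_derivative h x) (at x)"
    using False \<open>L < K\<close> by (simp add: 0)
  ultimately show ?thesis by (subst DERIV_cong_ev[OF refl _ refl])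
qed

text \<open>The base point -1 instead of 0 leaves the gap to the support of \<open>bump0\<close>
  that \<open>integral_has_deriv_at\<close> asks for.\<close>

definition step :: "real \<Rightarrow> real" where
  "step x = integral {-1..x} bump0 / integral {-1..1} bump0"

lemma bump0_integrable: "bump0 integrable_on {a..b}"
  by (intro integrable_continuous_real smooth_continuous smooth_bump0)

lemma integral_bump0_pos: "integral {-1..1} bump0 > 0"
proof -
  have "integral {-1..1} bump0 \<noteq> 0"
  proof
    assume "integral {-1..1} bump0 = 0"
    then have "(bump0 has_integral 0) (cbox (-1) 1)"
      using bump0_integrable[of "-1" 1] by (metis box_real(2) integrable_integral)
    then have "bump0 (1/2) = 0"
      using has_integral_0_cbox_imp_0[of "-1" 1 bump0 "1/2"] smooth_continuous[OF smooth_bump0] bump0_nonneg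
      by auto
    then show False using bump0_pos[of "1/2"] by auto
  qed
  moreover have "integral {-1..1} bump0 \<ge> 0" by (intro integral_nonneg bump0_integrable) (auto simp: bump0_nonneg)
  ultimately show ?thesis by auto
qed

lemma step_0: "x \<le> 0 \<Longrightarrow> step x = 0"
proof -
  assume "x \<le> 0"
  then have "integral {-1..x} bump0 = integral {-1..x} (\<lambda>x. 0)"
    by (intro integral_cong) (auto simp: bump0_0)
  then show ?thesis by (simp add: step_def)
qed

lemma step_1: "x \<ge> 1 \<Longrightarrow> step x = 1"
proof -
  assume x: "x \<ge> 1"
  have "integral {-1..1} bump0 + integral {1..x} bump0 = integral {-1..x} bump0"
    using x bump0_integrable by (intro Henstock_Kurzweil_Integration.integral_combine) auto
  moreover have "integral {1..x} bump0 = integral {1..x} (\<lambda>x. 0)"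
    by (intro integral_cong) (auto simp: bump0_0)
  ultimately show ?thesis using integral_bump0_pos by (simp add: step_def)
qed

lemma step_mono: "x \<le> y \<Longrightarrow> step x \<le> step y"
  unfolding step_def using integral_bump0_pos
  by (intro divide_right_mono integral_subset_le bump0_integrable) (auto simp: bump0_nonneg)

lemma step_bounds: "0 \<le> step x" "step x \<le> 1"
  using step_mono[of x "max x 1"] step_mono[of "min x 0" x] step_0[of "min x 0"] step_1[of "max x 1"] by auto

lemma step_has_deriv: "(step has_real_derivative bump0 x / integral {-1..1} bump0) (at x)"
  unfolding step_def[abs_def]
  by (intro DERIV_cdivide integral_has_deriv_at[where K=0] smooth_continuous smooth_bump0)
    (auto simp: bump0_0)

lemma smooth_step: "smooth step"
  by (rule smooth_antideriv[OF step_has_deriv])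
    (use smooth_scale[OF smooth_bump0, of "1 / integral {-1..1} bump0"] in simp)

section \<open>Weak derivatives\<close>

definition locally_integrable :: "(real \<Rightarrow> real) \<Rightarrow> bool" where
  "locally_integrable w \<longleftrightarrow> (\<forall>a b. set_integrable lebesgue {a..b} w)"

lemma locally_integrable_compact:
  "locally_integrable w \<longleftrightarrow> (\<forall>K. compact K \<longrightarrow> w absolutely_integrable_on K)"
proof
  assume w: "locally_integrable w"
  show "\<forall>K. compact K \<longrightarrow> w absolutely_integrable_on K"
  proof (intro allI impI)
    fix K :: "real set" assume K: "compact K"
    then obtain a b where "K \<subseteq> {a..b}" using bounded_subset_cbox_symmetric[OF compact_imp_bounded[OF K]] by (metis box_real(2))
    moreover have "K \<in> sets lebesgue" using K by (simp add: compact_imp_closed lmeasurable_compact fmeasurableD)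
    ultimately show "w absolutely_integrable_on K"
      using w set_integrable_subset unfolding locally_integrable_def by blast
  qed
qed (auto simp: locally_integrable_def)

lemma test_functions_iff:
  "xi \<in> test_functions \<longleftrightarrow> smooth xi \<and> (\<exists>N>0. \<forall>x. \<bar>x\<bar> \<ge> N \<longrightarrow> xi x = 0)"
proof -
  have "(\<exists>K. compact K \<and> (\<forall>x. x \<notin> K \<longrightarrow> xi x = 0)) \<longleftrightarrow> (\<exists>N>0. \<forall>x. \<bar>x\<bar> \<ge> N \<longrightarrow> xi x = 0)"
  proof
    assume "\<exists>K. compact K \<and> (\<forall>x. x \<notin> K \<longrightarrow> xi x = 0)"
    then obtain K where K: "compact K" "\<And>x. x \<notin> K \<Longrightarrow> xi x = 0" by auto
    then obtain B where "\<And>x. x \<in> K \<Longrightarrow> \<bar>x\<bar> \<le> B"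
      using compact_imp_bounded[OF K(1)] unfolding bounded_iff by auto
    then have "\<forall>x. \<bar>x\<bar> \<ge> max B 0 + 1 \<longrightarrow> xi x = 0" using K(2) by force
    then show "\<exists>N>0. \<forall>x. \<bar>x\<bar> \<ge> N \<longrightarrow> xi x = 0" by (intro exI[of _ "max B 0 + 1"]) auto
  next
    assume "\<exists>N>0. \<forall>x. \<bar>x\<bar> \<ge> N \<longrightarrow> xi x = 0"
    then obtain N where "\<forall>x. \<bar>x\<bar> \<ge> N \<longrightarrow> xi x = 0" by auto
    then show "\<exists>K. compact K \<and> (\<forall>x. x \<notin> K \<longrightarrow> xi x = 0)" by (intro exI[of _ "{-N..N}"]) auto
  qed
  then show ?thesis by (simp add: test_functions_def smooth_def)
qed

text \<open>For large \<open>n\<close> these approximate the indicator of \<open>{a<..b}\<close>, as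
  needed in \<open>fundamental_lemma\<close>; for fixed \<open>n\<close> they are the cutoffs of the
  energy estimate.\<close>

lemma test_function_step:
  assumes "n > 0" "a \<le> b"
  shows "(\<lambda>x. step (n * (x - a)) - step (n * (x - b))) \<in> test_functions"
proof -
  have "smooth (\<lambda>x. step (n * (x - c)))" for c
    using smooth_affine[OF smooth_step, of 1 n "-n*c"] by (simp add: algebra_simps)
  moreover have "step (n * (x - a)) - step (n * (x - b)) = 0" if x: "\<bar>x\<bar> \<ge> \<bar>a\<bar> + \<bar>b\<bar> + 1/n + 1" for x
  proof (cases "x \<le> a")
    case True
    then have "n * (x - a) \<le> 0" "n * (x - b) \<le> 0" using assms by (auto simp: mult_le_0_iff)
    then show ?thesis by (simp add: step_0)
  next
    case False
    have "1/n > 0" using assms by simp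
    then have "x \<ge> b + 1/n" using x False assms by arith
    then have "x - b \<ge> 1/n" "x - a \<ge> 1/n" using assms by auto
    then have "n * (x - a) \<ge> 1" "n * (x - b) \<ge> 1" using assms by (auto simp: field_simps)
    then show ?thesis by (simp add: step_1)
  qed
  moreover have "\<bar>a\<bar> + \<bar>b\<bar> + 1/n + 1 > 0" using assms by (simp add: add_nonneg_pos)
  ultimately show ?thesis unfolding test_functions_iff
    by (intro conjI smooth_diff exI[of _ "\<bar>a\<bar> + \<bar>b\<bar> + 1/n + 1"]) auto
qed

lemma test_function_deriv:
  assumes "xi \<in> test_functions"
  shows "deriv xi \<in> test_functions"
proof -
  obtain N where N: "N > 0" "smooth xi" "\<And>x. \<bar>x\<bar> \<ge> N \<Longrightarrow> xi x = 0" using assms by (auto simp: test_functions_iff)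
  have "deriv xi x = 0" if "\<bar>x\<bar> \<ge> N + 1" for x
  proof (rule DERIV_imp_deriv)
    have "\<forall>\<^sub>F y in nhds x. xi y = 0"
      by (rule eventually_mono[OF eventually_nhds_in_open[of "ball x 1" x]])
       (use that in \<open>auto intro!: N simp: dist_real_def\<close>)
    then show "(xi has_real_derivative 0) (at x)"
      by (subst DERIV_cong_ev[OF refl _ refl, of _ "\<lambda>_. 0"]) auto
  qed
  then show ?thesis unfolding test_functions_iff using N by (auto intro!: smooth_deriv exI[of _ "N+1"])
qed

lemma test_function_bounded:
  assumes "xi \<in> test_functions"
  obtains B where "\<And>x. \<bar>xi x\<bar> \<le> B" "B > 0"
proof -
  obtain N where N: "N > 0" "smooth xi" "\<And>x. \<bar>x\<bar> \<ge> N \<Longrightarrow> xi x = 0" using assms by (auto simp: test_functions_iff)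
  have "compact (xi ` {-N..N})" using N by (intro compact_continuous_image smooth_continuous) auto
  then obtain B where B: "\<forall>x\<in>{-N..N}. \<bar>xi x\<bar> \<le> B"
    using compact_imp_bounded[of "xi ` {-N..N}"] unfolding bounded_iff by auto
  have "\<bar>xi x\<bar> \<le> max B 1" for x using B[rule_format, of x] N(3)[of x]
    by (cases "\<bar>x\<bar> \<ge> N") (auto simp: max_def abs_less_iff not_le)
  then show ?thesis using that[of "max B 1"] by auto
qed

section \<open>Integrals against test functions and the fundamental lemma\<close>

lemma smooth_borel: "smooth f \<Longrightarrow> f \<in> borel_measurable borel"
  by (intro borel_measurable_continuous_onI smooth_continuous)

lemma smooth_lebesgue: "smooth f \<Longrightarrow> f \<in> borel_measurable lebesgue"
  by (rule measurable_completion) (simp add: smooth_borel)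

lemma integrable_bounded_mult:
  fixes w xi :: "real \<Rightarrow> real"
  assumes w: "set_integrable lebesgue {a..b} w" and xi: "xi \<in> borel_measurable lebesgue"
    and B: "\<And>x. \<bar>xi x\<bar> \<le> B" and 0: "\<And>x. x \<notin> {a..b} \<Longrightarrow> xi x = 0"
  shows "integrable lebesgue (\<lambda>x. w x * xi x)"
proof -
  have i: "integrable lebesgue (\<lambda>x. indicator {a..b} x * w x)" using w by (simp add: set_integrable_def)
  have eq: "w x * xi x = (indicator {a..b} x * w x) * xi x" for x using 0[of x] by (cases "x \<in> {a..b}") auto
  show ?thesis unfolding eq
  proof (rule Bochner_Integration.integrable_bound)
    show "integrable lebesgue (\<lambda>x. (indicator {a..b} x * w x) * B)" using i by simp
    show "(\<lambda>x. (indicator {a..b} x * w x) * xi x) \<in> borel_measurable lebesgue"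
      by (rule borel_measurable_times[OF borel_measurable_integrable[OF i] xi])
    show "AE x in lebesgue. norm ((indicator {a..b} x * w x) * xi x) \<le> norm ((indicator {a..b} x * w x) * B)"
      using B order_trans[OF B abs_ge_self] by (intro AE_I2) (auto simp: abs_mult intro!: mult_left_mono)
  qed
qed

lemma integrable_mult_test:
  assumes w: "locally_integrable w" and "xi \<in> test_functions"
  shows "integrable lebesgue (\<lambda>x. w x * xi x)"
proof -
  obtain N where N: "smooth xi" "\<And>x. \<bar>x\<bar> \<ge> N \<Longrightarrow> xi x = 0" using assms by (auto simp: test_functions_iff)
  obtain B where "\<And>x. \<bar>xi x\<bar> \<le> B" using test_function_bounded assms by metis
  then show ?thesis using N w
    by (intro integrable_bounded_mult[where a="-N" and b="N" and B=B] smooth_lebesgue) (auto simp: locally_integrable_def)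
qed

lemma locally_integrable_measurable:
  assumes "locally_integrable w" shows "w \<in> borel_measurable lebesgue"
proof (rule borel_measurable_LIMSEQ_metric)
  show "(\<lambda>x. indicator {-real n..real n} x * w x) \<in> borel_measurable lebesgue" for n
    using assms unfolding locally_integrable_def set_integrable_def by fastforce
  fix x
  obtain n0 where "\<bar>x\<bar> \<le> real n0" using real_arch_simple by blast
  then have "indicator {-real n..real n} x * w x = w x" if "n \<ge> n0" for n
    using that by (auto simp: indicator_def)
  then show "(\<lambda>n. indicator {-real n..real n} x * w x) \<longlonglongrightarrow> w x"
    by (intro tendsto_eventually) (auto simp: eventually_sequentially)
qed

lemma locally_integrable_lincomb:
  assumes "locally_integrable u" "locally_integrable v"
  shows "locally_integrable (\<lambda>x. c * u x + d * v x)"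
  using assms unfolding locally_integrable_def set_integrable_def
  by (auto simp: algebra_simps)

text \<open>The positive and the negative part of \<open>v\<close> are densities of two finite
  measures that agree on all rays, so the measures coincide, and the density of a finite measure is
  unique almost everywhere.\<close>

lemma lborel_AE_zero:
  fixes v :: "real \<Rightarrow> real"
  assumes v: "integrable lborel v" and 0: "\<And>x. (LINT y|lborel. indicator {x<..} y * v y) = 0"
  shows "AE x in lborel. v x = 0"
proof -
  define P Q where "P x = max (v x) 0" and "Q x = max (- v x) 0" for x
  have [measurable]: "v \<in> borel_measurable lborel" using v by auto
  have i: "integrable lborel P" "integrable lborel Q" using v unfolding P_def[abs_def] Q_def[abs_def] by auto
  have i': "integrable lborel (\<lambda>y. indicator {x<..} y * P y)" "integrable lborel (\<lambda>y. indicator {x<..} y * Q y)" for x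
  proof -
    have s: "{x<..} \<in> sets lborel" by (simp add: borel_open)
    show "integrable lborel (\<lambda>y. indicator {x<..} y * P y)" "integrable lborel (\<lambda>y. indicator {x<..} y * Q y)"
      using integrable_real_mult_indicator[OF s i(1)] integrable_real_mult_indicator[OF s i(2)]
      by (simp_all add: mult.commute)
  qed
  have eq: "(LINT y|lborel. indicator {x<..} y * P y) = (LINT y|lborel. indicator {x<..} y * Q y)" for x
  proof -
    have "(LINT y|lborel. indicator {x<..} y * P y) - (LINT y|lborel. indicator {x<..} y * Q y)
       = (LINT y|lborel. indicator {x<..} y * P y - indicator {x<..} y * Q y)"
      using i' by simp
    also have "\<dots> = (LINT y|lborel. indicator {x<..} y * v y)"
      by (intro Bochner_Integration.integral_cong) (auto simp: P_def Q_def indicator_def)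
    finally show ?thesis using 0 by simp
  qed
  have em: "emeasure (density lborel (\<lambda>x. ennreal (h x))) {x<..} = ennreal (LINT y|lborel. indicator {x<..} y * h y)"
    if "integrable lborel h" "integrable lborel (\<lambda>y. indicator {x<..} y * h y)" "\<And>x. h x \<ge> 0" for h and x :: real
  proof -
    have [measurable]: "h \<in> borel_measurable lborel" using that by auto
    have "emeasure (density lborel (\<lambda>x. ennreal (h x))) {x<..} = (\<integral>\<^sup>+y. ennreal (h y) * indicator {x<..} y \<partial>lborel)"
      by (subst emeasure_density) auto
    also have "\<dots> = (\<integral>\<^sup>+y. ennreal (indicator {x<..} y * h y) \<partial>lborel)"
      by (intro nn_integral_cong) (auto simp: indicator_def)
    also have "\<dots> = ennreal (LINT y|lborel. indicator {x<..} y * h y)"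
      using that by (intro nn_integral_eq_integral) auto
    finally show ?thesis .
  qed
  have "density lborel (\<lambda>x. ennreal (P x)) = density lborel (\<lambda>x. ennreal (Q x))"
  proof (rule measure_eqI_lessThan)
    fix x
    have "emeasure (density lborel (\<lambda>x. ennreal (P x))) {x<..} = ennreal (LINT y|lborel. indicator {x<..} y * P y)"
      by (rule em[OF i(1) i'(1)]) (auto simp: P_def)
    moreover have "emeasure (density lborel (\<lambda>x. ennreal (Q x))) {x<..} = ennreal (LINT y|lborel. indicator {x<..} y * Q y)"
      by (rule em[OF i(2) i'(2)]) (auto simp: Q_def)
    ultimately show "emeasure (density lborel (\<lambda>x. ennreal (P x))) {x<..} < \<infinity>"
      "emeasure (density lborel (\<lambda>x. ennreal (P x))) {x<..} = emeasure (density lborel (\<lambda>x. ennreal (Q x))) {x<..}"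
      by (simp_all add: eq)
  qed auto
  then have "AE x in lborel. ennreal (P x) = ennreal (Q x)"
    using i by (subst (asm) finite_density_unique) (auto simp: integrable_iff_bounded P_def Q_def)
  then show ?thesis
  proof (rule AE_mp, intro AE_I2 impI)
    fix x assume "ennreal (P x) = ennreal (Q x)"
    then have "P x = Q x" by (subst (asm) ennreal_inj) (auto simp: P_def Q_def)
    then show "v x = 0" by (simp add: P_def Q_def max_def split: if_splits)
  qed
qed

text \<open>On each \<open>{-n<..n}\<close> the truncated function is integrable; a Borel
  representative of it is passed to \<open>lborel_AE_zero\<close>, which lives on
  \<open>lborel\<close>.\<close>

lemma AE_zero_of_intervals:
  assumes w: "locally_integrable w" and 0: "\<And>a b. a \<le> b \<Longrightarrow> (LINT x|lebesgue. w x * indicator {a<..b} x) = 0"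
  shows "AE x in lebesgue. w x = 0"
proof -
  have "AE x in lebesgue. indicator {-real n<..real n} x * w x = 0" for n
  proof -
    let ?g = "\<lambda>x. indicator {-real n<..real n} x * w x"
    have "set_integrable lebesgue {-real n<..real n} w"
    proof (rule set_integrable_subset)
      show "set_integrable lebesgue {-real n..real n} w" using w by (simp add: locally_integrable_def)
    qed auto
    then have ig: "integrable lebesgue ?g" by (simp add: set_integrable_def)
    obtain v where v: "v \<in> borel_measurable lborel" and ae: "AE x in lborel. ?g x = v x"
      using completion_ex_borel_measurable_real[OF borel_measurable_integrable[OF ig]] by blast
    have ae': "AE x in lebesgue. ?g x = v x" using ae by (rule AE_completion)
    have iv: "integrable lborel v"
      by (rule integrable_completion[OF v, THEN iffD1, OF integrable_cong_AE_imp[OF ig measurable_completion[OF v] ae']])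
    have "AE x in lborel. v x = 0"
    proof (rule lborel_AE_zero[OF iv])
      fix x
      have "(LINT y|lborel. indicator {x<..} y * v y) = (LINT y|lebesgue. indicator {x<..} y * v y)"
        using v by (intro integral_completion[symmetric] borel_measurable_times borel_measurable_indicator) auto
      \<comment> \<open>The ray meets \<open>{-n<..n}\<close> in a half-open interval; the outer
        \<open>max\<close> keeps its endpoints ordered even when it is empty.\<close>
      also have "\<dots> = (LINT y|lebesgue. w y * indicator {max x (-real n)<..max (max x (-real n)) (real n)} y)"
      proof (rule integral_cong_AE)
        show "(\<lambda>y. indicator {x<..} y * v y) \<in> borel_measurable lebesgue"
          using v by (intro measurable_completion borel_measurable_times borel_measurable_indicator) auto
        show "(\<lambda>y. w y * indicator {max x (-real n)<..max (max x (-real n)) (real n)} y) \<in> borel_measurable lebesgue"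
          using locally_integrable_measurable[OF w]
          by (intro borel_measurable_times borel_measurable_indicator) auto
        show "AE y in lebesgue. indicator {x<..} y * v y = w y * indicator {max x (-real n)<..max (max x (-real n)) (real n)} y"
        proof (rule AE_mp[OF ae'], intro AE_I2 impI)
          fix y assume y: "?g y = v y"
          have "indicator {x<..} y * indicator {-real n<..real n} y
            = (indicator {max x (-real n)<..max (max x (-real n)) (real n)} y :: real)"
            by (cases "x < y"; cases "-real n < y"; cases "y \<le> real n") (auto simp: indicator_def)
          then show "indicator {x<..} y * v y = w y * indicator {max x (-real n)<..max (max x (-real n)) (real n)} y"
            using y by (metis mult.assoc mult.commute)
        qed
      qed
      also have "\<dots> = 0" by (rule 0) auto
      finally show "(LINT y|lborel. indicator {x<..} y * v y) = 0" .
    qed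
    then have "AE x in lebesgue. v x = 0" by (rule AE_completion)
    then show ?thesis using ae' by eventually_elim auto
  qed
  then have "AE x in lebesgue. \<forall>n. indicator {-real n<..real n} x * w x = 0" by (subst AE_all_countable) blast
  then show ?thesis
  proof eventually_elim
    case (elim x)
    obtain n where "\<bar>x\<bar> < real n" using reals_Archimedean2 by blast
    then have "indicator {-real n<..real n} x = (1::real)" by (simp add: abs_less_iff)
    then show ?case using elim[rule_format, of n] by simp
  qed
qed

text \<open>Differences of ever steeper steps are test functions that converge to the indicator of
  \<open>{a<..b}\<close>, and dominated convergence carries the hypothesis over to
  intervals.\<close>

lemma fundamental_lemma:
  assumes w: "locally_integrable w" and 0: "\<And>xi. xi \<in> test_functions \<Longrightarrow> (LINT x|lebesgue. w x * xi x) = 0"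
  shows "AE x in lebesgue. w x = 0"
proof (rule AE_zero_of_intervals[OF w])
  fix a b :: real assume ab: "a \<le> b"
  \<comment> \<open>\<open>Suc n\<close> keeps the slope parameter at least 1, so every
    \<open>S n\<close> vanishes outside of \<open>{a..b+1}\<close>, where \<open>w\<close> is
    integrable.\<close>
  define S where "S n x = step (real (Suc n) * (x - a)) - step (real (Suc n) * (x - b))" for n x
  have S: "S n \<in> test_functions" for n unfolding S_def[abs_def] by (rule test_function_step) (use ab in auto)
  have lim1: "(\<lambda>n. step (real (Suc n) * (x - c))) \<longlonglongrightarrow> indicator {c<..} x" for x c
  proof (cases "x \<le> c")
    case True
    then have "step (real (Suc n) * (x - c)) = 0" for n by (intro step_0) (auto simp: mult_le_0_iff)
    then show ?thesis using True by simp
  next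
    case False
    then obtain n0 where n0: "1 < real n0 * (x - c)" using reals_Archimedean3[of "x-c"] by auto
    have "step (real (Suc n) * (x - c)) = 1" if "n \<ge> n0" for n
    proof (rule step_1)
      have "real n0 * (x - c) \<le> real (Suc n) * (x - c)" using that False by (intro mult_right_mono) auto
      then show "1 \<le> real (Suc n) * (x - c)" using n0 by linarith
    qed
    then show ?thesis using False by (intro tendsto_eventually) (auto simp: eventually_sequentially)
  qed
  have "(\<lambda>n. LINT x|lebesgue. w x * S n x) \<longlonglongrightarrow> (LINT x|lebesgue. w x * indicator {a<..b} x)"
  proof (rule integral_dominated_convergence[where w="\<lambda>x. indicator {a..b+1} x * \<bar>w x\<bar>"])
    show "integrable lebesgue (\<lambda>x. indicator {a..b+1} x * \<bar>w x\<bar>)"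
      using w integrable_abs[of lebesgue "\<lambda>x. indicator {a..b+1} x * w x"]
      unfolding locally_integrable_def set_integrable_def by (simp add: abs_mult)
    show "(\<lambda>x. w x * S n x) \<in> borel_measurable lebesgue" for n
      using S by (intro borel_measurable_times locally_integrable_measurable[OF w] smooth_lebesgue) (auto simp: test_functions_iff)
    show "(\<lambda>x. w x * indicator {a<..b} x) \<in> borel_measurable lebesgue"
      using locally_integrable_measurable[OF w] by (intro borel_measurable_times borel_measurable_indicator) auto
    show "AE x in lebesgue. (\<lambda>n. w x * S n x) \<longlonglongrightarrow> w x * indicator {a<..b} x"
    proof (intro AE_I2 tendsto_mult tendsto_const)
      fix x
      have "indicator {a<..} x - indicator {b<..} x = (indicator {a<..b} x :: real)" using ab by (auto simp: indicator_def)
      then show "(\<lambda>n. S n x) \<longlonglongrightarrow> indicator {a<..b} x"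
        using tendsto_diff[OF lim1[of x a] lim1[of x b]] by (simp add: S_def)
    qed
    fix n
    show "AE x in lebesgue. norm (w x * S n x) \<le> indicator {a..b+1} x * \<bar>w x\<bar>"
    proof (intro AE_I2)
      fix x
      have "\<bar>S n x\<bar> \<le> 1" using step_bounds[of "real (Suc n) * (x - a)"] step_bounds[of "real (Suc n) * (x - b)"]
        by (simp add: S_def)
      moreover have "S n x = 0" if "x \<notin> {a..b+1}"
      proof (cases "x < a")
        case True then show ?thesis using ab unfolding S_def by (subst (1 2) step_0) (auto simp: mult_le_0_iff)
      next
        case False
        then have x: "x - b \<ge> 1" "x - a \<ge> 1" using that ab by auto
        have "1 * 1 \<le> real (Suc n) * (x - a)" "1 * 1 \<le> real (Suc n) * (x - b)"
          by (rule mult_mono; use x in simp)+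
        then show ?thesis unfolding S_def by (subst (1 2) step_1) auto
      qed
      ultimately show "norm (w x * S n x) \<le> indicator {a..b+1} x * \<bar>w x\<bar>"
        by (cases "x \<in> {a..b+1}") (auto simp: abs_mult mult_left_le)
    qed
  qed
  then show "(LINT x|lebesgue. w x * indicator {a<..b} x) = 0"
    using 0[OF S] by (simp add: LIMSEQ_const_iff)
qed

lemma has_weak_deriv_loc:
  "has_weak_deriv u v \<longleftrightarrow> locally_integrable u \<and> locally_integrable v \<and>
     (\<forall>xi\<in>test_functions. (LINT x|lebesgue. u x * deriv xi x) = - (LINT x|lebesgue. v x * xi x))"
  unfolding has_weak_deriv_def locally_integrable_compact by auto

lemma has_weak_deriv_unique:
  assumes "has_weak_deriv u v" "has_weak_deriv u v'"
  shows "AE x in lebesgue. v x = v' x"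
proof -
  have l: "locally_integrable v" "locally_integrable v'" using assms by (auto simp: has_weak_deriv_loc)
  have "AE x in lebesgue. 1 * v x + (-1) * v' x = 0"
  proof (rule fundamental_lemma)
    show "locally_integrable (\<lambda>x. 1 * v x + (-1) * v' x)" using l by (rule locally_integrable_lincomb)
    fix xi assume xi: "xi \<in> test_functions"
    have "(LINT x|lebesgue. (1 * v x + (-1) * v' x) * xi x) = (LINT x|lebesgue. v x * xi x - v' x * xi x)"
      by (simp add: algebra_simps)
    also have "\<dots> = 0" using assms xi l by (simp add: has_weak_deriv_loc integrable_mult_test)
    finally show "(LINT x|lebesgue. (1 * v x + (-1) * v' x) * xi x) = 0" .
  qed
  then show ?thesis by eventually_elim auto
qed

lemma has_weak_deriv_lincomb:
  assumes u: "has_weak_deriv u v" and u': "has_weak_deriv u' v'"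
  shows "has_weak_deriv (\<lambda>x. c * u x + d * u' x) (\<lambda>x. c * v x + d * v' x)"
  unfolding has_weak_deriv_loc
proof (intro conjI ballI)
  have l: "locally_integrable v" "locally_integrable v'" "locally_integrable u" "locally_integrable u'"
    using assms by (auto simp: has_weak_deriv_loc)
  then show "locally_integrable (\<lambda>x. c * u x + d * u' x)" "locally_integrable (\<lambda>x. c * v x + d * v' x)"
    by (auto intro: locally_integrable_lincomb)
  fix xi assume xi: "xi \<in> test_functions"
  note i = integrable_mult_test[OF _ xi] integrable_mult_test[OF _ test_function_deriv[OF xi]]
  have "(LINT x|lebesgue. (c * u x + d * u' x) * deriv xi x) = (LINT x|lebesgue. c * (u x * deriv xi x) + d * (u' x * deriv xi x))"
    by (simp add: algebra_simps)
  also have "\<dots> = c * (LINT x|lebesgue. u x * deriv xi x) + d * (LINT x|lebesgue. u' x * deriv xi x)"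
    using i l by simp
  also have "\<dots> = - (c * (LINT x|lebesgue. v x * xi x) + d * (LINT x|lebesgue. v' x * xi x))"
    using assms xi by (simp add: has_weak_deriv_loc)
  also have "\<dots> = - (LINT x|lebesgue. c * (v x * xi x) + d * (v' x * xi x))"
    using i l by simp
  also have "\<dots> = - (LINT x|lebesgue. (c * v x + d * v' x) * xi x)"
    by (simp add: algebra_simps)
  finally show "(LINT x|lebesgue. (c * u x + d * u' x) * deriv xi x) = - (LINT x|lebesgue. (c * v x + d * v' x) * xi x)" .
qed

lemma has_weak_deriv_wderiv: "has_weak_deriv u v \<Longrightarrow> has_weak_deriv u (wderiv u)"
  unfolding wderiv_def by (rule someI[of "has_weak_deriv u"])

lemma wderiv_AE: "has_weak_deriv u v \<Longrightarrow> AE x in lebesgue. wderiv u x = v x"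
  using has_weak_deriv_unique[OF has_weak_deriv_wderiv] by blast

section \<open>Continuous representatives\<close>

lemma locally_integrable_HK:
  assumes "locally_integrable v"
  shows "v integrable_on {a..b}" "integral {a..b} v = (LINT x:{a..b}|lebesgue. v x)"
  using assms set_lebesgue_integral_eq_integral[of "{a..b}" v] unfolding locally_integrable_def by auto

text \<open>The oriented integral from 0 to \<open>x\<close>: at least one of the two terms is over
  an empty or degenerate interval.\<close>

definition primitive :: "(real \<Rightarrow> real) \<Rightarrow> real \<Rightarrow> real" where
  "primitive v x = integral {0..x} v - integral {x..0} v"

lemma primitive_diff:
  assumes v: "locally_integrable v" and "x \<le> y"
  shows "primitive v y - primitive v x = integral {x..y} v"
proof -
  note i = locally_integrable_HK(1)[OF v]
  have c: "integral {a..b} v + integral {b..c} v = integral {a..c} v" if "a \<le> b" "b \<le> c" for a b c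
    by (rule Henstock_Kurzweil_Integration.integral_combine[OF that i])
  consider "0 \<le> x" | "y \<le> 0" | "x < 0" "0 < y" by linarith
  then show ?thesis
  proof cases
    case 1
    have "x = 0 \<or> {x..0} = {}" "y = 0 \<or> {y..0} = {}" using 1 assms(2) by auto
    then have "integral {x..0} v = 0" "integral {y..0} v = 0" by auto
    then show ?thesis using c[of 0 x y] 1 assms by (simp add: primitive_def)
  next
    case 2
    have "x = 0 \<or> {0..x} = {}" "y = 0 \<or> {0..y} = {}" using 2 assms(2) by auto
    then have "integral {0..x} v = 0" "integral {0..y} v = 0" by auto
    then show ?thesis using c[of x y 0] 2 assms by (simp add: primitive_def)
  next
    case 3 then show ?thesis using c[of x 0 y] by (simp add: primitive_def)
  qed
qed

lemma primitive_continuous: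
  assumes v: "locally_integrable v"
  shows "continuous_on UNIV (primitive v)"
proof -
  have "isCont (primitive v) x" for x
  proof -
    have "continuous_on {x-1..x+1} (\<lambda>y. primitive v (x-1) + integral {x-1..y} v)"
      by (intro continuous_intros indefinite_integral_continuous_1 locally_integrable_HK[OF v])
    then have "continuous_on {x-1..x+1} (primitive v)"
    proof (rule continuous_on_eq)
      fix y assume "y \<in> {x-1..x+1}"
      then show "primitive v (x-1) + integral {x-1..y} v = primitive v y"
        using primitive_diff[OF v, of "x-1" y] by simp
    qed
    then show ?thesis by (rule continuous_on_interior) auto
  qed
  then show ?thesis by (simp add: continuous_on_eq_continuous_at)
qed

lemma test_deriv_support:
  assumes "xi \<in> test_functions"
  obtains N where "N > 0" "\<And>x. \<bar>x\<bar> \<ge> N \<Longrightarrow> xi x = 0" "\<And>x. \<bar>x\<bar> \<ge> N \<Longrightarrow> deriv xi x = 0"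
proof -
  obtain N M where "N > 0" "\<And>x. \<bar>x\<bar> \<ge> N \<Longrightarrow> xi x = 0" "M > 0" "\<And>x. \<bar>x\<bar> \<ge> M \<Longrightarrow> deriv xi x = 0"
    using assms test_function_deriv[OF assms] by (auto simp: test_functions_iff)
  then show ?thesis by (intro that[of "max N M"]) auto
qed

lemma locally_integrable_const: "locally_integrable (\<lambda>x. c)"
  unfolding locally_integrable_def by (intro allI absolutely_integrable_continuous_real continuous_on_const)

lemma integral_deriv_test_from:
  assumes xi: "xi \<in> test_functions"
  shows "(LINT x|lborel. indicator {s..} x * deriv xi x) = - xi s"
proof -
  obtain N where N: "N > 0" "\<And>x. \<bar>x\<bar> \<ge> N \<Longrightarrow> xi x = 0" "\<And>x. \<bar>x\<bar> \<ge> N \<Longrightarrow> deriv xi x = 0"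
    using test_deriv_support[OF xi] by metis
  have sm: "smooth xi" using xi by (simp add: test_functions_iff)
  define M where "M = max N s"
  have "(LINT x|lborel. indicator {s..} x * deriv xi x) = (LINT x|lborel. deriv xi x * indicator {s..M} x)"
  proof (intro Bochner_Integration.integral_cong refl)
    fix x show "indicator {s..} x * deriv xi x = deriv xi x * indicator {s..M} x"
      using N(3)[of x] by (cases "x \<le> M") (auto simp: indicator_def M_def)
  qed
  also have "\<dots> = xi M - xi s"
    using DERIV_isCont[OF smooth_has_deriv[OF smooth_deriv[OF sm]]]
    by (intro integral_FTC_Icc_real smooth_has_deriv sm) (auto simp: M_def)
  finally show ?thesis using N(1) N(2)[of M] by (simp add: M_def)
qed

lemma integral_deriv_test:
  assumes xi: "xi \<in> test_functions"
  shows "(LINT x|lborel. deriv xi x) = 0" "(LINT x|lebesgue. deriv xi x) = 0"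
proof -
  obtain N where N: "N > 0" "\<And>x. \<bar>x\<bar> \<ge> N \<Longrightarrow> xi x = 0" "\<And>x. \<bar>x\<bar> \<ge> N \<Longrightarrow> deriv xi x = 0"
    using test_deriv_support[OF xi] by metis
  have "deriv xi x = indicator {-N..} x * deriv xi x" for x using N(3)[of x] by (cases "-N \<le> x") auto
  then have "(LINT x|lborel. deriv xi x) = (LINT x|lborel. indicator {-N..} x * deriv xi x)" by presburger
  then show z: "(LINT x|lborel. deriv xi x) = 0"
    using integral_deriv_test_from[OF xi, of "-N"] N(1) N(2)[of "-N"] by simp
  have "smooth (deriv xi)" using xi by (auto simp: test_functions_iff intro: smooth_deriv)
  then show "(LINT x|lebesgue. deriv xi x) = 0" using integral_completion[of "deriv xi" lborel] z by (simp add: smooth_borel)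
qed

text \<open>By Fubini: up to a constant, the primitive at \<open>x\<close> integrates
  \<open>v s\<close> over \<open>s \<le> x\<close>; after exchanging the integrals, the inner one is
  that of \<open>deriv xi\<close> over \<open>{s..}\<close>, which is \<open>- xi s\<close>.\<close>

lemma primitive_parts:
  assumes v: "locally_integrable v" and xi: "xi \<in> test_functions"
  shows "(LINT x|lebesgue. primitive v x * deriv xi x) = - (LINT x|lebesgue. v x * xi x)"
proof -
  obtain N where N: "N > 0" "\<And>x. \<bar>x\<bar> \<ge> N \<Longrightarrow> xi x = 0" "\<And>x. \<bar>x\<bar> \<ge> N \<Longrightarrow> deriv xi x = 0"
    using test_deriv_support[OF xi] by metis
  have sm: "smooth xi" using xi by (simp add: test_functions_iff)
  have b[measurable]: "xi \<in> borel_measurable borel" "deriv xi \<in> borel_measurable borel"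
    using sm by (auto intro: smooth_borel smooth_deriv)
  have ideriv: "integrable lborel (deriv xi)"
  proof -
    have "integrable lebesgue (\<lambda>x. 1 * deriv xi x)"
      by (intro integrable_mult_test test_function_deriv xi)
       (rule locally_integrable_const)
    then show ?thesis by (simp add: integrable_completion)
  qed
  have "integrable lebesgue (\<lambda>x. indicator {-N..N} x * v x)"
    using v by (simp add: locally_integrable_def set_integrable_def)
  note ig = this
  \<comment> \<open>Fubini's theorem is applied to the product of \<open>lborel\<close> with itself,
    hence the Borel representative.\<close>
  obtain w where w[measurable]: "w \<in> borel_measurable lborel" and ae: "AE x in lborel. indicator {-N..N} x * v x = w x"
    using completion_ex_borel_measurable_real[OF borel_measurable_integrable[OF ig]] by blast
  have ae': "AE x in lebesgue. indicator {-N..N} x * v x = w x" using ae by (rule AE_completion)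
  have iw: "integrable lborel w"
    by (rule integrable_completion[OF w, THEN iffD1, OF integrable_cong_AE_imp[OF ig measurable_completion[OF w] ae']])
  have mv: "v \<in> borel_measurable lebesgue" using v by (rule locally_integrable_measurable)
  \<comment> \<open>Where \<open>\<bar>x\<bar> \<ge> N\<close>, both sides vanish with
    \<open>deriv xi x\<close>. The constant \<open>primitive v (-N)\<close> disappears in the end
    because \<open>deriv xi\<close> has integral 0.\<close>
  have prim: "primitive v x * deriv xi x = primitive v (-N) * deriv xi x + (LINT s|lborel. w s * (indicator {s..} x * deriv xi x))" for x
  proof (cases "\<bar>x\<bar> \<ge> N")
    case False
    have "(LINT s|lborel. w s * (indicator {s..} x * deriv xi x)) = (LINT s|lborel. (w s * indicator {..x} s) * deriv xi x)"
      by (intro Bochner_Integration.integral_cong) (auto simp: indicator_def)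
    also have "\<dots> = (LINT s|lborel. (w s * indicator {..x} s)) * deriv xi x" by simp
    also have "(LINT s|lborel. (w s * indicator {..x} s)) = (LINT s|lebesgue. (w s * indicator {..x} s))"
      by (rule integral_completion[symmetric]) auto
    also have "\<dots> = (LINT s|lebesgue. indicator {-N..x} s * v s)"
    proof (rule integral_cong_AE)
      show "(\<lambda>s. w s * indicator {..x} s) \<in> borel_measurable lebesgue"
        by (rule measurable_completion) auto
      show "(\<lambda>s. indicator {-N..x} s * v s) \<in> borel_measurable lebesgue"
        by (intro borel_measurable_times mv borel_measurable_indicator) auto
      show "AE s in lebesgue. w s * indicator {..x} s = indicator {-N..x} s * v s"
        using ae'
      proof eventually_elim
        case (elim s) then show ?case using False
          by (cases "s \<le> x"; cases "-N \<le> s"; cases "s \<le> N") auto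
      qed
    qed
    also have "\<dots> = integral {-N..x} v" using locally_integrable_HK[OF v] by (simp add: set_lebesgue_integral_def)
    also have "\<dots> = primitive v x - primitive v (-N)" using False by (subst primitive_diff[OF v]) auto
    finally show ?thesis by (simp add: algebra_simps)
  qed (simp add: N)
  have int2: "integrable (lborel \<Otimes>\<^sub>M lborel) (\<lambda>(s, x). w s * (indicator {s..} x * deriv xi x))"
  proof (rule lborel_pair.Fubini_integrable)
    have [measurable]: "(\<lambda>p. indicator {fst p..} (snd p :: real) :: real) \<in> borel_measurable (lborel \<Otimes>\<^sub>M lborel)"
    proof -
      have eq: "(\<lambda>p. indicator {fst p..} (snd p) :: real) = (\<lambda>p. if fst p \<le> (snd p :: real) then 1 else 0)"
        by (auto simp: indicator_def)
      show ?thesis unfolding eq by measurable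
    qed
    show m: "(\<lambda>(s, x). w s * (indicator {s..} x * deriv xi x)) \<in> borel_measurable (lborel \<Otimes>\<^sub>M lborel)"
      unfolding split_beta by measurable
    have i1: "integrable lborel (\<lambda>x. w s * (indicator {s..} x * deriv xi x))" for s
      using integrable_real_mult_indicator[OF _ ideriv, of "{s..}"] by (simp add: mult.commute)
    then show "AE x in lborel. integrable lborel (\<lambda>y. case (x, y) of (s, x) \<Rightarrow> w s * (indicator {s..} x * deriv xi x))"
      by simp
    show "integrable lborel (\<lambda>x. LINT y|lborel. norm (case (x, y) of (s, x) \<Rightarrow> w s * (indicator {s..} x * deriv xi x)))"
    proof (rule Bochner_Integration.integrable_bound)
      show "integrable lborel (\<lambda>s. w s * (LINT x|lborel. \<bar>deriv xi x\<bar>))" using iw by simp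
      show "(\<lambda>x. LINT y|lborel. norm (case (x, y) of (s, x) \<Rightarrow> w s * (indicator {s..} x * deriv xi x))) \<in> borel_measurable lborel"
        using m by (intro lborel.borel_measurable_lebesgue_integral) (simp add: split_beta borel_measurable_norm)
      show "AE s in lborel. norm (LINT y|lborel. norm (case (s, y) of (s, x) \<Rightarrow> w s * (indicator {s..} x * deriv xi x)))
              \<le> norm (w s * (LINT x|lborel. \<bar>deriv xi x\<bar>))"
      proof (intro AE_I2)
        fix s
        have "(LINT y|lborel. \<bar>w s * (indicator {s..} y * deriv xi y)\<bar>) \<le> (LINT y|lborel. \<bar>w s\<bar> * \<bar>deriv xi y\<bar>)"
        proof (rule integral_mono)
          show "integrable lborel (\<lambda>y. \<bar>w s * (indicator {s..} y * deriv xi y)\<bar>)"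
            by (rule integrable_abs[OF i1[of s]])
          show "integrable lborel (\<lambda>y. \<bar>w s\<bar> * \<bar>deriv xi y\<bar>)" using ideriv by simp
        qed (auto simp: abs_mult indicator_def)
        moreover have "0 \<le> (LINT y|lborel. \<bar>w s * (indicator {s..} y * deriv xi y)\<bar>)" by simp
        ultimately show "norm (LINT y|lborel. norm (case (s, y) of (s, x) \<Rightarrow> w s * (indicator {s..} x * deriv xi x)))
              \<le> norm (w s * (LINT x|lborel. \<bar>deriv xi x\<bar>))" by (simp add: abs_mult)
      qed
    qed
  qed
  have m2: "(\<lambda>x. LINT s|lborel. w s * (indicator {s..} x * deriv xi x)) \<in> borel_measurable lborel"
    and i2: "integrable lborel (\<lambda>x. LINT s|lborel. w s * (indicator {s..} x * deriv xi x))"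
    using lborel_pair.integrable_snd[OF int2] by auto
  have "(LINT x|lebesgue. primitive v x * deriv xi x)
     = (LINT x|lborel. primitive v (-N) * deriv xi x + (LINT s|lborel. w s * (indicator {s..} x * deriv xi x)))"
    unfolding prim using m2 by (intro integral_completion) auto
  also have "\<dots> = primitive v (-N) * (LINT x|lborel. deriv xi x) + (LINT x|lborel. LINT s|lborel. w s * (indicator {s..} x * deriv xi x))"
    using ideriv i2 by simp
  also have "(LINT x|lborel. deriv xi x) = 0" by (rule integral_deriv_test[OF xi])
  also have "(LINT x|lborel. LINT s|lborel. w s * (indicator {s..} x * deriv xi x))
     = (LINT s|lborel. LINT x|lborel. w s * (indicator {s..} x * deriv xi x))"
    by (rule lborel_pair.Fubini_integral[OF int2])
  also have "\<dots> = (LINT s|lborel. - (w s * xi s))" by (simp add: integral_deriv_test_from[OF xi])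
  also have "\<dots> = - (LINT s|lborel. w s * xi s)" by simp
  also have "(LINT s|lborel. w s * xi s) = (LINT s|lebesgue. w s * xi s)"
    by (rule integral_completion[symmetric]) auto
  also have "\<dots> = (LINT s|lebesgue. v s * xi s)"
  proof (rule integral_cong_AE)
    show "(\<lambda>s. w s * xi s) \<in> borel_measurable lebesgue" by (rule measurable_completion) auto
    show "(\<lambda>s. v s * xi s) \<in> borel_measurable lebesgue" by (intro borel_measurable_times mv smooth_lebesgue sm)
    show "AE s in lebesgue. w s * xi s = v s * xi s"
      using ae'
    proof eventually_elim
      case (elim s)
      have "xi s = 0" if "s \<notin> {-N..N}" using that by (intro N(2)) auto
      then show ?case using elim by (cases "s \<in> {-N..N}") auto
    qed
  qed
  finally show ?thesis by simp
qed

section \<open>Functions with vanishing weak derivative\<close>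

lemma deriv_step_0: "x \<le> 0 \<or> x \<ge> 1 \<Longrightarrow> deriv step x = 0"
  using DERIV_imp_deriv[OF step_has_deriv[of x]] bump0_0[of x] by simp

lemma deriv_step: "deriv step \<in> test_functions" "(LINT x|lebesgue. deriv step x) = 1"
proof -
  note z = deriv_step_0
  show t: "deriv step \<in> test_functions"
    unfolding test_functions_iff
  proof (intro conjI smooth_deriv smooth_step exI[of _ 1] allI impI)
    fix x :: real assume "1 \<le> \<bar>x\<bar>" then show "deriv step x = 0" by (intro z) arith
  qed simp
  have "(LINT x|lebesgue. deriv step x) = (LINT x|lborel. deriv step x)"
    by (rule integral_completion) (simp add: smooth_borel smooth_deriv smooth_step)
  also have "\<dots> = (LINT x|lborel. deriv step x * indicator {0..1} x)"
  proof (intro Bochner_Integration.integral_cong refl)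
    fix x show "deriv step x = deriv step x * indicator {0..1} x"
      using z[of x] by (cases "x \<in> {0..1}") auto
  qed
  also have "\<dots> = step 1 - step 0"
    using DERIV_isCont[OF smooth_has_deriv[OF smooth_deriv[OF smooth_step]]]
    by (intro integral_FTC_Icc_real smooth_has_deriv smooth_step) auto
  finally show "(LINT x|lebesgue. deriv step x) = 1" by (simp add: step_0 step_1)
qed

text \<open>A primitive of a test function has compact support only if the integral is 0;
  subtracting a multiple of \<open>deriv step\<close>, a test function of integral 1, arranges
  this.\<close>

lemma ex_test_primitive:
  assumes eta: "eta \<in> test_functions"
  obtains xi where "xi \<in> test_functions" "\<And>x. deriv xi x = eta x - (LINT y|lebesgue. eta y) * deriv step x"
proof -
  obtain N where N: "N > 0" "smooth eta" "\<And>x. \<bar>x\<bar> \<ge> N \<Longrightarrow> eta x = 0" using eta by (auto simp: test_functions_iff)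
  define m where "m = (LINT y|lebesgue. eta y)"
  define E where "E x = integral {-N-1..x} eta" for x
  have dE: "(E has_real_derivative eta x) (at x)" for x
    unfolding E_def[abs_def] using N by (intro integral_has_deriv_at[where K="-N"] smooth_continuous) auto
  have sE: "smooth E" using dE N(2) by (rule smooth_antideriv)
  have i: "eta integrable_on {a..b}" for a b
    by (intro integrable_continuous_real smooth_continuous N)
  have m: "m = integral {-N-1..N} eta"
  proof -
    have "m = (LINT x:{-N-1..N}|lebesgue. eta x)"
      unfolding m_def set_lebesgue_integral_def
    proof (intro Bochner_Integration.integral_cong refl)
      fix x show "eta x = indicator {-N-1..N} x *\<^sub>R eta x"
        using N(3)[of x] by (cases "x \<in> {-N-1..N}") auto
    qed
    also have "\<dots> = integral {-N-1..N} eta"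
      by (intro set_lebesgue_integral_eq_integral absolutely_integrable_continuous_real smooth_continuous N)
    finally show ?thesis .
  qed
  have E0: "E x = 0" if "x \<le> -N" for x
  proof -
    have "E x = integral {-N-1..x} (\<lambda>x. 0)" unfolding E_def using that N(1)
      by (intro integral_cong N) auto
    then show ?thesis by simp
  qed
  have E1: "E x = m" if "x \<ge> N" for x
  proof -
    have "integral {-N-1..N} eta + integral {N..x} eta = integral {-N-1..x} eta"
      using that N by (intro Henstock_Kurzweil_Integration.integral_combine i) auto
    moreover have "integral {N..x} eta = integral {N..x} (\<lambda>x. 0)" using N(1)
      by (intro integral_cong N) auto
    ultimately show ?thesis by (simp add: E_def m)
  qed
  have "(\<lambda>x. E x - m * step x) \<in> test_functions"
    unfolding test_functions_iff
  proof (intro conjI smooth_diff smooth_scale sE smooth_step exI[of _ "max N 1"] allI impI)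
    fix x :: real assume "max N 1 \<le> \<bar>x\<bar>"
    then have "x \<le> -N \<and> x \<le> 0 \<or> x \<ge> N \<and> x \<ge> 1" by auto
    then show "E x - m * step x = 0" using E0[of x] E1[of x] step_0[of x] step_1[of x] by auto
  qed auto
  moreover have "deriv (\<lambda>x. E x - m * step x) x = eta x - (LINT y|lebesgue. eta y) * deriv step x" for x
    unfolding m_def[symmetric]
    by (intro DERIV_imp_deriv DERIV_diff dE DERIV_cmult smooth_has_deriv smooth_step)
  ultimately show ?thesis using that by blast
qed

text \<open>The lemma of du Bois-Reymond. The constant can only be the integral of \<open>W\<close>
  against the unit mass \<open>deriv step\<close>, and \<open>ex_test_primitive\<close> reduces
  every other test function to this one and a derivative.\<close>

lemma zero_weak_deriv_constant:
  assumes W: "locally_integrable W" and 0: "\<And>xi. xi \<in> test_functions \<Longrightarrow> (LINT x|lebesgue. W x * deriv xi x) = 0"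
  obtains c where "AE x in lebesgue. W x = c"
proof -
  define c where "c = (LINT x|lebesgue. W x * deriv step x)"
  note one = locally_integrable_const[of 1]
  have lc: "locally_integrable (\<lambda>x. 1 * W x + (-c) * 1)"
    using W one by (rule locally_integrable_lincomb)
  have "AE x in lebesgue. 1 * W x + (-c) * 1 = 0"
  proof (rule fundamental_lemma[OF lc])
    fix eta assume eta: "eta \<in> test_functions"
    define m where "m = (LINT y|lebesgue. eta y)"
    obtain xi where xi: "xi \<in> test_functions" and dxi: "\<And>x. deriv xi x = eta x - m * deriv step x"
      using ex_test_primitive[OF eta] unfolding m_def by metis
    note i = integrable_mult_test[OF W eta] integrable_mult_test[OF W deriv_step(1)] integrable_mult_test[OF one eta]
    have "0 = (LINT x|lebesgue. W x * eta x - m * (W x * deriv step x))"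
      using 0[OF xi] unfolding dxi by (simp add: algebra_simps)
    also have "\<dots> = (LINT x|lebesgue. W x * eta x) - m * c" using i by (simp add: c_def)
    finally have "(LINT x|lebesgue. W x * eta x) = c * m" by simp
    moreover have "(LINT x|lebesgue. (1 * W x + (-c) * 1) * eta x) = (LINT x|lebesgue. W x * eta x - c * (1 * eta x))"
      by (simp add: algebra_simps)
    ultimately show "(LINT x|lebesgue. (1 * W x + (-c) * 1) * eta x) = 0" using i by (simp add: m_def)
  qed
  then show ?thesis by (intro that[of c]) (auto elim: eventually_mono)
qed

text \<open>The difference of \<open>u\<close> and \<open>primitive v\<close> has weak derivative 0
  by \<open>primitive_parts\<close>, so it is constant almost everywhere.\<close>

lemma weak_deriv_continuous_representative:
  assumes uv: "has_weak_deriv u v"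
  obtains U where "AE x in lebesgue. u x = U x" "continuous_on UNIV U"
    "\<And>x y. x \<le> y \<Longrightarrow> U y - U x = integral {x..y} v"
proof -
  have lu: "locally_integrable u" and lv: "locally_integrable v" using uv by (auto simp: has_weak_deriv_loc)
  have lp: "locally_integrable (primitive v)"
    unfolding locally_integrable_def
    by (intro allI absolutely_integrable_continuous_real continuous_on_subset[OF primitive_continuous[OF lv]]) auto
  have lW: "locally_integrable (\<lambda>x. 1 * u x + (-1) * primitive v x)" using lu lp by (rule locally_integrable_lincomb)
  obtain c where c: "AE x in lebesgue. 1 * u x + (-1) * primitive v x = c"
  proof (rule zero_weak_deriv_constant[OF lW])
    fix xi assume xi: "xi \<in> test_functions"
    note i = integrable_mult_test[OF lu test_function_deriv[OF xi]] integrable_mult_test[OF lp test_function_deriv[OF xi]]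
    have "(LINT x|lebesgue. (1 * u x + (-1) * primitive v x) * deriv xi x) = (LINT x|lebesgue. u x * deriv xi x - primitive v x * deriv xi x)"
      by (simp add: algebra_simps)
    also have "\<dots> = 0" using i uv xi primitive_parts[OF lv xi] by (simp add: has_weak_deriv_loc)
    finally show "(LINT x|lebesgue. (1 * u x + (-1) * primitive v x) * deriv xi x) = 0" .
  qed blast
  show ?thesis
  proof (rule that)
    show "AE x in lebesgue. u x = primitive v x + c" using c by eventually_elim auto
    show "continuous_on UNIV (\<lambda>x. primitive v x + c)" by (intro continuous_intros primitive_continuous lv)
    show "(primitive v y + c) - (primitive v x + c) = integral {x..y} v" if "x \<le> y" for x y
      using primitive_diff[OF lv that] by simp
  qed
qed

section \<open>The supremum bound\<close>

definition dissipation :: "real \<Rightarrow> real \<Rightarrow> (real \<Rightarrow> real) \<Rightarrow> (real \<Rightarrow> real) \<Rightarrow> (real \<Rightarrow> real) \<Rightarrow> (real \<Rightarrow> real) \<Rightarrow> real \<Rightarrow> real" where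
  "dissipation R Rmu f g f' g' x =
     f x * ((1 + R) * f' x + R * g' x)\<^sup>2 + R * Rmu * g x * (f' x + g' x)\<^sup>2"

lemma nonneg_of_AE_nonneg:
  fixes U :: "real \<Rightarrow> real"
  assumes "continuous_on UNIV U" "AE x in lebesgue. 0 \<le> U x"
  shows "0 \<le> U x"
proof (rule ccontr)
  assume "\<not> 0 \<le> U x"
  then have neg: "U x < 0" by simp
  have "open {y. U y < 0}" using assms(1) by (intro open_Collect_less) auto
  then obtain e where e: "e > 0" "ball x e \<subseteq> {y. U y < 0}" using neg by (auto simp: open_contains_ball)
  have "AE y in lebesgue. y \<notin> ball x e" using assms(2) by eventually_elim (use e in force)
  then have "ball x e \<in> null_sets lebesgue" by (subst AE_iff_null_sets) auto
  then have "emeasure lebesgue (ball x e) = 0" by auto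
  moreover have "emeasure lebesgue (ball x e) = ennreal (2 * e)"
    using e by (simp add: ball_eq_greaterThanLessThan)
  ultimately show False using e by simp
qed

lemma locally_integrable_abs: "locally_integrable v \<Longrightarrow> locally_integrable (\<lambda>x. \<bar>v x\<bar>)"
  unfolding locally_integrable_def using set_integrable_abs by blast

lemma abs_diff_le_integral:
  assumes "\<And>x y. x \<le> y \<Longrightarrow> U y - U x = integral {x..y} v" "locally_integrable v" "a \<le> b"
  shows "\<bar>U b - U a\<bar> \<le> integral {a..b} (\<lambda>x. \<bar>v x\<bar>)"
  unfolding assms(1)[OF assms(3)]
  using integral_norm_bound_integral[OF locally_integrable_HK(1)[OF assms(2)] locally_integrable_HK(1)[OF locally_integrable_abs[OF assms(2)]], of a b]
  by simp

text \<open>For nonnegative numbers the square of the truncation is the truncation of the square,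
  and truncation does not increase distances.\<close>

lemma power2_max_diff_le:
  fixes p q h :: real
  assumes "p \<ge> 0" "q \<ge> 0" "h \<ge> 0"
  shows "\<bar>(max p h)\<^sup>2 - (max q h)\<^sup>2\<bar> \<le> \<bar>p - q\<bar> * (p + q)"
proof -
  have "(max p h)\<^sup>2 = max (p\<^sup>2) (h\<^sup>2)" "(max q h)\<^sup>2 = max (q\<^sup>2) (h\<^sup>2)"
    using assms by (auto simp: max_def power2_le_iff_abs_le)
  then have "\<bar>(max p h)\<^sup>2 - (max q h)\<^sup>2\<bar> \<le> \<bar>p\<^sup>2 - q\<^sup>2\<bar>" by (auto simp: max_def)
  also have "p\<^sup>2 - q\<^sup>2 = (p - q) * (p + q)" by (simp add: power2_eq_square algebra_simps)
  finally show ?thesis using assms by (simp add: abs_mult)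
qed

text \<open>Here f and g are the continuous representatives and f', g' their weak derivatives.\<close>

locale profile =
  fixes R Rmu :: real and f g f' g' :: "real \<Rightarrow> real" and lo hi :: real
  assumes R: "R > 0" and Rmu: "Rmu > 0"
    and cf: "continuous_on UNIV f" and cg: "continuous_on UNIV g"
    and f0: "\<And>x. 0 \<le> f x" and g0: "\<And>x. 0 \<le> g x"
    and f': "\<And>x y. x \<le> y \<Longrightarrow> f y - f x = integral {x..y} f'" "locally_integrable f'"
    and g': "\<And>x y. x \<le> y \<Longrightarrow> g y - g x = integral {x..y} g'" "locally_integrable g'"
    and ab: "lo < hi"
    and D_int: "set_integrable lebesgue {lo..hi} (dissipation R Rmu f g f' g')"
begin

definition "kap = 2 / (1 + 2 * R)"
text \<open>Dictated by the case \<open>f = g\<close> of \<open>psi_local\<close>: 32 times the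
  constants \<open>4\<close> and \<open>1 / (R * Rmu)\<close> of \<open>f_p\<close> and
  \<open>g_q\<close>.\<close>

definition "C1 = 128 + 32 / (R * Rmu)"
definition "u x = f x + g x"
definition "F x = kap * ((1 + R) * f x + R * g x)"
definition "q x = f' x + g' x"
definition "p x = kap * ((1 + R) * f' x + R * g' x)"
definition "psi x = max (u x) (F x)"
abbreviation "D \<equiv> dissipation R Rmu f g f' g'"

lemma kappa: "0 < kap" "kap \<le> 2" "kap * (1 + R) \<le> 2" "kap * R \<le> 2"
  and kappa_diff: "F x - u x = (f x - g x) / (1 + 2 * R)"
  using R by (auto simp: kap_def F_def u_def field_simps)

lemma D_nonneg: "D x \<ge> 0"
  using R Rmu f0 g0 by (simp add: dissipation_def)

lemma D_eq: "D x = f x * (p x / kap)\<^sup>2 + R * Rmu * g x * (q x)\<^sup>2"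
  using kappa by (simp add: dissipation_def p_def q_def)

lemma psi_bounds: "u x \<le> psi x" "psi x \<le> 2 * u x" "0 \<le> u x" "0 \<le> psi x"
proof -
  have "F x = (kap * (1 + R)) * f x + (kap * R) * g x" by (simp add: F_def algebra_simps)
  also have "\<dots> \<le> 2 * f x + 2 * g x" using kappa f0 g0 by (intro add_mono mult_right_mono) auto
  finally show "psi x \<le> 2 * u x" using f0[of x] g0[of x] by (simp add: psi_def u_def)
  show "u x \<le> psi x" "0 \<le> u x" "0 \<le> psi x" using f0[of x] g0[of x] by (auto simp: psi_def u_def max_def)
qed

lemma f_p: "f x * (p x)\<^sup>2 \<le> 4 * D x"
proof -
  have "kap\<^sup>2 \<le> 2\<^sup>2" using kappa by (intro power_mono) auto
  then have "(p x)\<^sup>2 \<le> 4 * (p x / kap)\<^sup>2"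
    using kappa mult_right_mono[of "kap\<^sup>2" 4 "(p x / kap)\<^sup>2"] by (simp add: power_divide)
  then have "f x * (p x)\<^sup>2 \<le> f x * (4 * (p x / kap)\<^sup>2)" using f0 by (intro mult_left_mono) auto
  also have "\<dots> \<le> 4 * D x" using R Rmu g0 by (simp add: D_eq)
  finally show ?thesis .
qed

lemma g_q: "g x * (q x)\<^sup>2 \<le> D x / (R * Rmu)"
  using R Rmu f0[of x] by (simp add: D_eq field_simps)

lemma u_diff: "x \<le> y \<Longrightarrow> u y - u x = integral {x..y} q"
  and F_diff: "x \<le> y \<Longrightarrow> F y - F x = integral {x..y} p"
proof -
  assume xy: "x \<le> y"
  note i = locally_integrable_HK(1)[OF f'(2)] locally_integrable_HK(1)[OF g'(2)]
  have "integral {x..y} q = integral {x..y} f' + integral {x..y} g'"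
    unfolding q_def by (intro Henstock_Kurzweil_Integration.integral_add i)
  then show "u y - u x = integral {x..y} q" using f'(1)[OF xy] g'(1)[OF xy] by (simp add: u_def)
  have "integral {x..y} p = kap * ((1 + R) * integral {x..y} f' + R * integral {x..y} g')"
    unfolding p_def using i
    by (simp, subst Henstock_Kurzweil_Integration.integral_add) (auto intro: integrable_on_mult_right)
  then show "F y - F x = integral {x..y} p"
    unfolding F_def f'(1)[OF xy, symmetric] g'(1)[OF xy, symmetric] by (simp add: algebra_simps)
qed

lemma loc_q: "locally_integrable q" and loc_p: "locally_integrable p"
  using locally_integrable_lincomb[OF f'(2) g'(2), of 1 1]
    locally_integrable_lincomb[OF f'(2) g'(2), of "kap * (1 + R)" "kap * R"]
  unfolding q_def p_def by (simp_all add: algebra_simps)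

lemma cont: "continuous_on UNIV u" "continuous_on UNIV F" "continuous_on UNIV psi"
  unfolding psi_def[abs_def] u_def[abs_def] F_def[abs_def] by (intro continuous_intros cf cg)+

lemma D_integrable: "{a..b} \<subseteq> {lo..hi} \<Longrightarrow> D integrable_on {a..b}"
  using set_lebesgue_integral_eq_integral(1)[OF D_int] integrable_subinterval_real by blast

lemma E_integrable: "{a..b} \<subseteq> {lo..hi} \<Longrightarrow> (\<lambda>x. s * psi x + C1 / s * D x) integrable_on {a..b}"
  using cont(3) continuous_on_subset
  by (intro integrable_add integrable_on_mult_right D_integrable integrable_continuous_real) blast+

lemma C1_pos: "C1 > 0" using R Rmu by (auto simp: C1_def intro!: add_pos_pos)

text \<open>Replaces |(psi^2)_x| = 2 psi |psi_x| \<le> s psi + psi psi_x^2 / s, with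
  \<open>w\<close> in the role of |psi_x|. As \<open>psi\<close> is comparable to the number
  \<open>psi0\<close> on the whole interval, it moves under the integral of \<open>w\<close> without
  any product or chain rule.\<close>

lemma psi_interval:
  assumes s: "s > 0" and h: "h > 0" and ab': "a \<le> b" "{a..b} \<subseteq> {lo..hi}"
    and psi: "\<And>x. x \<in> {a..b} \<Longrightarrow> psi0 / 2 \<le> psi x \<and> psi x \<le> 2 * psi0"
    and w: "w integrable_on {a..b}" "\<bar>psi b - psi a\<bar> \<le> integral {a..b} w"
    and wD: "\<And>x. x \<in> {a..b} \<Longrightarrow> 0 \<le> w x \<and> psi x * (w x)\<^sup>2 \<le> C1 * D x"
  shows "\<bar>(max (psi b) h)\<^sup>2 - (max (psi a) h)\<^sup>2\<bar> \<le> 4 * integral {a..b} (\<lambda>x. s * psi x + C1 / s * D x)"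
proof -
  have "\<bar>(max (psi b) h)\<^sup>2 - (max (psi a) h)\<^sup>2\<bar> \<le> \<bar>psi b - psi a\<bar> * (psi b + psi a)"
    using h psi_bounds by (intro power2_max_diff_le) auto
  also have "\<dots> \<le> integral {a..b} w * (4 * psi0)"
    using w psi[of a] psi[of b] ab' psi_bounds by (intro mult_mono) auto
  also have "\<dots> = integral {a..b} (\<lambda>x. 4 * psi0 * w x)" by simp
  also have "\<dots> \<le> integral {a..b} (\<lambda>x. 4 * (s * psi x + C1 / s * D x))"
  proof (rule integral_le)
    show "(\<lambda>x. 4 * psi0 * w x) integrable_on {a..b}" by (intro integrable_on_mult_right w)
    show "(\<lambda>x. 4 * (s * psi x + C1 / s * D x)) integrable_on {a..b}"
      by (intro integrable_on_mult_right E_integrable ab')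
    fix x assume x: "x \<in> {a..b}"
    have "0 \<le> (s - w x)\<^sup>2" by simp
    then have "2 * w x \<le> s + (w x)\<^sup>2 / s" using s by (simp add: field_simps power2_eq_square)
    then have "psi x * (2 * w x) \<le> psi x * (s + (w x)\<^sup>2 / s)" using psi_bounds by (intro mult_left_mono) auto
    also have "\<dots> = s * psi x + psi x * (w x)\<^sup>2 / s" by (simp add: algebra_simps)
    also have "\<dots> \<le> s * psi x + C1 * D x / s" using wD[OF x] s by (simp add: divide_right_mono)
    finally have "psi x * (2 * w x) \<le> s * psi x + C1 / s * D x" by simp
    moreover have "psi0 * w x \<le> (2 * psi x) * w x" using psi[OF x] wD[OF x] by (intro mult_right_mono) auto
    ultimately show "4 * psi0 * w x \<le> 4 * (s * psi x + C1 / s * D x)" by simp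
  qed
  also have "\<dots> = 4 * integral {a..b} (\<lambda>x. s * psi x + C1 / s * D x)"
    by (rule Henstock_Kurzweil_Integration.integral_mult_right)
  finally show ?thesis .
qed

text \<open>Near each point one of four situations persists: \<open>psi\<close> stays below
  \<open>h\<close> and the truncation is constant, or \<open>psi\<close> is positive and
  \<open>f\<close> is the larger component, or \<open>g\<close> is, or both are comparable to
  \<open>psi\<close>. The truncation takes care of the zeros of \<open>psi\<close>, near which no
  comparability with \<open>psi x0\<close> holds.\<close>

lemma psi_local:
  assumes s: "s > 0" and h: "h > 0"
  shows "\<exists>d>0. \<forall>a b. a \<le> x0 \<and> x0 \<le> b \<and> b - a < d \<longrightarrow> {a..b} \<subseteq> {lo..hi} \<longrightarrow>
    \<bar>(max (psi b) h)\<^sup>2 - (max (psi a) h)\<^sup>2\<bar> \<le> 4 * integral {a..b} (\<lambda>x. s * psi x + C1 / s * D x)"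
proof -
  have ev: "\<exists>d>0. \<forall>a b. a \<le> x0 \<and> x0 \<le> b \<and> b - a < d \<longrightarrow> {a..b} \<subseteq> {lo..hi} \<longrightarrow> Q a b"
    if P: "\<forall>\<^sub>F y in nhds x0. P y" and Q: "\<And>a b. a \<le> b \<Longrightarrow> {a..b} \<subseteq> {lo..hi} \<Longrightarrow> (\<And>y. y \<in> {a..b} \<Longrightarrow> P y) \<Longrightarrow> Q a b" for P Q
  proof -
    obtain d where d: "d > 0" "\<And>y. dist y x0 < d \<Longrightarrow> P y"
      using P unfolding eventually_nhds_metric by blast
    have "Q a b" if "a \<le> x0" "x0 \<le> b" "b - a < d" "{a..b} \<subseteq> {lo..hi}" for a b
    proof (rule Q)
      fix y assume "y \<in> {a..b}"
      then show "P y" using that by (intro d(2)) (auto simp: dist_real_def)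
    qed (use that in auto)
    then show ?thesis using d(1) by blast
  qed
  have less: "\<forall>\<^sub>F y in nhds x0. k y < l y" if "continuous_on UNIV k" "continuous_on UNIV l" "k x0 < l x0"
    for k l :: "real \<Rightarrow> real"
  proof -
    have "open {y. k y < l y}" using that by (intro open_Collect_less) auto
    then show ?thesis using eventually_nhds_in_open[of "{y. k y < l y}" x0] that(3) by simp
  qed
  have cc: "continuous_on UNIV (\<lambda>x. c)" for c :: real by simp
  show ?thesis
  proof (cases "psi x0 < h")
    case True
    show ?thesis
    proof (rule ev)
      show "\<forall>\<^sub>F y in nhds x0. psi y < h" using True by (intro less cont cc)
      fix a b assume *: "a \<le> b" "{a..b} \<subseteq> {lo..hi}" "\<And>y. y \<in> {a..b} \<Longrightarrow> psi y < h"
      have "0 \<le> integral {a..b} (\<lambda>x. s * psi x + C1 / s * D x)"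
        using s C1_pos psi_bounds D_nonneg by (intro Henstock_Kurzweil_Integration.integral_nonneg E_integrable *) auto
      moreover have "max (psi b) h = h" "max (psi a) h = h" using *(3)[of a] *(3)[of b] *(1) by auto
      ultimately show "\<bar>(max (psi b) h)\<^sup>2 - (max (psi a) h)\<^sup>2\<bar> \<le> 4 * integral {a..b} (\<lambda>x. s * psi x + C1 / s * D x)"
        by simp
    qed
  next
    case False
    then have pos: "psi x0 > 0" using h by simp
    have evpsi: "\<forall>\<^sub>F y in nhds x0. psi x0 / 2 < psi y \<and> psi y < 2 * psi x0"
      using pos by (intro eventually_conj less cont cc) auto
    \<comment> \<open>Common to the two cases in which \<open>psi\<close> coincides near
      \<open>x0\<close> with one term \<open>U\<close> of the maximum and the component
      \<open>k\<close> that weights \<open>v^2\<close> in the dissipation is comparable to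
      \<open>psi\<close>.\<close>
    have dominant: ?thesis
      if k: "\<forall>\<^sub>F y in nhds x0. psi y = U y \<and> psi y \<le> 4 * k y"
        and U: "\<And>x y. x \<le> y \<Longrightarrow> U y - U x = integral {x..y} v" and v: "locally_integrable v"
        and kD: "\<And>x. 4 * k x * (v x)\<^sup>2 \<le> C1 * D x" for U k v
    proof (rule ev)
      show "\<forall>\<^sub>F y in nhds x0. (psi x0 / 2 < psi y \<and> psi y < 2 * psi x0) \<and> psi y = U y \<and> psi y \<le> 4 * k y"
        by (intro eventually_conj evpsi k)
      fix a b assume *: "a \<le> b" "{a..b} \<subseteq> {lo..hi}"
        "\<And>y. y \<in> {a..b} \<Longrightarrow> (psi x0 / 2 < psi y \<and> psi y < 2 * psi x0) \<and> psi y = U y \<and> psi y \<le> 4 * k y"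
      show "\<bar>(max (psi b) h)\<^sup>2 - (max (psi a) h)\<^sup>2\<bar> \<le> 4 * integral {a..b} (\<lambda>x. s * psi x + C1 / s * D x)"
      proof (rule psi_interval[OF s h *(1,2)])
        show "(\<lambda>x. \<bar>v x\<bar>) integrable_on {a..b}" by (intro locally_integrable_HK locally_integrable_abs v)
        show "\<bar>psi b - psi a\<bar> \<le> integral {a..b} (\<lambda>x. \<bar>v x\<bar>)"
          using abs_diff_le_integral[OF U v *(1)] *(1) *(3)[of a] *(3)[of b] by simp
        fix x assume x: "x \<in> {a..b}"
        show "psi x0 / 2 \<le> psi x \<and> psi x \<le> 2 * psi x0" using *(3)[OF x] by auto
        have "psi x * (v x)\<^sup>2 \<le> 4 * k x * (v x)\<^sup>2" using *(3)[OF x] by (intro mult_right_mono) auto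
        then show "0 \<le> \<bar>v x\<bar> \<and> psi x * \<bar>v x\<bar>\<^sup>2 \<le> C1 * D x" using kD[of x] by simp
      qed
    qed
    consider "g x0 < f x0" | "f x0 < g x0" | "f x0 = g x0" by linarith
    then show ?thesis
    proof cases
      case 1
      show ?thesis
      proof (rule dominant[OF _ F_diff loc_p])
        show "\<forall>\<^sub>F y in nhds x0. psi y = F y \<and> psi y \<le> 4 * f y"
          using less[OF cg cf 1]
        proof eventually_elim
          case (elim y)
          then have "F y - u y \<ge> 0" unfolding kappa_diff using R by auto
          then show ?case using elim psi_bounds(2)[of y] by (simp add: psi_def u_def)
        qed
        show "4 * f x * (p x)\<^sup>2 \<le> C1 * D x" for x
        proof -
          have "4 * f x * (p x)\<^sup>2 \<le> 16 * D x" using f_p[of x] by simp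
          also have "\<dots> \<le> C1 * D x" using D_nonneg R Rmu by (intro mult_right_mono) (auto simp: C1_def)
          finally show ?thesis .
        qed
      qed
    next
      case 2
      show ?thesis
      proof (rule dominant[OF _ u_diff loc_q])
        show "\<forall>\<^sub>F y in nhds x0. psi y = u y \<and> psi y \<le> 4 * g y"
          using less[OF cf cg 2]
        proof eventually_elim
          case (elim y)
          then have "F y - u y \<le> 0" unfolding kappa_diff using R by (auto simp: divide_le_0_iff)
          then show ?case using elim psi_bounds(2)[of y] by (simp add: psi_def u_def)
        qed
        show "4 * g x * (q x)\<^sup>2 \<le> C1 * D x" for x
        proof -
          have "4 * g x * (q x)\<^sup>2 \<le> 4 / (R * Rmu) * D x" using g_q[of x] by simp
          also have "\<dots> \<le> C1 * D x" using D_nonneg R Rmu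
            by (intro mult_right_mono) (auto simp: C1_def field_simps)
          finally show ?thesis .
        qed
      qed
    next
      case 3
      \<comment> \<open>Here \<open>psi \<le> 2 * u = 4 * f\<close> at \<open>x0\<close>, which
        leaves room for continuity. Nearby both terms of the maximum have controlled derivatives, so
        it does not matter which of them is attained.\<close>
      have x0: "psi x0 / 8 < f x0" "psi x0 / 8 < g x0" using psi_bounds(2)[of x0] 3 pos by (auto simp: u_def)
      show ?thesis
      proof (rule ev)
        show "\<forall>\<^sub>F y in nhds x0. (psi x0 / 2 < psi y \<and> psi y < 2 * psi x0) \<and> psi x0 / 8 < f y \<and> psi x0 / 8 < g y"
          using x0 by (intro eventually_conj evpsi less cf cg cc)
        fix a b assume *: "a \<le> b" "{a..b} \<subseteq> {lo..hi}"
          "\<And>y. y \<in> {a..b} \<Longrightarrow> (psi x0 / 2 < psi y \<and> psi y < 2 * psi x0) \<and> psi x0 / 8 < f y \<and> psi x0 / 8 < g y"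
        show "\<bar>(max (psi b) h)\<^sup>2 - (max (psi a) h)\<^sup>2\<bar> \<le> 4 * integral {a..b} (\<lambda>x. s * psi x + C1 / s * D x)"
        proof (rule psi_interval[OF s h *(1,2)])
          note i = locally_integrable_HK(1)[OF locally_integrable_abs[OF loc_p]]
             locally_integrable_HK(1)[OF locally_integrable_abs[OF loc_q]]
          show "(\<lambda>x. \<bar>p x\<bar> + \<bar>q x\<bar>) integrable_on {a..b}" by (intro integrable_add i)
          have "\<bar>psi b - psi a\<bar> \<le> \<bar>F b - F a\<bar> + \<bar>u b - u a\<bar>" by (auto simp: psi_def max_def)
          also have "\<dots> \<le> integral {a..b} (\<lambda>x. \<bar>p x\<bar>) + integral {a..b} (\<lambda>x. \<bar>q x\<bar>)"
            using abs_diff_le_integral[OF F_diff loc_p *(1)] abs_diff_le_integral[OF u_diff loc_q *(1)] by simp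
          also have "\<dots> = integral {a..b} (\<lambda>x. \<bar>p x\<bar> + \<bar>q x\<bar>)"
            by (intro Henstock_Kurzweil_Integration.integral_add[symmetric] i)
          finally show "\<bar>psi b - psi a\<bar> \<le> integral {a..b} (\<lambda>x. \<bar>p x\<bar> + \<bar>q x\<bar>)" .
          fix x assume x: "x \<in> {a..b}"
          show "psi x0 / 2 \<le> psi x \<and> psi x \<le> 2 * psi x0" using *(3)[OF x] by auto
          have fg: "psi x \<le> 16 * f x" "psi x \<le> 16 * g x" using *(3)[OF x] by auto
          have "(\<bar>p x\<bar> + \<bar>q x\<bar>)\<^sup>2 \<le> 2 * (p x)\<^sup>2 + 2 * (q x)\<^sup>2"
            using sum_squares_bound[of "\<bar>p x\<bar>" "\<bar>q x\<bar>"] by (simp add: power2_sum)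
          then have "psi x * (\<bar>p x\<bar> + \<bar>q x\<bar>)\<^sup>2 \<le> psi x * (2 * (p x)\<^sup>2 + 2 * (q x)\<^sup>2)"
            using psi_bounds by (intro mult_left_mono) auto
          also have "\<dots> = psi x * (2 * (p x)\<^sup>2) + psi x * (2 * (q x)\<^sup>2)" by (simp add: algebra_simps)
          also have "\<dots> \<le> (16 * f x) * (2 * (p x)\<^sup>2) + (16 * g x) * (2 * (q x)\<^sup>2)"
            using fg by (intro add_mono mult_right_mono) auto
          also have "\<dots> \<le> 32 * (4 * D x) + 32 * (D x / (R * Rmu))" using f_p[of x] g_q[of x] by simp
          also have "\<dots> = C1 * D x" by (simp add: C1_def algebra_simps)
          finally show "0 \<le> \<bar>p x\<bar> + \<bar>q x\<bar> \<and> psi x * (\<bar>p x\<bar> + \<bar>q x\<bar>)\<^sup>2 \<le> C1 * D x" by simp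
        qed
      qed
    qed
  qed
qed

text \<open>Bisection passes from local to global, since the right-hand side is additive over
  adjacent intervals and the left-hand side obeys the triangle inequality.\<close>

lemma psi_global:
  assumes s: "s > 0" and h: "h > 0" and "x \<le> y" "{x..y} \<subseteq> {lo..hi}"
  shows "\<bar>(max (psi y) h)\<^sup>2 - (max (psi x) h)\<^sup>2\<bar> \<le> 4 * integral {x..y} (\<lambda>x. s * psi x + C1 / s * D x)"
proof -
  let ?E = "\<lambda>x. s * psi x + C1 / s * D x"
  let ?H = "\<lambda>x. (max (psi x) h)\<^sup>2"
  have "{x..y} \<subseteq> {lo..hi} \<longrightarrow> \<bar>?H y - ?H x\<bar> \<le> 4 * integral {x..y} ?E"
    using \<open>x \<le> y\<close>
  proof (induction rule: Bolzano)
    case (trans a b c)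
    show ?case
    proof
      assume sub: "{a..c} \<subseteq> {lo..hi}"
      then have sub': "{a..b} \<subseteq> {lo..hi}" "{b..c} \<subseteq> {lo..hi}" using trans by auto
      have "integral {a..b} ?E + integral {b..c} ?E = integral {a..c} ?E"
        by (rule Henstock_Kurzweil_Integration.integral_combine[OF trans(3,4) E_integrable[OF sub]])
      then show "\<bar>?H c - ?H a\<bar> \<le> 4 * integral {a..c} ?E" using trans(1,2) sub' by linarith
    qed
  next
    case (local x)
    show ?case using psi_local[OF s h, of x] by blast
  qed
  then show ?thesis using assms(4) by blast
qed

text \<open>Truncation raises the square by at most \<open>h^2\<close>, and \<open>h\<close> is
  arbitrary.\<close>

lemma psi_le:
  assumes s: "s > 0" and x: "x \<in> {lo..hi}" and y: "y \<in> {lo..hi}"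
  shows "(psi x)\<^sup>2 \<le> (psi y)\<^sup>2 + 4 * integral {lo..hi} (\<lambda>x. s * psi x + C1 / s * D x)"
proof (rule field_le_epsilon)
  fix e :: real assume e: "e > 0"
  let ?E = "\<lambda>x. s * psi x + C1 / s * D x"
  define h where "h = sqrt e"
  have h: "h > 0" "h\<^sup>2 = e" using e by (auto simp: h_def)
  have sub: "integral {a..b} ?E \<le> integral {lo..hi} ?E" if "{a..b} \<subseteq> {lo..hi}" for a b
    using that s C1_pos psi_bounds D_nonneg
    by (intro integral_subset_le E_integrable) auto
  have "\<bar>(max (psi x) h)\<^sup>2 - (max (psi y) h)\<^sup>2\<bar> \<le> 4 * integral {lo..hi} ?E"
  proof (cases "x \<le> y")
    case True
    then show ?thesis using psi_global[OF s h(1) True] sub[of x y] x y by (auto simp: abs_minus_commute)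
  next
    case False
    then show ?thesis using psi_global[OF s h(1), of y x] sub[of y x] x y by auto
  qed
  moreover have "(psi x)\<^sup>2 \<le> (max (psi x) h)\<^sup>2" using psi_bounds by (intro power_mono) auto
  moreover have "(max (psi y) h)\<^sup>2 \<le> (psi y)\<^sup>2 + h\<^sup>2" by (auto simp: max_def)
  ultimately show "(psi x)\<^sup>2 \<le> (psi y)\<^sup>2 + 4 * integral {lo..hi} ?E + e" using h by linarith
qed

text \<open>Comparing \<open>u x\<close> with \<open>u y\<close> and averaging over all
  \<open>y\<close> replaces the value at an unknown point by the mean over the interval.\<close>

lemma u_le:
  assumes s: "s > 0" and x: "x \<in> {lo..hi}"
  shows "(u x)\<^sup>2 \<le> 8 * C1 * ((integral {lo..hi} u / (hi - lo))\<^sup>2 + s * integral {lo..hi} u + integral {lo..hi} D / s)"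
proof -
  let ?m = "integral {lo..hi} u" and ?d = "integral {lo..hi} D" and ?L = "hi - lo"
  have iu: "u integrable_on {lo..hi}" "psi integrable_on {lo..hi}" "D integrable_on {lo..hi}"
    using cont by (auto intro!: integrable_continuous_real D_integrable intro: continuous_on_subset)
  have m: "?m \<ge> 0" "?d \<ge> 0" using iu psi_bounds D_nonneg by (auto intro!: Henstock_Kurzweil_Integration.integral_nonneg)
  have C: "C1 \<ge> 128" using R Rmu by (simp add: C1_def)
  define X where "X = 8 * s * ?m + 4 * C1 * ?d / s"
  have X0: "X \<ge> 0" using m s C by (simp add: X_def)
  have E: "4 * integral {lo..hi} (\<lambda>x. s * psi x + C1 / s * D x) \<le> X"
  proof -
    have "integral {lo..hi} (\<lambda>x. s * psi x + C1 / s * D x)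
       = integral {lo..hi} (\<lambda>x. s * psi x) + integral {lo..hi} (\<lambda>x. C1 / s * D x)"
      by (rule Henstock_Kurzweil_Integration.integral_add[OF integrable_on_mult_right[OF iu(2)] integrable_on_mult_right[OF iu(3)]])
    also have "\<dots> = s * integral {lo..hi} psi + C1 / s * ?d"
      by (simp only: Henstock_Kurzweil_Integration.integral_mult_right)
    finally have "integral {lo..hi} (\<lambda>x. s * psi x + C1 / s * D x) = s * integral {lo..hi} psi + C1 / s * ?d" .
    moreover
    have "integral {lo..hi} psi \<le> integral {lo..hi} (\<lambda>x. 2 * u x)"
      using iu psi_bounds by (intro integral_le integrable_on_mult_right) auto
    then have "s * integral {lo..hi} psi \<le> s * (2 * ?m)" using s by (intro mult_left_mono) auto
    ultimately show ?thesis by (simp add: X_def)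
  qed
  have pt: "u x \<le> 2 * u y + sqrt X" if y: "y \<in> {lo..hi}" for y
  proof -
    have "(u x)\<^sup>2 \<le> (psi x)\<^sup>2" using psi_bounds by (intro power_mono) auto
    also have "\<dots> \<le> (psi y)\<^sup>2 + X" using psi_le[OF s x y] E by simp
    also have "(psi y)\<^sup>2 \<le> (2 * u y)\<^sup>2" using psi_bounds by (intro power_mono) auto
    also have "(2 * u y)\<^sup>2 + X \<le> (2 * u y + sqrt X)\<^sup>2" using X0 psi_bounds(3)[of y] by (simp add: power2_sum)
    finally show ?thesis by (rule power2_le_imp_le) (use psi_bounds(3)[of y] X0 in auto)
  qed
  have "?L * u x = integral {lo..hi} (\<lambda>y. u x)" using ab by simp
  also have "\<dots> \<le> integral {lo..hi} (\<lambda>y. 2 * u y + sqrt X)"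
    using iu pt by (intro integral_le integrable_add integrable_on_mult_right) auto
  also have "\<dots> = 2 * ?m + ?L * sqrt X"
    using iu ab by (subst Henstock_Kurzweil_Integration.integral_add) (auto intro: integrable_on_mult_right)
  finally have "u x \<le> 2 * (?m / ?L) + sqrt X" using ab by (simp add: field_simps)
  then have "(u x)\<^sup>2 \<le> (2 * (?m / ?L) + sqrt X)\<^sup>2" using psi_bounds by (intro power_mono) auto
  also have "\<dots> \<le> 2 * (2 * (?m / ?L))\<^sup>2 + 2 * (sqrt X)\<^sup>2"
    using sum_squares_bound[of "2 * (?m / ?L)" "sqrt X"] by (simp add: power2_sum)
  also have "\<dots> = 8 * (?m / ?L)\<^sup>2 + 16 * (s * ?m) + 8 * C1 * (?d / s)"
    unfolding real_sqrt_pow2[OF X0] power_mult_distrib by (simp add: X_def)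
  also have "\<dots> \<le> 8 * C1 * (?m / ?L)\<^sup>2 + 8 * C1 * (s * ?m) + 8 * C1 * (?d / s)"
    using C m s by (intro add_mono mult_right_mono) auto
  finally show ?thesis by (simp add: algebra_simps)
qed

end

text \<open>This is \<open>8 * C1\<close>, written outside of the locale so that later constants
  visibly depend on \<open>R\<close> and \<open>Rmu\<close> only.\<close>

definition sup_const :: "real \<Rightarrow> real \<Rightarrow> real" where
  "sup_const R Rmu = 8 * (128 + 32 / (R * Rmu))"

text \<open>Continuous representatives of \<open>f\<close> and \<open>g\<close> enter the locale
  \<open>profile\<close>; the weak derivatives are kept, so the dissipation changes only on a null
  set.\<close>

lemma AE_sup_bound:
  assumes R: "R > 0" "Rmu > 0" and w: "has_weak_deriv f f'" "has_weak_deriv g g'"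
    and nn: "AE x in lebesgue. 0 \<le> f x" "AE x in lebesgue. 0 \<le> g x"
    and ab: "lo < hi" and s: "s > 0"
    and D: "set_integrable lebesgue {lo..hi} (dissipation R Rmu f g f' g')"
  shows "AE x in lebesgue. x \<in> {lo..hi} \<longrightarrow> (f x + g x)\<^sup>2 \<le>
    sup_const R Rmu * (((LINT x:{lo..hi}|lebesgue. f x + g x) / (hi - lo))\<^sup>2 + s * (LINT x:{lo..hi}|lebesgue. f x + g x)
      + (LINT x:{lo..hi}|lebesgue. dissipation R Rmu f g f' g' x) / s)"
proof -
  obtain F where F: "AE x in lebesgue. f x = F x" "continuous_on UNIV F"
    "\<And>x y. x \<le> y \<Longrightarrow> F y - F x = integral {x..y} f'"
    using weak_deriv_continuous_representative[OF w(1)] by blast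
  obtain G where G: "AE x in lebesgue. g x = G x" "continuous_on UNIV G"
    "\<And>x y. x \<le> y \<Longrightarrow> G y - G x = integral {x..y} g'"
    using weak_deriv_continuous_representative[OF w(2)] by blast
  have F0: "0 \<le> F x" for x
  proof (rule nonneg_of_AE_nonneg[OF F(2)])
    show "AE x in lebesgue. 0 \<le> F x" using nn(1) F(1) by eventually_elim auto
  qed
  have G0: "0 \<le> G x" for x
  proof (rule nonneg_of_AE_nonneg[OF G(2)])
    show "AE x in lebesgue. 0 \<le> G x" using nn(2) G(1) by eventually_elim auto
  qed
  let ?D = "dissipation R Rmu f g f' g'" and ?E = "dissipation R Rmu F G f' g'"
  have l: "locally_integrable f" "locally_integrable g" "locally_integrable f'" "locally_integrable g'"
    using w by (auto simp: has_weak_deriv_loc)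
  have cFG: "continuous_on {lo..hi} (\<lambda>x. F x + G x)"
    using F(2) G(2) by (auto intro!: continuous_intros intro: continuous_on_subset)
  have lF: "locally_integrable F" "locally_integrable G"
    using F(2) G(2) by (auto simp: locally_integrable_def intro!: absolutely_integrable_continuous_real intro: continuous_on_subset)
  note [measurable] = l[THEN locally_integrable_measurable] lF[THEN locally_integrable_measurable]
  have mD: "?D \<in> borel_measurable lebesgue" "?E \<in> borel_measurable lebesgue"
    unfolding dissipation_def[abs_def] by measurable
  have ind: "(\<lambda>x. indicator {lo..hi} x :: real) \<in> borel_measurable lebesgue" by (intro borel_measurable_indicator) auto
  have eqD: "AE x in lebesgue. ?D x = ?E x" using F(1) G(1) by eventually_elim (simp add: dissipation_def)
  have iE: "set_integrable lebesgue {lo..hi} ?E"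
    unfolding set_integrable_def
  proof (rule integrable_cong_AE_imp[OF D[unfolded set_integrable_def]])
    show "(\<lambda>x. indicator {lo..hi} x *\<^sub>R ?E x) \<in> borel_measurable lebesgue"
      using ind mD by auto
    show "AE x in lebesgue. indicator {lo..hi} x *\<^sub>R ?D x = indicator {lo..hi} x *\<^sub>R ?E x"
      using eqD by eventually_elim simp
  qed
  interpret profile R Rmu F G f' g' lo hi
    by unfold_locales (use R F G F0 G0 l ab iE in auto)
  have e1: "integral {lo..hi} u = (LINT x:{lo..hi}|lebesgue. f x + g x)"
  proof -
    have "integral {lo..hi} u = (LINT x:{lo..hi}|lebesgue. F x + G x)"
      unfolding u_def using set_lebesgue_integral_eq_integral[OF absolutely_integrable_continuous_real[OF cFG]] by simp
    also have "\<dots> = (LINT x:{lo..hi}|lebesgue. f x + g x)"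
      unfolding set_lebesgue_integral_def
    proof (rule integral_cong_AE)
      show "AE x in lebesgue. indicator {lo..hi} x *\<^sub>R (F x + G x) = indicator {lo..hi} x *\<^sub>R (f x + g x)"
        using F(1) G(1) by eventually_elim simp
    qed (use ind in auto)
    finally show ?thesis .
  qed
  have e2: "integral {lo..hi} ?E = (LINT x:{lo..hi}|lebesgue. ?D x)"
  proof -
    have "integral {lo..hi} ?E = (LINT x:{lo..hi}|lebesgue. ?E x)"
      using set_lebesgue_integral_eq_integral[OF iE] by simp
    also have "\<dots> = (LINT x:{lo..hi}|lebesgue. ?D x)"
      unfolding set_lebesgue_integral_def
    proof (rule integral_cong_AE)
      show "AE x in lebesgue. indicator {lo..hi} x *\<^sub>R ?E x = indicator {lo..hi} x *\<^sub>R ?D x"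
        using eqD by eventually_elim simp
    qed (use ind mD in auto)
    finally show ?thesis .
  qed
  have K: "8 * C1 = sup_const R Rmu" by (simp add: C1_def sup_const_def)
  show ?thesis using F(1) G(1)
  proof eventually_elim
    case (elim x)
    show ?case using u_le[OF s, of x] unfolding e1 e2 K by (simp add: u_def elim)
  qed
qed

section \<open>Bounds at fixed time and cutoffs\<close>

abbreviation nnint :: "real set \<Rightarrow> (real \<Rightarrow> real) \<Rightarrow> ennreal" where
  "nnint A h \<equiv> (\<integral>\<^sup>+x\<in>A. ennreal (h x) \<partial>lebesgue)"

lemma \<K>_D:
  assumes "f \<in> \<K>"
  shows "f \<in> borel_measurable lebesgue" "integrable lebesgue f" "integrable lebesgue (\<lambda>x. (f x)\<^sup>2)"
    "AE x in lebesgue. 0 \<le> f x"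
proof -
  show m: "f \<in> borel_measurable lebesgue" and "integrable lebesgue (\<lambda>x. (f x)\<^sup>2)" "AE x in lebesgue. 0 \<le> f x"
    using assms by (auto simp: \<K>_def Lp_def)
  have "integrable lebesgue (\<lambda>x. f x * (1 + x\<^sup>2))" using assms by (simp add: \<K>_def)
  then show "integrable lebesgue f"
  proof (rule Bochner_Integration.integrable_bound[OF _ m])
    have "\<bar>f x\<bar> \<le> \<bar>f x * (1 + x\<^sup>2)\<bar>" for x
      using mult_left_mono[of 1 "1 + x\<^sup>2" "\<bar>f x\<bar>"] by (simp add: abs_mult)
    then show "AE x in lebesgue. norm (f x) \<le> norm (f x * (1 + x\<^sup>2))" by simp
  qed
qed

lemma nn_integral_set_eq_integral:
  fixes h :: "real \<Rightarrow> real"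
  assumes m: "h \<in> borel_measurable lebesgue" and nn: "AE x in lebesgue. 0 \<le> h x"
    and fin: "nnint {lo..hi} h < \<infinity>"
  shows "set_integrable lebesgue {lo..hi} h"
    "nnint {lo..hi} h = ennreal (LINT x:{lo..hi}|lebesgue. h x)"
    "0 \<le> (LINT x:{lo..hi}|lebesgue. h x)"
proof -
  have eq: "nnint {lo..hi} h = (\<integral>\<^sup>+x. ennreal (indicator {lo..hi} x * h x) \<partial>lebesgue)"
    by (intro nn_integral_cong) (auto split: split_indicator)
  have nn': "AE x in lebesgue. 0 \<le> indicator {lo..hi} x * h x" using nn by eventually_elim auto
  have m': "(\<lambda>x. indicator {lo..hi} x * h x) \<in> borel_measurable lebesgue"
    by (intro borel_measurable_times borel_measurable_indicator m) auto
  have i: "integrable lebesgue (\<lambda>x. indicator {lo..hi} x * h x)"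
    by (rule integrableI_nonneg[OF m' nn']) (use fin eq in simp)
  show "set_integrable lebesgue {lo..hi} h" using i by (simp add: set_integrable_def)
  show "nnint {lo..hi} h = ennreal (LINT x:{lo..hi}|lebesgue. h x)"
    unfolding eq set_lebesgue_integral_def using nn_integral_eq_integral[OF i nn'] by simp
  show "0 \<le> (LINT x:{lo..hi}|lebesgue. h x)"
    unfolding set_lebesgue_integral_def using integral_nonneg_AE[OF nn'] by simp
qed

lemma sup_bound_nn:
  assumes R: "R > 0" "Rmu > 0" and K: "f \<in> \<K>" "g \<in> \<K>"
    and w: "has_weak_deriv f f'" "has_weak_deriv g g'"
    and ab: "lo < hi" and s: "s > 0"
    and fin: "nnint {lo..hi} (dissipation R Rmu f g f' g') = ennreal d" "d \<ge> 0"
    and mass: "nnint {lo..hi} (\<lambda>x. f x + g x) \<le> ennreal m" "m \<ge> 0"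
  shows "AE x in lebesgue. x \<in> {lo..hi} \<longrightarrow> (f x + g x)\<^sup>2 \<le> sup_const R Rmu * ((m / (hi - lo))\<^sup>2 + s * m + d / s)"
proof -
  let ?D = "dissipation R Rmu f g f' g'" and ?m = "LINT x:{lo..hi}|lebesgue. f x + g x"
  note f = \<K>_D[OF K(1)] and g = \<K>_D[OF K(2)]
  have l: "locally_integrable f'" "locally_integrable g'" using w by (auto simp: has_weak_deriv_loc)
  note [measurable] = f(1) g(1) l[THEN locally_integrable_measurable]
  have mD: "?D \<in> borel_measurable lebesgue"
    unfolding dissipation_def[abs_def] by measurable
  have nnD: "AE x in lebesgue. 0 \<le> ?D x"
    using f(4) g(4) by eventually_elim (use R in \<open>simp add: dissipation_def\<close>)
  have nnu: "AE x in lebesgue. 0 \<le> f x + g x" using f(4) g(4) by eventually_elim simp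
  have D: "set_integrable lebesgue {lo..hi} (?D)"
    "(LINT x:{lo..hi}|lebesgue. ?D x) = d"
    using nn_integral_set_eq_integral[OF mD nnD, of lo hi] fin by auto
  have fin2: "nnint {lo..hi} (\<lambda>x. f x + g x) < \<infinity>" using mass by (simp add: le_less_trans)
  have m': "?m \<le> m" "0 \<le> ?m"
    using nn_integral_set_eq_integral[OF _ nnu fin2] mass by auto
  have S: "sup_const R Rmu \<ge> 0" using R by (simp add: sup_const_def)
  show ?thesis using AE_sup_bound[OF R w f(4) g(4) ab s D(1)]
  proof eventually_elim
    case (elim x)
    have "(?m / (hi - lo))\<^sup>2 \<le> (m / (hi - lo))\<^sup>2"
      using m' ab by (intro power_mono divide_right_mono) auto
    moreover have "s * ?m \<le> s * m" using m' s by simp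
    ultimately have "sup_const R Rmu * ((?m / (hi - lo))\<^sup>2 + s * ?m
      + (LINT x:{lo..hi}|lebesgue. ?D x) / s)
     \<le> sup_const R Rmu * ((m / (hi - lo))\<^sup>2 + s * m + d / s)"
      unfolding D(2) by (intro mult_left_mono[OF _ S]) linarith
    then show ?case using elim by auto
  qed
qed

lemma sup_const_ge: "R > 0 \<Longrightarrow> Rmu > 0 \<Longrightarrow> sup_const R Rmu \<ge> 1"
  by (simp add: sup_const_def)

lemma nn_integral_mult_le:
  assumes ae: "AE x in lebesgue. x \<in> A \<longrightarrow> h x \<le> c * k x" and c: "c > 0"
  shows "nnint A h \<le> ennreal c * (nnint A k)"
proof -
  have "nnint A h \<le> (\<integral>\<^sup>+x. ennreal c * (ennreal (k x) * indicator A x) \<partial>lebesgue)"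
  proof (rule nn_integral_mono_AE)
    show "AE x in lebesgue. ennreal (h x) * indicator A x \<le> ennreal c * (ennreal (k x) * indicator A x)"
      using ae
    proof eventually_elim
      case (elim x)
      then show ?case using c ennreal_leI[of "h x" "c * k x"] by (cases "x \<in> A") (auto simp: ennreal_mult')
    qed
  qed
  also have "\<dots> \<le> ennreal c * (nnint A k)"
    by (rule nn_integral_cmult_le[OF c])
  finally show ?thesis .
qed

text \<open>In u^3 = u^2 u the first factor is bounded by its supremum and the second one is
  integrated. The supremum bound for u^2 is affine in the dissipation as it stands, and
  \<open>s\<close> remains free for the absorption in \<open>Y_half_ball\<close>.\<close>

lemma cube_mass_bound:
  assumes R: "R > 0" "Rmu > 0" and K: "f \<in> \<K>" "g \<in> \<K>"
    and w: "has_weak_deriv f f'" "has_weak_deriv g g'"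
    and ab: "lo < hi" and s: "s > 0" and M: "M > 0"
    and mass: "nnint {lo..hi} (\<lambda>x. f x + g x) \<le> ennreal M"
  shows "nnint {lo..hi} (\<lambda>x. (f x + g x) ^ 3)
    \<le> ennreal (sup_const R Rmu * M / s) * (nnint {lo..hi} (dissipation R Rmu f g f' g'))
      + ennreal (sup_const R Rmu * (M^3 / (hi - lo)\<^sup>2 + s * M\<^sup>2))"
proof (cases "nnint {lo..hi} (dissipation R Rmu f g f' g')" rule: ennreal_cases)
  case (real d)
  define S where "S = sup_const R Rmu"
  have S: "S \<ge> 1" using sup_const_ge[OF R] by (simp add: S_def)
  define c where "c = S * ((M / (hi - lo))\<^sup>2 + s * M + d / s)"
  have "0 < s * M" using s M by simp
  moreover have "0 \<le> (M / (hi - lo))\<^sup>2" "0 \<le> d / s" using real(1) s by auto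
  ultimately have "0 < (M / (hi - lo))\<^sup>2 + s * M + d / s" by linarith
  then have c: "c > 0" unfolding c_def using S by (intro mult_pos_pos) auto
  have "nnint {lo..hi} (\<lambda>x. (f x + g x) ^ 3) \<le> ennreal c * (nnint {lo..hi} (\<lambda>x. f x + g x))"
  proof (rule nn_integral_mult_le[OF _ c])
    show "AE x in lebesgue. x \<in> {lo..hi} \<longrightarrow> (f x + g x) ^ 3 \<le> c * (f x + g x)"
      using sup_bound_nn[OF R K w ab s real(2) real(1) mass less_imp_le[OF M]] \<K>_D(4)[OF K(1)] \<K>_D(4)[OF K(2)]
    proof eventually_elim
      case (elim x)
      show ?case
      proof
        assume "x \<in> {lo..hi}"
        then have "(f x + g x)\<^sup>2 * (f x + g x) \<le> c * (f x + g x)"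
          using elim by (intro mult_right_mono) (auto simp: c_def S_def)
        then show "(f x + g x) ^ 3 \<le> c * (f x + g x)" by (simp add: power3_eq_cube power2_eq_square)
      qed
    qed
  qed
  also have "\<dots> \<le> ennreal c * ennreal M" using mass by (intro mult_left_mono) auto
  also have "\<dots> = ennreal (c * M)" using c M by (simp add: ennreal_mult)
  also have "c * M = S * M / s * d + S * (M^3 / (hi - lo)\<^sup>2 + s * M\<^sup>2)"
    unfolding c_def by (simp add: algebra_simps power2_eq_square power3_eq_cube add_divide_distrib)
  also have "ennreal \<dots> = ennreal (S * M / s) * ennreal d + ennreal (S * (M^3 / (hi - lo)\<^sup>2 + s * M\<^sup>2))"
    using S M s real by (subst ennreal_plus) (auto simp: ennreal_mult[symmetric])
  finally show ?thesis using real by (simp add: S_def)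
next
  case top
  define c where "c = sup_const R Rmu * M / s"
  have "c > 0" using sup_const_ge[OF R] M s by (simp add: c_def)
  then show ?thesis unfolding top c_def[symmetric] by (simp add: ennreal_mult_top)
qed

text \<open>In u^3 = u u^2 the first factor is bounded by its supremum and the second one by the
  energy, the mass in the supremum bound being estimated by Cauchy-Schwarz. The choice
  \<open>s = eta / l\<close> splits the mixed term \<open>s * m\<close> into \<open>eta^2\<close>
  and \<open>(m / l)^2\<close>.\<close>

lemma cube_energy_bound:
  assumes R: "R > 0" "Rmu > 0" and K: "f \<in> \<K>" "g \<in> \<K>"
    and w: "has_weak_deriv f f'" "has_weak_deriv g g'"
    and ab: "lo < hi" and eta: "eta > 0" and L: "Lam > 0"
    and energy: "nnint {lo..hi} (\<lambda>x. (f x + g x)\<^sup>2) \<le> ennreal Lam"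
  shows "nnint {lo..hi} (\<lambda>x. (f x + g x) ^ 3)
    \<le> ennreal (2 * sup_const R Rmu * Lam * (hi - lo) / eta\<^sup>2) * (nnint {lo..hi} (dissipation R Rmu f g f' g'))
      + ennreal (2 * sup_const R Rmu * Lam * (eta + Lam / ((hi - lo) * eta)))"
proof (cases "nnint {lo..hi} (dissipation R Rmu f g f' g')" rule: ennreal_cases)
  case (real d)
  define S where "S = sup_const R Rmu"
  have S: "S \<ge> 1" using sup_const_ge[OF R] by (simp add: S_def)
  define l where "l = hi - lo"
  have l: "l > 0" using ab by (simp add: l_def)
  define m where "m = sqrt (l * Lam)"
  have m: "m > 0" "m\<^sup>2 = l * Lam" using l L by (auto simp: m_def)
  have mass: "nnint {lo..hi} (\<lambda>x. f x + g x) \<le> ennreal m"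
  proof -
    \<comment> \<open>With this \<open>h\<close>, Young's inequality is as good as Cauchy-Schwarz:
      both of its terms integrate to at most \<open>m / 2\<close>.\<close>
    define h where "h = Lam / m"
    have h: "h > 0" using L m by (simp add: h_def)
    have "nnint {lo..hi} (\<lambda>x. f x + g x)
      \<le> (\<integral>\<^sup>+x. ennreal (1 / (2 * h)) * (ennreal ((f x + g x)\<^sup>2) * indicator {lo..hi} x) + ennreal (h / 2) * indicator {lo..hi} x \<partial>lebesgue)"
    proof (rule nn_integral_mono)
      fix x
      have "0 \<le> (f x + g x - h)\<^sup>2" by simp
      then have "f x + g x \<le> 1 / (2 * h) * (f x + g x)\<^sup>2 + h / 2" using h by (simp add: field_simps power2_eq_square)
      then have "ennreal (f x + g x) \<le> ennreal (1 / (2 * h)) * ennreal ((f x + g x)\<^sup>2) + ennreal (h / 2)"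
        using h by (simp add: ennreal_mult[symmetric] ennreal_plus[symmetric] ennreal_leI del: ennreal_plus)
      then show "ennreal (f x + g x) * indicator {lo..hi} x
         \<le> ennreal (1 / (2 * h)) * (ennreal ((f x + g x)\<^sup>2) * indicator {lo..hi} x) + ennreal (h / 2) * indicator {lo..hi} x"
        by (auto split: split_indicator)
    qed
    also have "\<dots> \<le> (\<integral>\<^sup>+x. ennreal (1 / (2 * h)) * (ennreal ((f x + g x)\<^sup>2) * indicator {lo..hi} x) \<partial>lebesgue)
        + (\<integral>\<^sup>+x. ennreal (h / 2) * indicator {lo..hi} x \<partial>lebesgue)"
      by (intro nn_integral_add_le borel_measurable_times_ennreal borel_measurable_indicator)
        (auto split: split_indicator)
    also have "(\<integral>\<^sup>+x. ennreal (h / 2) * indicator {lo..hi} x \<partial>lebesgue) = ennreal (h / 2 * l)"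
      using ab h by (subst nn_integral_cmult_indicator) (auto simp: ennreal_mult[symmetric] l_def)
    also have "(\<integral>\<^sup>+x. ennreal (1 / (2 * h)) * (ennreal ((f x + g x)\<^sup>2) * indicator {lo..hi} x) \<partial>lebesgue)
       \<le> ennreal (1 / (2 * h)) * (nnint {lo..hi} (\<lambda>x. (f x + g x)\<^sup>2))"
      using h by (intro nn_integral_cmult_le) auto
    also have "\<dots> \<le> ennreal (1 / (2 * h)) * ennreal Lam" by (intro mult_left_mono energy) auto
    also have "\<dots> = ennreal (1 / (2 * h) * Lam)" using h L by (intro ennreal_mult[symmetric]) auto
    also have "1 / (2 * h) * Lam = m / 2" using L m(1) by (simp add: h_def)
    also have "h / 2 * l = m / 2" using m l L by (simp add: h_def power2_eq_square field_simps)
    also have "ennreal (m/2) + ennreal (m/2) = ennreal m" using m by (simp flip: ennreal_plus)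
    finally show ?thesis by (simp add: add_right_mono)
  qed
  define c where "c = 2 * S * (eta + Lam / (l * eta) + l * d / eta\<^sup>2)"
  have c: "c > 0" unfolding c_def using S real(1) eta L l by (intro mult_pos_pos add_pos_nonneg) auto
  have s: "eta / l > 0" using eta l by simp
  have "nnint {lo..hi} (\<lambda>x. (f x + g x) ^ 3) \<le> ennreal c * (nnint {lo..hi} (\<lambda>x. (f x + g x)\<^sup>2))"
  proof (rule nn_integral_mult_le[OF _ c])
    show "AE x in lebesgue. x \<in> {lo..hi} \<longrightarrow> (f x + g x) ^ 3 \<le> c * (f x + g x)\<^sup>2"
      using sup_bound_nn[OF R K w ab s real(2) real(1) mass less_imp_le[OF m(1)]] \<K>_D(4)[OF K(1)] \<K>_D(4)[OF K(2)]
    proof eventually_elim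
      case (elim x)
      show ?case
      proof
        let ?u = "f x + g x"
        assume "x \<in> {lo..hi}"
        then have u2: "?u\<^sup>2 \<le> S * ((m / l)\<^sup>2 + eta / l * m + d / (eta / l))"
          using elim by (auto simp: l_def S_def)
        have "(m / l)\<^sup>2 = Lam / l" using m l by (simp add: power_divide power2_eq_square)
        moreover have "eta / l * m \<le> eta\<^sup>2 + (m / l)\<^sup>2"
        proof -
          have "0 \<le> eta / l * m" using eta m l by simp
          moreover have "2 * (eta / l * m) \<le> eta\<^sup>2 + (m / l)\<^sup>2" using sum_squares_bound[of eta "m / l"] by simp
          ultimately show ?thesis by linarith
        qed
        moreover have "d / (eta / l) = l * d / eta" by (simp add: mult.commute)
        ultimately have "(m / l)\<^sup>2 + eta / l * m + d / (eta / l) \<le> eta\<^sup>2 + 2 * (Lam / l) + l * d / eta" by linarith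
        then have "S * ((m / l)\<^sup>2 + eta / l * m + d / (eta / l)) \<le> S * (eta\<^sup>2 + 2 * (Lam / l) + l * d / eta)"
          using S by (intro mult_left_mono) auto
        with u2 have "?u\<^sup>2 \<le> S * (eta\<^sup>2 + 2 * (Lam / l) + l * d / eta)" by linarith
        then have "?u\<^sup>2 / eta \<le> S * (eta\<^sup>2 + 2 * (Lam / l) + l * d / eta) / eta" using eta by (intro divide_right_mono) auto
        also have "\<dots> = S * (eta + 2 * (Lam / (l * eta)) + l * d / eta\<^sup>2)"
          using eta by (simp add: field_simps power2_eq_square)
        finally have *: "?u\<^sup>2 / eta \<le> S * (eta + 2 * (Lam / (l * eta)) + l * d / eta\<^sup>2)" .
        \<comment> \<open>This gives \<open>?u \<le> eta + ?u^2 / eta\<close>, which converts the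
          bound for the square into one for \<open>?u\<close> that is still affine in
          \<open>d\<close>; taking a root would destroy this.\<close>
        have "0 \<le> (?u - eta)\<^sup>2 + ?u * eta" using elim eta by simp
        then have "?u * eta \<le> eta * eta + ?u\<^sup>2" by (simp add: power2_eq_square algebra_simps)
        then have "?u \<le> eta + ?u\<^sup>2 / eta" using eta by (simp add: field_simps)
        also have "\<dots> \<le> S * eta + S * (eta + 2 * (Lam / (l * eta)) + l * d / eta\<^sup>2)"
          using * S eta by (intro add_mono) auto
        also have "\<dots> = 2 * (S * eta) + 2 * (S * (Lam / (l * eta))) + S * (l * d / eta\<^sup>2)" by (simp add: algebra_simps)
        also have "\<dots> \<le> 2 * (S * eta) + 2 * (S * (Lam / (l * eta))) + 2 * (S * (l * d / eta\<^sup>2))"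
        proof -
          have "0 \<le> S * (l * d / eta\<^sup>2)" using S real(1) l by simp
          then show ?thesis by (intro add_left_mono) (simp only: mult_2 le_add_same_cancel1)
        qed
        also have "\<dots> = c" by (simp add: c_def algebra_simps)
        finally have "?u * ?u\<^sup>2 \<le> c * ?u\<^sup>2" by (intro mult_right_mono) auto
        then show "?u ^ 3 \<le> c * ?u\<^sup>2" by (simp add: power3_eq_cube power2_eq_square mult.assoc)
      qed
    qed
  qed
  also have "\<dots> \<le> ennreal c * ennreal Lam" using energy by (intro mult_left_mono) auto
  also have "\<dots> = ennreal (c * Lam)" using c L by (simp add: ennreal_mult)
  also have "c * Lam = 2 * S * Lam * l / eta\<^sup>2 * d + 2 * S * Lam * (eta + Lam / (l * eta))"
    unfolding c_def by (simp add: algebra_simps)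
  also have "ennreal \<dots> = ennreal (2 * S * Lam * l / eta\<^sup>2) * ennreal d + ennreal (2 * S * Lam * (eta + Lam / (l * eta)))"
    using S L l eta real by (subst ennreal_plus) (auto simp: ennreal_mult[symmetric])
  finally show ?thesis using real by (simp add: S_def l_def)
next
  case top
  define c where "c = 2 * sup_const R Rmu * Lam * (hi - lo) / eta\<^sup>2"
  have "c > 0" using sup_const_ge[OF R] L eta ab by (simp add: c_def)
  then show ?thesis unfolding top c_def[symmetric] by (simp add: ennreal_mult_top)
qed

section \<open>Cutoff functions\<close>

lemma has_weak_deriv_of_integral:
  assumes v: "locally_integrable v" and U: "\<And>x y. x \<le> y \<Longrightarrow> U y - U x = integral {x..y} v"
  shows "has_weak_deriv U v"
proof -
  have p: "has_weak_deriv (primitive v) v"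
    using v primitive_parts[OF v] by (auto simp: has_weak_deriv_loc locally_integrable_def
      intro!: absolutely_integrable_continuous_real continuous_on_subset[OF primitive_continuous[OF v]])
  have c: "has_weak_deriv (\<lambda>x. 1) (\<lambda>x. 0)"
    unfolding has_weak_deriv_loc
    by (intro conjI ballI locally_integrable_const) (simp add: integral_deriv_test)
  have "U = (\<lambda>x. 1 * primitive v x + U 0 * 1)"
  proof
    fix x
    have z: "primitive v 0 = 0" by (simp add: primitive_def)
    show "U x = 1 * primitive v x + U 0 * 1"
      using U[of 0 x] U[of x 0] primitive_diff[OF v, of 0 x] primitive_diff[OF v, of x 0] z by (cases "0 \<le> x") auto
  qed
  then show ?thesis using has_weak_deriv_lincomb[OF p c, of 1 "U 0"] by simp
qed

text \<open>An absolute constant; the factor 2 accounts for the two steps of which a cutoff is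
  composed.\<close>

definition step_slope :: real where
  "step_slope = (SOME B. B > 0 \<and> (\<forall>x. 2 * \<bar>deriv step x\<bar> \<le> B))"

lemma step_slope: "step_slope > 0" "2 * \<bar>deriv step x\<bar> \<le> step_slope"
proof -
  obtain B where "\<And>x. \<bar>deriv step x\<bar> \<le> B" "B > 0" using test_function_bounded[OF deriv_step(1)] by metis
  then have "2 * B > 0 \<and> (\<forall>x. 2 * \<bar>deriv step x\<bar> \<le> 2 * B)" by auto
  then have "step_slope > 0 \<and> (\<forall>x. 2 * \<bar>deriv step x\<bar> \<le> step_slope)" unfolding step_slope_def by (rule someI)
  then show "step_slope > 0" "2 * \<bar>deriv step x\<bar> \<le> step_slope" by auto
qed

definition cutoff :: "real \<Rightarrow> real \<Rightarrow> real \<Rightarrow> real \<Rightarrow> real" where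
  "cutoff a rho' rho x = step (1 / (rho - rho') * (x - (a - rho))) - step (1 / (rho - rho') * (x - (a + rho')))"

lemma cutoff_test: "0 < rho' \<Longrightarrow> rho' < rho \<Longrightarrow> cutoff a rho' rho \<in> test_functions"
  unfolding cutoff_def[abs_def] by (rule test_function_step) auto

lemma cutoff_bounds:
  assumes "0 < rho'" "rho' < rho"
  shows "0 \<le> cutoff a rho' rho x" "cutoff a rho' rho x \<le> 1" "x \<in> {a-rho'..a+rho'} \<Longrightarrow> cutoff a rho' rho x = 1"
    "x \<notin> {a-rho<..<a+rho} \<Longrightarrow> cutoff a rho' rho x = 0"
    "\<bar>deriv (cutoff a rho' rho) x\<bar> \<le> step_slope / (rho - rho') * indicator {a-rho..a+rho} x"
proof -
  define d y z where "d = rho - rho'" and "y = 1 / d * (x - (a - rho))" and "z = 1 / d * (x - (a + rho'))"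
  have d: "d > 0" using assms by (simp add: d_def)
  have eq: "cutoff a rho' rho x = step y - step z" by (simp add: cutoff_def y_def z_def d_def)
  have "z \<le> y" unfolding y_def z_def using assms d by (intro mult_left_mono) auto
  then show "0 \<le> cutoff a rho' rho x" using step_mono by (simp add: eq)
  show "cutoff a rho' rho x \<le> 1" using step_bounds(2)[of y] step_bounds(1)[of z] by (simp add: eq)
  show "cutoff a rho' rho x = 1" if "x \<in> {a-rho'..a+rho'}"
  proof -
    have "1 \<le> y" "z \<le> 0" using that assms by (auto simp: y_def z_def d_def field_simps)
    then show ?thesis by (simp add: eq step_0 step_1)
  qed
  have out: "y \<le> 0 \<and> z \<le> 0 \<or> 1 \<le> y \<and> 1 \<le> z" if "x \<notin> {a-rho<..<a+rho}"
    using that assms by (auto simp: y_def z_def d_def field_simps)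
  then show "cutoff a rho' rho x = 0" if "x \<notin> {a-rho<..<a+rho}" using that by (auto simp: eq step_0 step_1)
  have "((\<lambda>x. step (1 / d * (x - b))) has_real_derivative 1 / d * deriv step (1 / d * (x - b))) (at x)" for b
  proof -
    have "((\<lambda>x. 1 / d * (x - b)) has_real_derivative 1 / d) (at x)" using d by (auto intro!: derivative_eq_intros)
    from DERIV_chain2[OF smooth_has_deriv[OF smooth_step] this] show ?thesis by (simp only: mult.commute)
  qed
  then have dc: "deriv (cutoff a rho' rho) x = 1 / d * deriv step y - 1 / d * deriv step z"
    unfolding cutoff_def[abs_def] d_def[symmetric] y_def z_def by (intro DERIV_imp_deriv DERIV_diff)
  show "\<bar>deriv (cutoff a rho' rho) x\<bar> \<le> step_slope / (rho - rho') * indicator {a-rho..a+rho} x"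
  proof (cases "x \<in> {a-rho<..<a+rho}")
    case True
    have "\<bar>deriv (cutoff a rho' rho) x\<bar> = \<bar>deriv step y - deriv step z\<bar> / d"
      unfolding dc using d by (simp add: abs_divide flip: diff_divide_distrib)
    also have "\<dots> \<le> step_slope / d"
      using step_slope(2)[of y] step_slope(2)[of z] abs_triangle_ineq4[of "deriv step y" "deriv step z"] d
      by (intro divide_right_mono) linarith+
    finally show ?thesis using True by (simp add: d_def)
  next
    case False
    then have "deriv (cutoff a rho' rho) x = 0" unfolding dc using out deriv_step_0 by auto
    then show ?thesis using assms step_slope(1) by simp
  qed
qed

lemma bounded_support_Lp:
  fixes h :: "real \<Rightarrow> real"
  assumes m: "h \<in> borel_measurable lebesgue" and B: "\<And>x. \<bar>h x\<bar> \<le> B" and 0: "\<And>x. x \<notin> {a..b} \<Longrightarrow> h x = 0" and p: "p > 0"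
  shows "h \<in> Lp p"
proof -
  have "integrable lebesgue (\<lambda>x. 1 * \<bar>h x\<bar> ^ p)"
  proof (rule integrable_bounded_mult)
    show "set_integrable lebesgue {a..b} (\<lambda>x. 1 :: real)" using locally_integrable_const by (simp add: locally_integrable_def)
    show "\<bar>\<bar>h x\<bar> ^ p\<bar> \<le> B ^ p" for x using B by (simp add: power_mono)
  qed (use m 0 p in auto)
  then show ?thesis using m by (simp add: Lp_def)
qed

lemma cutoff_W1:
  assumes "0 < rho'" "rho' < rho"
  shows "cutoff a rho' rho \<in> W1 4" "AE x in lebesgue. wderiv (cutoff a rho' rho) x = deriv (cutoff a rho' rho) x"
proof -
  let ?z = "cutoff a rho' rho"
  have Lp: "xi \<in> Lp 4" if xi: "xi \<in> test_functions" for xi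
  proof -
    obtain N where N: "smooth xi" "\<And>x. \<bar>x\<bar> \<ge> N \<Longrightarrow> xi x = 0" using xi by (auto simp: test_functions_iff)
    obtain B where "\<And>x. \<bar>xi x\<bar> \<le> B" using test_function_bounded xi by metis
    then show ?thesis using N by (intro bounded_support_Lp[where a="-N" and b="N" and B=B] smooth_lebesgue) auto
  qed
  have z: "?z \<in> test_functions" "smooth ?z" using cutoff_test[OF assms] by (auto simp: test_functions_iff)
  have w: "has_weak_deriv ?z (deriv ?z)"
  proof (rule has_weak_deriv_of_integral)
    show "locally_integrable (deriv ?z)" unfolding locally_integrable_def
      by (intro allI absolutely_integrable_continuous_real smooth_continuous smooth_deriv z)
    fix x y :: real assume "x \<le> y"
    then have "(deriv ?z has_integral (?z y - ?z x)) {x..y}"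
      using smooth_has_deriv[OF z(2)]
      by (intro fundamental_theorem_of_calculus) (auto simp: has_vector_derivative_at_within simp flip: has_real_derivative_iff_has_vector_derivative intro: has_field_derivative_at_within)
    then show "?z y - ?z x = integral {x..y} (deriv ?z)" by (simp add: integral_unique)
  qed
  then show "?z \<in> W1 4" using Lp[OF z(1)] Lp[OF test_function_deriv[OF z(1)]] by (auto simp: W1_def)
  show "AE x in lebesgue. wderiv ?z x = deriv ?z x" using w by (rule wderiv_AE)
qed

lemma wderiv_const: "AE x in lebesgue. wderiv (\<lambda>x. c) x = 0"
  by (rule wderiv_AE[OF has_weak_deriv_of_integral]) (auto intro: locally_integrable_const)

section \<open>Consequences of the local energy estimate\<close>

lemma AE_lebesgue_neq: "AE t in lebesgue. t \<noteq> (c :: real)"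
  by (rule AE_completion) (rule AE_lborel_singleton)

lemma nn_integral_zero_weight:
  assumes "AE x in M. h x = 0"
  shows "(\<integral>\<^sup>+x. ennreal (k x * h x) \<partial>M) = 0"
proof -
  have "(\<integral>\<^sup>+x. ennreal (k x * h x) \<partial>M) \<le> (\<integral>\<^sup>+x. 0 \<partial>M)"
    by (rule nn_integral_mono_AE) (use assms in eventually_elim, simp)
  then show ?thesis by simp
qed

locale solution =
  fixes R Rmu :: real and f0 g0 :: "real \<Rightarrow> real" and f g :: "real \<Rightarrow> real \<Rightarrow> real"
  assumes R: "R > 0" and Rmu: "Rmu > 0" and f0: "f0 \<in> \<K>" and g0: "g0 \<in> \<K>"
    and sol: "energy_weak_solution R Rmu f0 g0 f g"
begin

lemma weak: "weak_solution R Rmu f0 g0 f g"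
  using sol by (simp add: energy_weak_solution_def)

lemma estimate: "T > 0 \<Longrightarrow> \<zeta> \<in> W1 4 \<Longrightarrow> local_energy_estimate R Rmu f g T \<zeta>"
  "T > 0 \<Longrightarrow> local_energy_estimate R Rmu f g T (\<lambda>x. 1)"
  using sol by (auto simp: energy_weak_solution_def)

lemma in_\<K>: "t \<ge> 0 \<Longrightarrow> f t \<in> \<K>" "t \<ge> 0 \<Longrightarrow> g t \<in> \<K>"
  using weak by (auto simp: weak_solution_def)

lemma initial: "AE x in lebesgue. f 0 x = f0 x" "AE x in lebesgue. g 0 x = g0 x"
  using weak by (auto simp: weak_solution_def)

lemma AE_weak_deriv:
  "AE t in lebesgue. t > 0 \<longrightarrow> has_weak_deriv (f t) (wderiv (f t)) \<and> has_weak_deriv (g t) (wderiv (g t))"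
proof -
  have *: "AE t in lebesgue. t > 0 \<longrightarrow> u t \<in> H1" if "u \<in> L2_time H1 H1_norm" for u :: "real \<Rightarrow> real \<Rightarrow> real"
  proof -
    have "AE t in lebesgue_on {0<..}. u t \<in> H1" using that by (simp add: L2_time_def strongly_measurable_def)
    then show ?thesis by (subst (asm) AE_restrict_space_iff) auto
  qed
  have "f \<in> L2_time H1 H1_norm" "g \<in> L2_time H1 H1_norm"
    using weak unfolding weak_solution_def by blast+
  from this[THEN *] show ?thesis
    by eventually_elim (auto simp: W1_def intro: has_weak_deriv_wderiv)
qed

section \<open>Energy, dissipation and cube integral on balls\<close>

definition "D t = dissipation R Rmu (f t) (g t) (wderiv (f t)) (wderiv (g t))"
definition "En t A = nnint A (\<lambda>x. (f t x + g t x)\<^sup>2)"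
definition "Dn T A = (\<integral>\<^sup>+t\<in>{0..T}. (nnint A (D t)) \<partial>lebesgue)"
definition "Y T A = (\<integral>\<^sup>+t\<in>{0..T}. (nnint A (\<lambda>x. (f t x + g t x) ^ 3)) \<partial>lebesgue)"
definition "c_flux = (1 + R)\<^sup>2 + R * Rmu"
text \<open>Collects the factor 4 of the local energy estimate, the bound
  \<open>c_flux * u^3\<close> of its flux density, the squared slope of the cutoff, and
  \<open>1 + 1 / R\<close> to serve both \<open>Dn\<close> and \<open>En\<close>, the latter being
  controlled through \<open>R * u^2\<close>.\<close>

definition "c_step = 4 * c_flux * step_slope\<^sup>2 * (1 + 1 / R)"

lemma c_pos: "c_flux > 0" "c_step > 0"
proof -
  show "c_flux > 0" using R Rmu by (auto simp: c_flux_def intro!: add_pos_pos)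
  then show "c_step > 0" using R step_slope(1) by (simp add: c_step_def add_pos_pos)
qed

lemma En_mono: "A \<subseteq> B \<Longrightarrow> En t A \<le> En t B"
  unfolding En_def by (intro nn_integral_mono) (auto split: split_indicator)

lemma Y_mono: "t \<le> T \<Longrightarrow> Y t A \<le> Y T A"
  unfolding Y_def by (intro nn_integral_mono) (auto split: split_indicator)

lemma estimate_bound:
  assumes est: "local_energy_estimate R Rmu f g t \<zeta>" and one: "\<And>x. x \<in> A \<Longrightarrow> \<zeta> x = 1"
    and rhs: "(\<integral>\<^sup>+x. ennreal (((f 0 x)\<^sup>2 + R * (f 0 x + g 0 x)\<^sup>2) * (\<zeta> x)\<^sup>2) \<partial>lebesgue)
       + 4 * (\<integral>\<^sup>+t\<in>{0..t}. (\<integral>\<^sup>+x. ennreal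
          ((f t x * ((1 + R) * f t x + R * g t x)\<^sup>2
            + R * Rmu * g t x * (f t x + g t x)\<^sup>2) * \<bar>wderiv \<zeta> x\<bar>\<^sup>2)
          \<partial>lebesgue) \<partial>lebesgue) \<le> r"
  shows "En t A \<le> ennreal (1 / R) * r" "Dn t A \<le> r"
proof -
  let ?A = "\<integral>\<^sup>+x. ennreal (((f t x)\<^sup>2 + R * (f t x + g t x)\<^sup>2) * (\<zeta> x)\<^sup>2) \<partial>lebesgue"
  let ?B = "\<integral>\<^sup>+t\<in>{0..t}. (\<integral>\<^sup>+x. ennreal
          ((f t x * \<bar>(1 + R) * wderiv (f t) x + R * wderiv (g t) x\<bar>\<^sup>2
            + R * Rmu * g t x * \<bar>wderiv (f t) x + wderiv (g t) x\<bar>\<^sup>2) * (\<zeta> x)\<^sup>2)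
          \<partial>lebesgue) \<partial>lebesgue"
  have AB: "?A + ?B \<le> r" using order_trans[OF est[unfolded local_energy_estimate_def] rhs] .
  have A: "?A \<le> r" by (rule order_trans[OF add_increasing2[OF zero_le order_refl] AB])
  have B: "?B \<le> r" by (rule order_trans[OF add_increasing[OF zero_le order_refl] AB])
  have "En t A \<le> (\<integral>\<^sup>+x. ennreal (1 / R) * ennreal (((f t x)\<^sup>2 + R * (f t x + g t x)\<^sup>2) * (\<zeta> x)\<^sup>2) \<partial>lebesgue)"
    unfolding En_def
  proof (rule nn_integral_mono)
    fix x
    show "ennreal ((f t x + g t x)\<^sup>2) * indicator A x \<le> ennreal (1 / R) * ennreal (((f t x)\<^sup>2 + R * (f t x + g t x)\<^sup>2) * (\<zeta> x)\<^sup>2)"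
    proof (cases "x \<in> A")
      case True
      have "(f t x + g t x)\<^sup>2 \<le> 1 / R * ((f t x)\<^sup>2 + R * (f t x + g t x)\<^sup>2)" using R by (simp add: field_simps)
      then have "ennreal ((f t x + g t x)\<^sup>2) \<le> ennreal (1 / R * ((f t x)\<^sup>2 + R * (f t x + g t x)\<^sup>2))"
        by (rule ennreal_leI)
      also have "\<dots> = ennreal (1 / R) * ennreal ((f t x)\<^sup>2 + R * (f t x + g t x)\<^sup>2)"
        using R by (intro ennreal_mult') simp
      finally show ?thesis using True one[OF True] by simp
    qed simp
  qed
  also have "\<dots> \<le> ennreal (1 / R) * ?A" using R by (intro nn_integral_cmult_le) simp
  also have "\<dots> \<le> ennreal (1 / R) * r" by (intro mult_left_mono A) simp
  finally show "En t A \<le> ennreal (1 / R) * r" .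
  have "Dn t A \<le> ?B" unfolding Dn_def
    by (intro nn_integral_mono mult_right_mono) (auto split: split_indicator simp: D_def dissipation_def one)
  then show "Dn t A \<le> r" using B by (rule order_trans)
qed

text \<open>A Caccioppoli inequality: the cutoff between the two balls removes the initial term, as
  the data vanish on the larger one, and the flux term costs the squared slope of the
  cutoff.\<close>

lemma energy_step:
  assumes rho: "0 < rho'" "rho' < rho" and t: "0 < t" "t \<le> T"
    and 0: "AE x in lebesgue. x \<in> {a - rho<..<a + rho} \<longrightarrow> f0 x + g0 x = 0"
  shows "En t {a - rho'..a + rho'} \<le> ennreal (c_step / (rho - rho')\<^sup>2) * Y T {a - rho..a + rho}"
    "Dn t {a - rho'..a + rho'} \<le> ennreal (c_step / (rho - rho')\<^sup>2) * Y T {a - rho..a + rho}"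
proof -
  define c where "c = c_flux * step_slope\<^sup>2 / (rho - rho')\<^sup>2"
  have c: "c > 0" using c_pos rho step_slope(1) by (simp add: c_def)
  let ?z = "cutoff a rho' rho"
  let ?C = "\<integral>\<^sup>+x. ennreal (((f 0 x)\<^sup>2 + R * (f 0 x + g 0 x)\<^sup>2) * (?z x)\<^sup>2) \<partial>lebesgue"
  let ?F = "\<integral>\<^sup>+t\<in>{0..t}. (\<integral>\<^sup>+x. ennreal
          ((f t x * ((1 + R) * f t x + R * g t x)\<^sup>2
            + R * Rmu * g t x * (f t x + g t x)\<^sup>2) * \<bar>wderiv ?z x\<bar>\<^sup>2)
          \<partial>lebesgue) \<partial>lebesgue"
  \<comment> \<open>Both data are nonnegative, so each of them vanishes where their sum does;
    elsewhere the cutoff is 0.\<close>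
  have "?C \<le> (\<integral>\<^sup>+(x::real). 0 \<partial>lebesgue)"
  proof (rule nn_integral_mono_AE)
    show "AE x in lebesgue. ennreal (((f 0 x)\<^sup>2 + R * (f 0 x + g 0 x)\<^sup>2) * (?z x)\<^sup>2) \<le> 0"
      using 0 initial \<K>_D(4)[OF f0] \<K>_D(4)[OF g0]
    proof eventually_elim
      case (elim x)
      then show ?case using cutoff_bounds(4)[OF rho, of x a] by (cases "x \<in> {a - rho<..<a + rho}") auto
    qed
  qed
  then have C: "?C = 0" by simp
  let ?k = "\<lambda>s x. (f s x * ((1 + R) * f s x + R * g s x)\<^sup>2 + R * Rmu * g s x * (f s x + g s x)\<^sup>2) * \<bar>wderiv ?z x\<bar>\<^sup>2"
  have inner: "(\<integral>\<^sup>+x. ennreal (?k s x) \<partial>lebesgue)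
      \<le> ennreal c * (nnint {a - rho..a + rho} (\<lambda>x. (f s x + g s x) ^ 3))" if "s \<ge> 0" for s
  proof -
    have "(\<integral>\<^sup>+x. ennreal (?k s x) \<partial>lebesgue)
       \<le> (\<integral>\<^sup>+x. ennreal c * (ennreal ((f s x + g s x) ^ 3) * indicator {a - rho..a + rho} x) \<partial>lebesgue)"
    proof (rule nn_integral_mono_AE)
      show "AE x in lebesgue. ennreal (?k s x)
         \<le> ennreal c * (ennreal ((f s x + g s x) ^ 3) * indicator {a - rho..a + rho} x)"
        using cutoff_W1(2)[OF rho, of a] \<K>_D(4)[OF in_\<K>(1)[OF that]] \<K>_D(4)[OF in_\<K>(2)[OF that]]
      proof eventually_elim
        case (elim x)
        let ?u = "f s x + g s x" and ?i = "indicator {a-rho..a+rho} x :: real"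
        have "(1 + R) * f s x + R * g s x \<le> (1 + R) * ?u" using elim by (simp add: algebra_simps)
        then have "((1 + R) * f s x + R * g s x)\<^sup>2 \<le> ((1 + R) * ?u)\<^sup>2" using elim R by (intro power_mono) auto
        then have 1: "f s x * ((1 + R) * f s x + R * g s x)\<^sup>2 \<le> ?u * ((1 + R) * ?u)\<^sup>2"
          using elim by (intro mult_mono) auto
        have 2: "R * Rmu * g s x * ?u\<^sup>2 \<le> R * Rmu * ?u * ?u\<^sup>2"
          using elim R Rmu by (intro mult_right_mono mult_left_mono) auto
        have "f s x * ((1 + R) * f s x + R * g s x)\<^sup>2 + R * Rmu * g s x * ?u\<^sup>2 \<le> ?u * ((1 + R) * ?u)\<^sup>2 + R * Rmu * ?u * ?u\<^sup>2"
          using 1 2 by linarith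
        also have "\<dots> = c_flux * ?u ^ 3"
          by (simp add: c_flux_def power2_eq_square power3_eq_cube algebra_simps)
        finally have a: "f s x * ((1 + R) * f s x + R * g s x)\<^sup>2 + R * Rmu * g s x * ?u\<^sup>2 \<le> c_flux * ?u ^ 3" .
        have "\<bar>wderiv ?z x\<bar>\<^sup>2 \<le> (step_slope / (rho - rho') * ?i)\<^sup>2"
          using cutoff_bounds(5)[OF rho, of a x] elim(1) by (intro power_mono) auto
        also have "\<dots> = step_slope\<^sup>2 / (rho - rho')\<^sup>2 * ?i" by (simp add: power_mult_distrib power_divide indicator_def)
        finally have b: "\<bar>wderiv ?z x\<bar>\<^sup>2 \<le> step_slope\<^sup>2 / (rho - rho')\<^sup>2 * ?i" .
        have "?k s x
          \<le> (c_flux * ?u ^ 3) * (step_slope\<^sup>2 / (rho - rho')\<^sup>2 * ?i)"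
          using a b elim c_pos by (intro mult_mono) auto
        also have "\<dots> = c * (?u ^ 3 * ?i)" by (simp add: c_def)
        finally have "ennreal (?k s x)
           \<le> ennreal (c * (?u ^ 3 * ?i))" by (rule ennreal_leI)
        also have "\<dots> = ennreal c * (ennreal (?u ^ 3) * indicator {a - rho..a + rho} x)"
          using c by (cases "x \<in> {a-rho..a+rho}") (auto simp: ennreal_mult')
        finally show ?case .
      qed
    qed
    also have "\<dots> \<le> ennreal c * (nnint {a - rho..a + rho} (\<lambda>x. (f s x + g s x) ^ 3))"
      by (rule nn_integral_cmult_le[OF c])
    finally show ?thesis .
  qed
  have "?F \<le> (\<integral>\<^sup>+s. ennreal c * ((nnint {a - rho..a + rho} (\<lambda>x. (f s x + g s x) ^ 3)) * indicator {0..t} s) \<partial>lebesgue)"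
    using inner by (intro nn_integral_mono) (auto split: split_indicator)
  also have "\<dots> \<le> ennreal c * Y t {a - rho..a + rho}"
    unfolding Y_def by (rule nn_integral_cmult_le[OF c])
  also have "\<dots> \<le> ennreal c * Y T {a - rho..a + rho}" by (intro mult_left_mono Y_mono t) simp
  finally have F: "4 * ?F \<le> 4 * (ennreal c * Y T {a - rho..a + rho})" by (intro mult_left_mono) auto
  have c4: "4 * (ennreal c * y) = ennreal (4 * c) * y" for y :: ennreal
    using c by (simp add: ennreal_mult' mult.assoc)
  have le: "?C + 4 * ?F \<le> ennreal (4 * c) * Y T {a - rho..a + rho}" using F by (simp only: C c4 add_0)
  note est = estimate_bound[where A="{a - rho'..a + rho'}", OF estimate(1)[OF t(1) cutoff_W1(1)[OF rho, of a]] cutoff_bounds(3)[OF rho] le]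
  have k: "c_step / (rho - rho')\<^sup>2 = 4 * c * (1 + 1 / R)" by (simp add: c_step_def c_def)
  have "1 / R * (4 * c) \<le> c_step / (rho - rho')\<^sup>2" "4 * c \<le> c_step / (rho - rho')\<^sup>2"
    unfolding k using c R by (auto simp: algebra_simps)
  then have k': "ennreal (1 / R) * ennreal (4 * c) \<le> ennreal (c_step / (rho - rho')\<^sup>2)" "ennreal (4 * c) \<le> ennreal (c_step / (rho - rho')\<^sup>2)"
    using R c by (auto simp: ennreal_mult''[symmetric] intro!: ennreal_leI)
  have "En t {a - rho'..a + rho'} \<le> (ennreal (1 / R) * ennreal (4 * c)) * Y T {a - rho..a + rho}"
    using est(1) by (simp add: mult.assoc)
  also have "\<dots> \<le> ennreal (c_step / (rho - rho')\<^sup>2) * Y T {a - rho..a + rho}" by (intro mult_right_mono k') simp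
  finally show "En t {a - rho'..a + rho'} \<le> ennreal (c_step / (rho - rho')\<^sup>2) * Y T {a - rho..a + rho}" .
  have "Dn t {a - rho'..a + rho'} \<le> ennreal (4 * c) * Y T {a - rho..a + rho}" using est(2) .
  also have "\<dots> \<le> ennreal (c_step / (rho - rho')\<^sup>2) * Y T {a - rho..a + rho}" by (intro mult_right_mono k') simp
  finally show "Dn t {a - rho'..a + rho'} \<le> ennreal (c_step / (rho - rho')\<^sup>2) * Y T {a - rho..a + rho}" .
qed

lemma energy_nonneg: "energy R f0 g0 \<ge> 0"
  unfolding energy_def using R by (intro mult_nonneg_nonneg integral_nonneg) auto

text \<open>The cutoff 1 has derivative 0, so the flux term disappears; the factor 2 undoes the 1/2
  in \<open>energy\<close>.\<close>

lemma global_energy: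
  assumes t: "0 < t"
  shows "En t A \<le> ennreal (2 * energy R f0 g0 / R)" "Dn t A \<le> ennreal (2 * energy R f0 g0)"
proof -
  let ?F = "\<integral>\<^sup>+t\<in>{0..t}. (\<integral>\<^sup>+x. ennreal
          ((f t x * ((1 + R) * f t x + R * g t x)\<^sup>2
            + R * Rmu * g t x * (f t x + g t x)\<^sup>2) * \<bar>wderiv (\<lambda>x. 1) x\<bar>\<^sup>2)
          \<partial>lebesgue) \<partial>lebesgue"
  let ?C = "\<integral>\<^sup>+x. ennreal (((f 0 x)\<^sup>2 + R * (f 0 x + g 0 x)\<^sup>2) * ((\<lambda>x. 1) x)\<^sup>2) \<partial>lebesgue"
  have "AE x in lebesgue. \<bar>wderiv (\<lambda>x. 1) x\<bar>\<^sup>2 = 0" using wderiv_const[of 1] by eventually_elim simp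
  then have F: "?F = 0" by (simp add: nn_integral_zero_weight)
  have i: "integrable lebesgue (\<lambda>x. (f0 x)\<^sup>2 + R * (f0 x + g0 x)\<^sup>2)"
  proof (rule Bochner_Integration.integrable_bound)
    show "integrable lebesgue (\<lambda>x. (1 + 2 * R) * (f0 x)\<^sup>2 + 2 * R * (g0 x)\<^sup>2)"
      using \<K>_D(3)[OF f0] \<K>_D(3)[OF g0] by simp
    show "(\<lambda>x. (f0 x)\<^sup>2 + R * (f0 x + g0 x)\<^sup>2) \<in> borel_measurable lebesgue"
      using \<K>_D(1)[OF f0] \<K>_D(1)[OF g0] by measurable
    have "(f0 x)\<^sup>2 + R * (f0 x + g0 x)\<^sup>2 \<le> (1 + 2 * R) * (f0 x)\<^sup>2 + 2 * R * (g0 x)\<^sup>2" for x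
    proof -
      have "(f0 x + g0 x)\<^sup>2 \<le> 2 * (f0 x)\<^sup>2 + 2 * (g0 x)\<^sup>2"
        using sum_squares_bound[of "f0 x" "g0 x"] by (simp add: power2_sum)
      then have "R * (f0 x + g0 x)\<^sup>2 \<le> R * (2 * (f0 x)\<^sup>2 + 2 * (g0 x)\<^sup>2)" using R by (intro mult_left_mono) auto
      then show ?thesis by (simp add: algebra_simps)
    qed
    then show "AE x in lebesgue. norm ((f0 x)\<^sup>2 + R * (f0 x + g0 x)\<^sup>2) \<le> norm ((1 + 2 * R) * (f0 x)\<^sup>2 + 2 * R * (g0 x)\<^sup>2)"
      using R by (intro AE_I2) (simp add: abs_of_nonneg)
  qed
  have "?C = (\<integral>\<^sup>+x. ennreal ((f0 x)\<^sup>2 + R * (f0 x + g0 x)\<^sup>2) \<partial>lebesgue)"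
    by (intro nn_integral_cong_AE) (use initial in eventually_elim, simp)
  also have "\<dots> = ennreal (2 * energy R f0 g0)"
    using R by (subst nn_integral_eq_integral[OF i]) (auto simp: energy_def)
  finally have C: "?C = ennreal (2 * energy R f0 g0)" .
  have le: "?C + 4 * ?F \<le> ennreal (2 * energy R f0 g0)" by (simp only: C F mult_zero_right add_0_right order_refl)
  note est = estimate_bound[OF estimate(2)[OF t] refl le]
  have "En t A \<le> ennreal (1 / R) * ennreal (2 * energy R f0 g0)" by (rule est)
  also have "\<dots> = ennreal (2 * energy R f0 g0 / R)" using R energy_nonneg by (subst ennreal_mult[symmetric]) auto
  finally show "En t A \<le> ennreal (2 * energy R f0 g0 / R)" .
  show "Dn t A \<le> ennreal (2 * energy R f0 g0)" by (rule est)
qed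

lemma Y_le:
  assumes "T \<ge> 0" "c > 0" "b \<ge> 0"
    and le: "\<And>t. 0 < t \<Longrightarrow> t \<le> T \<Longrightarrow> has_weak_deriv (f t) (wderiv (f t)) \<Longrightarrow> has_weak_deriv (g t) (wderiv (g t)) \<Longrightarrow>
      (nnint A (\<lambda>x. (f t x + g t x) ^ 3)) \<le> ennreal c * (nnint A (D t)) + ennreal b"
  shows "Y T A \<le> ennreal c * Dn T A + ennreal (b * T)"
proof -
  have "Y T A \<le> (\<integral>\<^sup>+t\<in>{0..T}. (ennreal c * (nnint A (D t)) + ennreal b) \<partial>lebesgue)"
    unfolding Y_def
  proof (intro nn_integral_mono_AE, use AE_weak_deriv AE_lebesgue_neq[of 0] in eventually_elim)
    case (elim t)
    then show ?case using le[of t] by (cases "t \<in> {0..T}") auto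
  qed
  also have "\<dots> \<le> ennreal c * Dn T A + ennreal (b * T)"
    unfolding Dn_def by (rule nn_integral_affine_le) (use assms in auto)
  finally show ?thesis .
qed

text \<open>For small \<open>Lam\<close>, a fixed interval and fixed \<open>T\<close>, the choice of
  \<open>eta\<close> as \<open>Lam\<close> to the power 1/3 makes the bound of order
  \<open>Lam\<close> to the power 4/3. This superlinearity drives the iteration in
  \<open>extinction\<close>.\<close>

lemma Y_energy_bound:
  assumes "T \<ge> 0" "lo < hi" "eta > 0" "Lam > 0"
    and En: "\<And>t. 0 < t \<Longrightarrow> t \<le> T \<Longrightarrow> En t {lo..hi} \<le> ennreal Lam" and Dn: "Dn T {lo..hi} \<le> ennreal Lam"
  shows "Y T {lo..hi} \<le> ennreal (2 * sup_const R Rmu * Lam * (T * eta + T * Lam / ((hi - lo) * eta) + (hi - lo) * Lam / eta\<^sup>2))"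
proof -
  define S where "S = sup_const R Rmu"
  have S: "S \<ge> 1" using sup_const_ge[OF R Rmu] by (simp add: S_def)
  define c b where "c = 2 * S * Lam * (hi - lo) / eta\<^sup>2" and "b = 2 * S * Lam * (eta + Lam / ((hi - lo) * eta))"
  have cb: "c > 0" "b \<ge> 0" using assms S by (auto simp: c_def b_def)
  have "Y T {lo..hi} \<le> ennreal c * Dn T {lo..hi} + ennreal (b * T)"
  proof (rule Y_le[OF assms(1) cb])
    fix t assume t: "0 < t" "t \<le> T" and w: "has_weak_deriv (f t) (wderiv (f t))" "has_weak_deriv (g t) (wderiv (g t))"
    show "nnint {lo..hi} (\<lambda>x. (f t x + g t x) ^ 3) \<le> ennreal c * (nnint {lo..hi} (D t)) + ennreal b"
      unfolding c_def b_def S_def D_def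
      by (rule cube_energy_bound[OF R Rmu in_\<K>[OF less_imp_le[OF t(1)]] w assms(2-4) En[OF t, unfolded En_def]])
  qed
  also have "\<dots> \<le> ennreal c * ennreal Lam + ennreal (b * T)" by (intro add_right_mono mult_left_mono Dn) simp
  also have "\<dots> = ennreal (c * Lam + b * T)" using cb assms by (simp add: ennreal_mult ennreal_plus)
  also have "c * Lam + b * T = 2 * S * Lam * (T * eta + T * Lam / ((hi - lo) * eta) + (hi - lo) * Lam / eta\<^sup>2)"
    by (simp add: c_def b_def algebra_simps)
  finally show ?thesis by (simp add: S_def)
qed

text \<open>A large \<open>s\<close> makes the coefficient of the dissipation small at the price of
  the term \<open>s * M^2\<close>, and no power of the energy enters.\<close>

lemma Y_mass_bound:
  assumes "T \<ge> 0" "lo < hi" "s > 0" "M > 0"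
    and mass: "\<And>t. 0 < t \<Longrightarrow> t \<le> T \<Longrightarrow> (nnint {lo..hi} (\<lambda>x. f t x + g t x)) \<le> ennreal M"
  shows "Y T {lo..hi} \<le> ennreal (sup_const R Rmu * M / s) * Dn T {lo..hi}
     + ennreal (sup_const R Rmu * (M^3 / (hi - lo)\<^sup>2 + s * M\<^sup>2) * T)"
proof (rule Y_le)
  have S: "sup_const R Rmu \<ge> 1" by (rule sup_const_ge[OF R Rmu])
  then show "sup_const R Rmu * M / s > 0" "sup_const R Rmu * (M^3 / (hi - lo)\<^sup>2 + s * M\<^sup>2) \<ge> 0" using assms by auto
  fix t assume t: "0 < t" "t \<le> T" and w: "has_weak_deriv (f t) (wderiv (f t))" "has_weak_deriv (g t) (wderiv (g t))"
  show "nnint {lo..hi} (\<lambda>x. (f t x + g t x) ^ 3)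
    \<le> ennreal (sup_const R Rmu * M / s) * (nnint {lo..hi} (D t))
     + ennreal (sup_const R Rmu * (M^3 / (hi - lo)\<^sup>2 + s * M\<^sup>2))"
    unfolding D_def by (rule cube_mass_bound[OF R Rmu in_\<K>[OF less_imp_le[OF t(1)]] w assms(2-4) mass[OF t]])
qed (rule assms)

end

section \<open>Mass\<close>

context solution
begin

text \<open>The parameter \<open>dlt\<close> distributes the undissipated part of the flux between
  the length of the support of \<open>phi\<close> and the energy; it is balanced against that length
  in \<open>component_mass\<close>.\<close>

lemma flux_bound:
  assumes h: "h = f t \<or> h = g t" and t: "t > 0" and B: "\<And>x. \<bar>phi x\<bar> \<le> B" "B > 0" and supp: "\<And>x. x \<notin> {-N..N} \<Longrightarrow> phi x = 0"
    and k: "k > 0" "\<And>x. 0 \<le> f t x \<Longrightarrow> 0 \<le> g t x \<Longrightarrow> h x * (v x)\<^sup>2 \<le> k * D t x" and dlt: "dlt > 0" and N: "N \<ge> 0"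
  shows "ennreal \<bar>LINT x|lebesgue. h x * v x * phi x\<bar>
     \<le> ennreal (B * k) * nnint UNIV (D t) + ennreal (B * (2 * N * dlt + 2 * energy R f0 g0 / (R * dlt)))"
proof -
  note F = \<K>_D[OF in_\<K>(1)] and G = \<K>_D[OF in_\<K>(2)]
  let ?u = "\<lambda>x. ennreal (B / dlt) * (ennreal ((f t x + g t x)\<^sup>2) * indicator UNIV x)"
  let ?i = "\<lambda>x. ennreal (B * dlt) * indicator {-N..N} x"
  \<comment> \<open>If the integrand is not integrable, its integral is 0 by convention and the
    inequality is trivial.\<close>
  have "ennreal \<bar>LINT x|lebesgue. h x * v x * phi x\<bar> \<le> (\<integral>\<^sup>+x. ennreal \<bar>h x * v x * phi x\<bar> \<partial>lebesgue)"
    using integral_norm_bound_ennreal[of lebesgue "\<lambda>x. h x * v x * phi x"]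
    by (cases "integrable lebesgue (\<lambda>x. h x * v x * phi x)") (auto simp: not_integrable_integral_eq)
  also have "\<dots> \<le> (\<integral>\<^sup>+x. (ennreal (B * k) * (ennreal (D t x) * indicator UNIV x) + ?u x) + ?i x \<partial>lebesgue)"
  proof (rule nn_integral_mono_AE)
    show "AE x in lebesgue. ennreal \<bar>h x * v x * phi x\<bar> \<le> (ennreal (B * k) * (ennreal (D t x) * indicator UNIV x) + ?u x) + ?i x"
      using F(4)[OF less_imp_le[OF t]] G(4)[OF less_imp_le[OF t]]
    proof eventually_elim
      case (elim x)
      show ?case
      proof (cases "x \<in> {-N..N}")
        case True
        have h0: "0 \<le> h x" "h x \<le> f t x + g t x" using h elim by auto
        have D0: "0 \<le> D t x" using elim R Rmu by (simp add: D_def dissipation_def)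
        have "0 \<le> (h x - dlt)\<^sup>2 + h x * dlt" using h0 dlt by simp
        then have "h x * dlt \<le> dlt * dlt + (h x)\<^sup>2" by (simp add: power2_eq_square algebra_simps)
        also have "(h x)\<^sup>2 \<le> (f t x + g t x)\<^sup>2" using h0 by (intro power_mono)
        finally have 1: "h x \<le> dlt + (f t x + g t x)\<^sup>2 / dlt" using dlt by (simp add: field_simps)
        have "0 \<le> (\<bar>v x\<bar> - 1)\<^sup>2 + \<bar>v x\<bar>" by simp
        then have "\<bar>v x\<bar> \<le> 1 + (v x)\<^sup>2" by (simp add: power2_eq_square algebra_simps)
        then have "h x * \<bar>v x\<bar> \<le> h x * (1 + (v x)\<^sup>2)" using h0 by (intro mult_left_mono)
        also have "\<dots> \<le> k * D t x + (f t x + g t x)\<^sup>2 / dlt + dlt" using 1 k(2)[of x] elim by (simp add: algebra_simps)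
        finally have "h x * \<bar>v x\<bar> * \<bar>phi x\<bar> \<le> (k * D t x + (f t x + g t x)\<^sup>2 / dlt + dlt) * B"
          using B h0 D0 k dlt by (intro mult_mono) auto
        then have "\<bar>h x * v x * phi x\<bar> \<le> (B * k) * D t x + B / dlt * (f t x + g t x)\<^sup>2 + B * dlt"
          using h0 by (simp add: abs_mult algebra_simps)
        then have "ennreal \<bar>h x * v x * phi x\<bar> \<le> ennreal ((B * k) * D t x + B / dlt * (f t x + g t x)\<^sup>2 + B * dlt)" by (rule ennreal_leI)
        also have "\<dots> = ennreal (B * k) * ennreal (D t x) + ennreal (B / dlt) * ennreal ((f t x + g t x)\<^sup>2) + ennreal (B * dlt)"
          using B(2) dlt k D0 by (simp add: ennreal_mult[symmetric])
        finally show ?thesis using True by simp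
      qed (simp add: supp)
    qed
  qed
  also have "\<dots> \<le> (\<integral>\<^sup>+x. ennreal (B * k) * (ennreal (D t x) * indicator UNIV x) + ?u x \<partial>lebesgue) + (\<integral>\<^sup>+x. ?i x \<partial>lebesgue)"
    by (intro nn_integral_add_le borel_measurable_times_ennreal borel_measurable_indicator) (auto split: split_indicator)
  \<comment> \<open>At an exceptional time the weak derivatives are unspecified functions and
    \<open>D t\<close> need not be measurable in \<open>x\<close> either; the measurable summand is
    the one with the squared sum.\<close>
  also have "\<dots> \<le> (\<integral>\<^sup>+x. ennreal (B * k) * (ennreal (D t x) * indicator UNIV x) \<partial>lebesgue) + (\<integral>\<^sup>+x. ?u x \<partial>lebesgue) + (\<integral>\<^sup>+x. ?i x \<partial>lebesgue)"
    using F(1) G(1) t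
    by (intro add_right_mono nn_integral_add_le borel_measurable_times_ennreal measurable_compose[OF _ measurable_ennreal] borel_measurable_power borel_measurable_add)
      (auto simp: ennreal_mult_less_top)
  also have "\<dots> \<le> ennreal (B * k) * nnint UNIV (D t) + ennreal (B / dlt) * ennreal (2 * energy R f0 g0 / R) + ennreal (B * dlt * (2 * N))"
  proof (intro add_mono)
    show "(\<integral>\<^sup>+x. ennreal (B * k) * (ennreal (D t x) * indicator UNIV x) \<partial>lebesgue) \<le> ennreal (B * k) * nnint UNIV (D t)"
      using B(2) k by (intro nn_integral_cmult_le) simp
    have "(\<integral>\<^sup>+x. ?u x \<partial>lebesgue) \<le> ennreal (B / dlt) * En t UNIV"
      unfolding En_def using B(2) dlt by (intro nn_integral_cmult_le) simp
    also have "\<dots> \<le> ennreal (B / dlt) * ennreal (2 * energy R f0 g0 / R)" by (intro mult_left_mono global_energy t) simp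
    finally show "(\<integral>\<^sup>+x. ?u x \<partial>lebesgue) \<le> ennreal (B / dlt) * ennreal (2 * energy R f0 g0 / R)" .
    show "(\<integral>\<^sup>+x. ?i x \<partial>lebesgue) \<le> ennreal (B * dlt * (2 * N))"
      using N B(2) dlt by (subst nn_integral_cmult_indicator) (auto simp: ennreal_mult[symmetric])
  qed
  also have "\<dots> = ennreal (B * k) * nnint UNIV (D t) + ennreal (B / dlt * (2 * energy R f0 g0 / R) + B * dlt * (2 * N))"
  proof -
    have nn: "0 \<le> B / dlt" "0 \<le> 2 * energy R f0 g0 / R" "0 \<le> B * dlt * (2 * N)" using B(2) dlt R N energy_nonneg by auto
    show ?thesis
      by (simp only: add.assoc ennreal_mult[OF nn(1,2), symmetric] ennreal_plus[OF mult_nonneg_nonneg[OF nn(1,2)] nn(3), symmetric])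
  qed
  also have "B / dlt * (2 * energy R f0 g0 / R) + B * dlt * (2 * N) = B * (2 * N * dlt + 2 * energy R f0 g0 / (R * dlt))"
    by (simp add: algebra_simps)
  finally show ?thesis .
qed

lemma flux_time_bound:
  assumes h: "\<And>t. h t = f t \<or> h t = g t" and t: "t \<ge> 0" and B: "\<And>x. \<bar>phi x\<bar> \<le> B" "B > 0" and supp: "\<And>x. x \<notin> {-N..N} \<Longrightarrow> phi x = 0"
    and k: "k > 0" "\<And>t x. 0 \<le> f t x \<Longrightarrow> 0 \<le> g t x \<Longrightarrow> h t x * (v t x)\<^sup>2 \<le> k * D t x" and dlt: "dlt > 0" and N: "N \<ge> 0"
  shows "\<bar>LINT tau:{0..t}|lebesgue. LINT x|lebesgue. h tau x * v tau x * phi x\<bar>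
     \<le> B * (k * (2 * energy R f0 g0) + (2 * N * dlt + 2 * energy R f0 g0 / (R * dlt)) * t)"
proof (cases "t = 0")
  case True
  have "(LINT tau:{0..t}|lebesgue. LINT x|lebesgue. h tau x * v tau x * phi x) = 0"
    unfolding set_lebesgue_integral_def True
  proof (intro integral_eq_zero_AE, use AE_lebesgue_neq[of 0] in eventually_elim)
    case (elim tau)
    then show ?case by (simp add: indicator_def)
  qed
  then show ?thesis using B(2) k(1) energy_nonneg True by simp
next
  case False
  then have t: "t > 0" using t by simp
  define I where "I tau = (LINT x|lebesgue. h tau x * v tau x * phi x)" for tau
  define b where "b = B * (2 * N * dlt + 2 * energy R f0 g0 / (R * dlt))"
  have b: "b \<ge> 0" using B(2) dlt N R energy_nonneg by (simp add: b_def)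
  have "ennreal \<bar>LINT tau:{0..t}|lebesgue. I tau\<bar> \<le> (\<integral>\<^sup>+tau. ennreal \<bar>indicator {0..t} tau * I tau\<bar> \<partial>lebesgue)"
    using integral_norm_bound_ennreal[of lebesgue "\<lambda>tau. indicator {0..t} tau * I tau"]
    by (cases "integrable lebesgue (\<lambda>tau. indicator {0..t} tau * I tau)") (auto simp: not_integrable_integral_eq set_lebesgue_integral_def)
  also have "\<dots> \<le> (\<integral>\<^sup>+tau\<in>{0..t}. (ennreal (B * k) * nnint UNIV (D tau) + ennreal b) \<partial>lebesgue)"
  proof (rule nn_integral_mono_AE)
    show "AE tau in lebesgue. ennreal \<bar>indicator {0..t} tau * I tau\<bar> \<le> (ennreal (B * k) * nnint UNIV (D tau) + ennreal b) * indicator {0..t} tau"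
      using AE_lebesgue_neq[of 0]
    proof eventually_elim
      case (elim tau)
      show ?case
      proof (cases "tau \<in> {0..t}")
        case True
        then have "tau > 0" using elim by auto
        from flux_bound[OF h this B supp k dlt N] True show ?thesis by (simp add: I_def b_def)
      qed simp
    qed
  qed
  also have "\<dots> \<le> ennreal (B * k) * Dn t UNIV + ennreal (b * t)"
    unfolding Dn_def using B(2) k b t by (intro nn_integral_affine_le) auto
  also have "\<dots> \<le> ennreal (B * k) * ennreal (2 * energy R f0 g0) + ennreal (b * t)"
    by (intro add_right_mono mult_left_mono global_energy t) simp
  also have "\<dots> = ennreal (B * k * (2 * energy R f0 g0) + b * t)"
    using B(2) k b t energy_nonneg by (simp add: ennreal_mult[symmetric])
  finally have "\<bar>LINT tau:{0..t}|lebesgue. I tau\<bar> \<le> B * k * (2 * energy R f0 g0) + b * t"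
    using B(2) k b t energy_nonneg by (subst (asm) ennreal_le_iff) auto
  also have "\<dots> = B * (k * (2 * energy R f0 g0) + (2 * N * dlt + 2 * energy R f0 g0 / (R * dlt)) * t)"
    by (simp add: b_def algebra_simps)
  finally show ?thesis by (simp add: I_def)
qed

text \<open>The flux is bounded by h + h v^2, where the second term is dissipated; on the support of the
  derivative of a cutoff at scale n = m^2 the first one is of order m by h \<le> 1/m + m h^2.\<close>

lemma component_mass:
  assumes h: "\<And>t. h t = f t \<or> h t = g t" and k: "k > 0" and t: "t \<ge> 0" and K: "h t \<in> \<K>" "h0 \<in> \<K>"
    and eq: "\<And>xi. xi \<in> test_functions \<Longrightarrow> (LINT x|lebesgue. h t x * xi x) - (LINT x|lebesgue. h0 x * xi x)
        + c * (LINT tau:{0..t}|lebesgue. LINT x|lebesgue. h tau x * v tau x * deriv xi x) = 0"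
    and kD: "\<And>t x. 0 \<le> f t x \<Longrightarrow> 0 \<le> g t x \<Longrightarrow> h t x * (v t x)\<^sup>2 \<le> k * D t x"
  shows "nnint {l..r} (h t) \<le> ennreal (LINT x|lebesgue. h0 x)"
proof -
  note ht = \<K>_D[OF K(1)] and h0 = \<K>_D[OF K(2)]
  define C where "C = \<bar>c\<bar> * (step_slope * (k * (2 * energy R f0 g0) + (4 + 2 * energy R f0 g0 / R) * t))"
  have main: "nnint {l..r} (h t) \<le> ennreal ((LINT x|lebesgue. h0 x) + C / m)"
    if m: "m \<ge> 1" "\<bar>l\<bar> \<le> m" "\<bar>r\<bar> \<le> m" for m
  proof -
    define n where "n = m\<^sup>2"
    have "m \<le> n" using m(1) by (simp add: n_def power2_eq_square)
    then have n: "n > 0" "\<bar>l\<bar> \<le> n" "\<bar>r\<bar> \<le> n" using m by auto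
    define xi where "xi = cutoff 0 n (2 * n)"
    note cut = cutoff_bounds[where a=0 and rho'=n and rho="2 * n"]
    have test: "xi \<in> test_functions" unfolding xi_def by (rule cutoff_test) (use n in auto)
    have dxi: "\<bar>deriv xi x\<bar> \<le> step_slope / n * indicator {-(2 * n)..2 * n} x" for x
      using cut(5)[of x] n by (simp add: xi_def)
    have supp: "deriv xi x = 0" if "x \<notin> {-(2 * n)..2 * n}" for x using dxi[of x] that by simp
    have dB: "\<bar>deriv xi x\<bar> \<le> step_slope / n" for x
      by (rule order_trans[OF dxi]) (use n step_slope(1) in \<open>auto simp: indicator_def\<close>)
    have xi01: "0 \<le> xi x" "xi x \<le> 1" for x using cut(1,2)[of x] n by (auto simp: xi_def)
    have xi1: "xi x = 1" if "x \<in> {l..r}" for x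
    proof -
      have "-n \<le> x" "x \<le> n" using that n by auto
      then show ?thesis using cut(3)[of x] n by (simp add: xi_def)
    qed
    have mxi: "xi \<in> borel_measurable lebesgue" using test by (auto simp: test_functions_iff intro: smooth_lebesgue)
    have i: "integrable lebesgue (\<lambda>x. k x * xi x)" if k: "k \<in> \<K>" for k
    proof (rule Bochner_Integration.integrable_bound[OF \<K>_D(2)[OF k]])
      show "(\<lambda>x. k x * xi x) \<in> borel_measurable lebesgue" by (intro borel_measurable_times \<K>_D(1)[OF k] mxi)
      show "AE x in lebesgue. norm (k x * xi x) \<le> norm (k x)"
        using xi01 by (intro AE_I2) (simp add: abs_mult mult_left_le)
    qed
    let ?J = "LINT tau:{0..t}|lebesgue. LINT x|lebesgue. h tau x * v tau x * deriv xi x"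
    have "\<bar>?J\<bar> \<le> step_slope / n * (k * (2 * energy R f0 g0) + (2 * (2 * n) * (1 / m) + 2 * energy R f0 g0 / (R * (1 / m))) * t)"
      by (rule flux_time_bound[OF h t dB _ supp k kD]) (use step_slope(1) n m in auto)
    also have "2 * (2 * n) * (1 / m) + 2 * energy R f0 g0 / (R * (1 / m)) = m * (4 + 2 * energy R f0 g0 / R)"
      using m(1) by (simp add: n_def power2_eq_square field_simps)
    also have "step_slope / n * (k * (2 * energy R f0 g0) + m * (4 + 2 * energy R f0 g0 / R) * t)
        \<le> step_slope / n * (m * (k * (2 * energy R f0 g0) + (4 + 2 * energy R f0 g0 / R) * t))"
      using m(1) k energy_nonneg mult_right_mono[of 1 m "k * (2 * energy R f0 g0)"] step_slope(1) n
      by (intro mult_left_mono) (simp_all add: algebra_simps)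
    also have "\<dots> = step_slope * (k * (2 * energy R f0 g0) + (4 + 2 * energy R f0 g0 / R) * t) / m"
      using m(1) by (simp add: n_def power2_eq_square)
    finally have "\<bar>c\<bar> * \<bar>?J\<bar> \<le> \<bar>c\<bar> * (step_slope * (k * (2 * energy R f0 g0) + (4 + 2 * energy R f0 g0 / R) * t) / m)"
      using step_slope(1) n by (intro mult_left_mono) auto
    then have J: "\<bar>c * ?J\<bar> \<le> C / m" by (simp add: abs_mult C_def)
    have "(LINT x|lebesgue. h0 x * xi x) \<le> (LINT x|lebesgue. h0 x)"
    proof (rule integral_mono_AE[OF i[OF K(2)] h0(2)])
      show "AE x in lebesgue. h0 x * xi x \<le> h0 x" using h0(4) by eventually_elim (use xi01 in \<open>auto simp: mult_left_le\<close>)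
    qed
    then have le: "(LINT x|lebesgue. h t x * xi x) \<le> (LINT x|lebesgue. h0 x) + C / m"
      using eq[OF test] J by linarith
    have "nnint {l..r} (h t) \<le> (\<integral>\<^sup>+x. ennreal (h t x * xi x) \<partial>lebesgue)"
      by (intro nn_integral_mono) (auto simp: xi1 split: split_indicator)
    also have "\<dots> = ennreal (LINT x|lebesgue. h t x * xi x)"
      by (rule nn_integral_eq_integral[OF i[OF K(1)]]) (use ht(4) in eventually_elim, use xi01 in simp)
    also have "\<dots> \<le> ennreal ((LINT x|lebesgue. h0 x) + C / m)" using le by (rule ennreal_leI)
    finally show ?thesis .
  qed
  have "(\<lambda>n. ennreal ((LINT x|lebesgue. h0 x) + C / real n)) \<longlonglongrightarrow> ennreal ((LINT x|lebesgue. h0 x) + 0)"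
    by (intro tendsto_ennrealI tendsto_add tendsto_const lim_const_over_n)
  moreover have "\<forall>\<^sub>F n in sequentially. nnint {l..r} (h t) \<le> ennreal ((LINT x|lebesgue. h0 x) + C / real n)"
  proof -
    obtain N where N: "max 1 (max \<bar>l\<bar> \<bar>r\<bar>) \<le> real N" using real_arch_simple by blast
    have "nnint {l..r} (h t) \<le> ennreal ((LINT x|lebesgue. h0 x) + C / real n)" if "n \<ge> N" for n
      using that N by (intro main) auto
    then show ?thesis by (auto simp: eventually_sequentially)
  qed
  ultimately show ?thesis by (intro tendsto_lowerbound) auto
qed

lemma mass_bound:
  assumes "t \<ge> 0"
  shows "nnint {l..r} (\<lambda>x. f t x + g t x) \<le> ennreal ((LINT x|lebesgue. f0 x) + (LINT x|lebesgue. g0 x))"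
proof -
  note F = \<K>_D[OF in_\<K>(1)[OF assms]] and G = \<K>_D[OF in_\<K>(2)[OF assms]]
  have eq: "(LINT x|lebesgue. f t x * xi x) - (LINT x|lebesgue. f0 x * xi x)
        + 1 * (LINT tau:{0..t}|lebesgue. LINT x|lebesgue.
             f tau x * ((1 + R) * wderiv (f tau) x + R * wderiv (g tau) x) * deriv xi x) = 0"
     "(LINT x|lebesgue. g t x * xi x) - (LINT x|lebesgue. g0 x * xi x)
        + Rmu * (LINT tau:{0..t}|lebesgue. LINT x|lebesgue.
             g tau x * (1 * wderiv (f tau) x + 1 * wderiv (g tau) x) * deriv xi x) = 0" if "xi \<in> test_functions" for xi
    using weak that assms by (auto simp: weak_solution_def)
  \<comment> \<open>The values 1 and \<open>1 / (R * Rmu)\<close> of \<open>k\<close> are the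
    reciprocals of the weights of the two dissipation terms, which contain the squares of exactly
    the velocities \<open>v\<close> of the two equations.\<close>
  have 1: "nnint {l..r} (f t) \<le> ennreal (LINT x|lebesgue. f0 x)"
    by (rule component_mass[where h=f and k=1 and v="\<lambda>tau x. (1 + R) * wderiv (f tau) x + R * wderiv (g tau) x",
        OF _ _ assms in_\<K>(1)[OF assms] f0 eq(1)]) (use R Rmu in \<open>auto simp: D_def dissipation_def\<close>)
  have 2: "nnint {l..r} (g t) \<le> ennreal (LINT x|lebesgue. g0 x)"
    by (rule component_mass[where h=g and k="1 / (R * Rmu)" and v="\<lambda>tau x. 1 * wderiv (f tau) x + 1 * wderiv (g tau) x",
        OF _ _ assms in_\<K>(2)[OF assms] g0 eq(2)]) (use R Rmu in \<open>auto simp: D_def dissipation_def field_simps\<close>)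
  have nn: "(LINT x|lebesgue. f0 x) \<ge> 0" "(LINT x|lebesgue. g0 x) \<ge> 0"
    using \<K>_D(4)[OF f0] \<K>_D(4)[OF g0] by (auto intro: integral_nonneg_AE)
  have "nnint {l..r} (\<lambda>x. f t x + g t x)
     \<le> (\<integral>\<^sup>+x. ennreal (f t x) * indicator {l..r} x + ennreal (g t x) * indicator {l..r} x \<partial>lebesgue)"
    using F(4) G(4)
    by (intro nn_integral_mono_AE, eventually_elim) (auto split: split_indicator)
  also have "\<dots> \<le> nnint {l..r} (f t) + nnint {l..r} (g t)"
    by (rule nn_integral_add_le, intro borel_measurable_times_ennreal borel_measurable_indicator)
      (use G(1) in \<open>auto split: split_indicator\<close>)
  also have "\<dots> \<le> ennreal (LINT x|lebesgue. f0 x) + ennreal (LINT x|lebesgue. g0 x)" by (intro add_mono 1 2)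
  also have "\<dots> = ennreal ((LINT x|lebesgue. f0 x) + (LINT x|lebesgue. g0 x))" using nn by simp
  finally show ?thesis .
qed

end

section \<open>Propagation\<close>

text \<open>The complement of the support is a union of arbitrarily many open sets on each of which
  \<open>w\<close> vanishes almost everywhere; by Lindeloef countably many of them suffice, so the
  exceptional sets add up to a null set.\<close>

lemma ae_support_disjoint_iff:
  assumes "open S"
  shows "ae_support w \<inter> S = {} \<longleftrightarrow> (AE x in lebesgue. x \<in> S \<longrightarrow> w x = 0)"
proof
  let ?F = "{U. open U \<and> (AE x in lebesgue. x \<in> U \<longrightarrow> w x = 0)}"
  assume "ae_support w \<inter> S = {}"
  then have S: "S \<subseteq> \<Union>?F" by (auto simp: ae_support_def)
  obtain F' where F': "F' \<subseteq> ?F" "countable F'" "\<Union>F' = \<Union>?F"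
    using Lindelof_openin[of ?F UNIV] by auto
  have "AE x in lebesgue. \<forall>U\<in>F'. x \<in> U \<longrightarrow> w x = 0"
    using F' by (subst AE_ball_countable) auto
  then show "AE x in lebesgue. x \<in> S \<longrightarrow> w x = 0"
  proof eventually_elim
    case (elim x)
    then show ?case using S F'(3) by blast
  qed
next
  assume "AE x in lebesgue. x \<in> S \<longrightarrow> w x = 0"
  then show "ae_support w \<inter> S = {}" using assms by (auto simp: ae_support_def)
qed

section \<open>Constants and arithmetic of the iteration\<close>

definition step_const :: "real \<Rightarrow> real \<Rightarrow> real" where
  "step_const R Rmu = 1 + 4 * ((1 + R)\<^sup>2 + R * Rmu) * step_slope\<^sup>2 * (1 + 1 / R) + 2 * sup_const R Rmu"

text \<open>Chosen such that 3 lam = eta^3 in the lemma iteration_arith below.\<close>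

definition smallness :: "real \<Rightarrow> real" where
  "smallness K = (1 / 256) ^ 3 / (1572864 * K ^ 7)"

lemma smallness_bounds: "K \<ge> 1 \<Longrightarrow> 0 < smallness K" "K \<ge> 1 \<Longrightarrow> smallness K \<le> 1"
proof -
  assume K: "K \<ge> 1"
  then show "0 < smallness K" by (simp add: smallness_def)
  have "K ^ 7 \<ge> 1" using K by (rule one_le_power)
  moreover have "(1 / 256 :: real) ^ 3 \<le> 1" by (rule power_le_one) auto
  ultimately show "smallness K \<le> 1" unfolding smallness_def by (subst divide_le_eq_1_pos) linarith+
qed

text \<open>The ratio 1/64 of \<open>lam\<close> is the cube of the ratio 1/4 of \<open>eta\<close>,
  so \<open>lam / eta^2\<close> stays proportional to \<open>eta\<close> and the left-hand side is
  at most \<open>2 * K * lam * eta\<close>, which has ratio 1/256. The further factors 1/256 and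
  \<open>1 / (32 * K^2)\<close> in \<open>eta\<close> turn this into exactly the next level.\<close>

lemma iteration_arith:
  fixes K :: real and k :: nat
  assumes K: "K \<ge> 1"
  defines "eps \<equiv> smallness K"
  defines "eta \<equiv> (1 / 256) * (1 / 4) ^ k / (32 * K\<^sup>2)" and "lam \<equiv> 16 * K * eps * (1 / 64) ^ k"
  shows "K * lam * (eta + lam / eta + 2 * lam / eta\<^sup>2) \<le> eps * (1 / 256) ^ Suc k"
proof -
  define p :: real where "p = 4 ^ k"
  have p: "p \<ge> 1" by (simp add: p_def)
  have pw: "(1 / 4) ^ k = 1 / p" "(1 / 64) ^ k = 1 / p ^ 3" "(1 / 256) ^ k = 1 / p ^ 4"
  proof -
    have "(64::real) ^ k = (4 ^ k) ^ 3" "(256::real) ^ k = (4 ^ k) ^ 4"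
      by (simp_all flip: power_mult add: mult.commute[of k] power_mult)
    then show "(1 / 4) ^ k = 1 / p" "(1 / 64) ^ k = 1 / p ^ 3" "(1 / 256) ^ k = 1 / p ^ 4"
      by (simp_all add: p_def power_one_over)
  qed
  have e: "eps > 0" using smallness_bounds K by (simp add: eps_def)
  have eta: "eta = 1 / (8192 * K\<^sup>2 * p)" and lam: "lam = 16 * K * eps / p ^ 3"
    by (simp_all add: eta_def lam_def pw)
  have "K\<^sup>2 * p \<ge> 1 * 1" using K p by (intro mult_mono one_le_power) auto
  then have eta1: "0 < eta" "eta \<le> 1" using K p unfolding eta by (auto simp: divide_le_eq)
  have lam0: "lam > 0" using K p e by (simp add: lam)
  have eq: "3 * lam = eta ^ 3"
    using K p by (simp add: eta lam eps_def smallness_def power_divide power_mult_distrib field_simps flip: power_add power_mult)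
      (simp add: eval_nat_numeral)
  have "eta\<^sup>2 \<le> eta" using eta1 by (simp add: power2_eq_square mult_left_le)
  then have "lam / eta \<le> lam / eta\<^sup>2" using lam0 eta1 by (intro divide_left_mono) auto
  then have "eta + lam / eta + 2 * lam / eta\<^sup>2 \<le> eta + 3 * lam / eta\<^sup>2" by simp
  also have "\<dots> = 2 * eta" unfolding eq using eta1 by (simp add: power2_eq_square power3_eq_cube)
  finally have "K * lam * (eta + lam / eta + 2 * lam / eta\<^sup>2) \<le> K * lam * (2 * eta)" using K lam0 by (intro mult_left_mono) auto
  also have "\<dots> = eps * (1 / 256) ^ Suc k"
    unfolding power_Suc pw eta lam using K p by (simp add: field_simps power2_eq_square power3_eq_cube power4_eq_xxxx)
  finally show ?thesis .
qed

text \<open>Iterated \<open>n\<close> times, the remainders form a geometric series of ratio 4/8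
  with sum at most \<open>2 * A\<close>, while \<open>y n / 8^n\<close> tends to 0 by
  boundedness.\<close>

lemma hole_filling:
  fixes y :: "nat \<Rightarrow> real"
  assumes step: "\<And>k. y k \<le> y (Suc k) / 8 + A * 4 ^ k" and B: "\<And>k. y k \<le> B" and A: "A \<ge> 0"
  shows "y 0 \<le> 2 * A"
proof -
  have "y 0 \<le> y n / 8 ^ n + A * (2 - 2 * (1 / 2) ^ n)" for n
  proof (induction n)
    case (Suc n)
    have "y n / 8 ^ n \<le> (y (Suc n) / 8 + A * 4 ^ n) / 8 ^ n" by (intro divide_right_mono step) simp
    also have "\<dots> = y (Suc n) / 8 ^ Suc n + A * (4 ^ n / 8 ^ n)" by (simp add: add_divide_distrib)
    also have "(4::real) ^ n / 8 ^ n = (1 / 2) ^ n" by (simp flip: power_divide)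
    finally show ?case using Suc by (simp add: algebra_simps)
  qed simp
  moreover have "A * (2 - 2 * (1 / 2) ^ n) \<le> A * 2" for n using A by (intro mult_left_mono) auto
  moreover have "y n / 8 ^ n \<le> B * (1 / 8) ^ n" for n
    using divide_right_mono[OF B, of "8 ^ n" n] by (simp add: power_one_over)
  ultimately have le: "y 0 \<le> B * (1 / 8) ^ n + 2 * A" for n
    by (smt (verit, best) mult.commute)
  have "(\<lambda>n. B * (1 / 8) ^ n + 2 * A) \<longlonglongrightarrow> B * 0 + 2 * A"
    by (intro tendsto_intros LIMSEQ_realpow_zero) auto
  then show ?thesis using LIMSEQ_le_const[of "\<lambda>n. B * (1 / 8) ^ n + 2 * A" "2 * A" "y 0"] le by auto
qed

section \<open>Iterations over shrinking and over growing balls\<close>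

context solution
begin

abbreviation "K \<equiv> step_const R Rmu"
abbreviation "ball_ivl a rho \<equiv> {a - rho..a + rho}"

text \<open>\<open>step_const\<close> is \<open>1 + c_step + 2 * sup_const R Rmu\<close> with
  \<open>c_step\<close> written out; being defined outside of the locale, it is available before
  initial data and solution are given.\<close>

lemma K_bounds: "K \<ge> 1" "c_step \<le> K" "2 * sup_const R Rmu \<le> K" "sup_const R Rmu \<le> K"
proof -
  have "c_step > 0" "sup_const R Rmu \<ge> 1" using c_pos sup_const_ge[OF R Rmu] by auto
  moreover have "K = 1 + c_step + 2 * sup_const R Rmu" by (simp add: step_const_def c_step_def c_flux_def)
  ultimately show "K \<ge> 1" "c_step \<le> K" "2 * sup_const R Rmu \<le> K" "sup_const R Rmu \<le> K" by linarith+
qed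

lemma vanish_step:
  assumes rho: "0 < rho'" "rho' < rho" "rho \<le> r" and t: "0 < t" "t \<le> T"
    and 0: "AE x in lebesgue. x \<in> {a - r<..<a + r} \<longrightarrow> f0 x + g0 x = 0"
    and Y: "Y T (ball_ivl a rho) \<le> ennreal y" "y \<ge> 0"
  shows "En t (ball_ivl a rho') \<le> ennreal (K / (rho - rho')\<^sup>2 * y)" "Dn t (ball_ivl a rho') \<le> ennreal (K / (rho - rho')\<^sup>2 * y)"
proof -
  have zero': "AE x in lebesgue. x \<in> {a - rho<..<a + rho} \<longrightarrow> f0 x + g0 x = 0"
    using 0 by eventually_elim (use rho in auto)
  have "ennreal (c_step / (rho - rho')\<^sup>2) * Y T (ball_ivl a rho) \<le> ennreal (K / (rho - rho')\<^sup>2) * ennreal y"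
    by (intro mult_mono Y ennreal_leI divide_right_mono K_bounds) auto
  also have "\<dots> = ennreal (K / (rho - rho')\<^sup>2 * y)" using K_bounds(1) Y(2) by (intro ennreal_mult[symmetric]) auto
  finally show "En t (ball_ivl a rho') \<le> ennreal (K / (rho - rho')\<^sup>2 * y)" "Dn t (ball_ivl a rho') \<le> ennreal (K / (rho - rho')\<^sup>2 * y)"
    using energy_step[OF rho(1,2) t zero'] by (auto intro: order_trans)
qed

text \<open>Halving the distance of the balls multiplies the cost of a cutoff by 4, and the
  interpolation has the exponent 4/3. So the cube integrals can decay like q^(-k) if q =
  (q/4)^(4/3), that is q = 256, and the energies then decay like 64^(-k).\<close>

lemma extinction:
  assumes r: "r > 0" and T: "T > 0"
    and 0: "AE x in lebesgue. x \<in> {a - r<..<a + r} \<longrightarrow> f0 x + g0 x = 0"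
    and small: "Y T (ball_ivl a r) \<le> ennreal (smallness K * r ^ 7 / T\<^sup>2)"
  shows "AE x in lebesgue. x \<in> ball_ivl a (r / 2) \<longrightarrow> f T x + g T x = 0"
proof -
  define eps where "eps = smallness K"
  have e: "eps > 0" using smallness_bounds(1) K_bounds(1) by (simp add: eps_def)
  define rho where "rho k = r / 2 * (1 + (1 / 2) ^ k)" for k :: nat
  define lam where "lam k = 16 * K * eps * (1 / 64) ^ k" for k :: nat
  define Lam where "Lam k = lam k * r ^ 5 / T\<^sup>2" for k :: nat
  have lam0: "lam k > 0" for k using K_bounds(1) e by (simp add: lam_def)
  have Lam0: "Lam k > 0" for k using lam0 r T by (simp add: Lam_def)
  have rhob: "r / 2 < rho k" "rho k \<le> r" "rho (Suc k) < rho k" for k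
    using r power_le_one[of "1 / 2 :: real" k] by (auto simp: rho_def)
  \<comment> \<open>Consecutive radii differ by \<open>r / 4 * (1 / 2)^k\<close>, so the cutoff
    costs \<open>16 * 4^k / r^2\<close>; this turns a bound for the cube integral into the level
    \<open>Lam k\<close> of energy and dissipation.\<close>
  have dlt: "K / (rho k - rho (Suc k))\<^sup>2 * (eps * (1 / 256) ^ k * r ^ 7 / T\<^sup>2) = Lam k" for k
  proof -
    have d: "rho k - rho (Suc k) = r / 4 * (1 / 2) ^ k" by (simp add: rho_def algebra_simps)
    have e1: "(rho k - rho (Suc k))\<^sup>2 = r\<^sup>2 / 16 * (1 / 4) ^ k"
      unfolding d power_mult_distrib by (simp add: power_divide flip: power_mult) (simp add: power_mult mult.commute[of k])
    have e2: "(1 / 256 :: real) ^ k = (1 / 64) ^ k * (1 / 4) ^ k" by (simp flip: power_mult_distrib)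
    have *: "K / (r\<^sup>2 / 16 * p) * (eps * (w * p) * r ^ 7 / T\<^sup>2) = 16 * K * eps * w * r ^ 5 / T\<^sup>2" if "p > 0" for p w
      using that r T by (simp add: field_simps eval_nat_numeral)
    show ?thesis unfolding e1 e2 Lam_def lam_def by (rule *) simp
  qed
  have Yk: "Y T (ball_ivl a (rho k)) \<le> ennreal (eps * (1 / 256) ^ k * r ^ 7 / T\<^sup>2)" for k
  proof (induction k)
    case 0
    then show ?case using small by (simp add: rho_def eps_def)
  next
    case (Suc k)
    have y0: "eps * (1 / 256) ^ k * r ^ 7 / T\<^sup>2 \<ge> 0" using e r T by simp
    have rhop: "0 < rho (Suc k)" using rhob(1)[of "Suc k"] r by simp
    note st = vanish_step[OF rhop rhob(3) rhob(2) _ _ 0 Suc y0, unfolded dlt]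
    define eta where "eta = (1 / 256) * (1 / 4) ^ k / (32 * K\<^sup>2)"
    have eta0: "eta > 0" using K_bounds(1) by (simp add: eta_def)
    \<comment> \<open>\<open>r^2 / T\<close> is the natural size of the solution on this ball, so
      \<open>eta\<close> is dimensionless and all powers of \<open>r\<close> and \<open>T\<close>
      separate from the numbers in \<open>iteration_arith\<close>.\<close>
    define h where "h = eta * r\<^sup>2 / T"
    have h: "h > 0" using eta0 r T by (simp add: h_def)
    define L where "L = (a + rho (Suc k)) - (a - rho (Suc k))"
    have L: "r \<le> L" "L \<le> 2 * r" using rhob(1,2)[of "Suc k"] by (auto simp: L_def)
    let ?b = "2 * sup_const R Rmu * Lam k * (T * h + T * Lam k / (L * h) + L * Lam k / h\<^sup>2)"
    have "Y T (ball_ivl a (rho (Suc k))) \<le> ennreal (?b)"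
      unfolding L_def using rhop T h Lam0 st by (intro Y_energy_bound) auto
    also have "\<dots> \<le> ennreal (eps * (1 / 256) ^ Suc k * r ^ 7 / T\<^sup>2)"
    proof (rule ennreal_leI)
      have "T * Lam k / (L * h) \<le> T * Lam k / (r * h)" using L r T h Lam0[of k] by (intro divide_left_mono mult_right_mono) auto
      moreover have "L * Lam k / h\<^sup>2 \<le> 2 * r * Lam k / h\<^sup>2" using L Lam0[of k] by (intro divide_right_mono mult_right_mono) auto
      ultimately have "T * h + T * Lam k / (L * h) + L * Lam k / h\<^sup>2 \<le> T * h + T * Lam k / (r * h) + 2 * r * Lam k / h\<^sup>2" by linarith
      moreover have "2 * sup_const R Rmu * Lam k \<le> K * Lam k" using K_bounds(3) Lam0[of k] by (intro mult_right_mono) auto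
      ultimately have "?b
         \<le> K * Lam k * (T * h + T * Lam k / (r * h) + 2 * r * Lam k / h\<^sup>2)"
        using T h L r Lam0[of k] K_bounds(1) by (intro mult_mono) auto
      also have "T * h + T * Lam k / (r * h) + 2 * r * Lam k / h\<^sup>2 = r\<^sup>2 * (eta + lam k / eta + 2 * lam k / eta\<^sup>2)"
        using r T eta0 by (simp add: h_def Lam_def field_simps power2_eq_square eval_nat_numeral)
      also have "K * Lam k * (r\<^sup>2 * (eta + lam k / eta + 2 * lam k / eta\<^sup>2)) = K * lam k * (eta + lam k / eta + 2 * lam k / eta\<^sup>2) * (r ^ 7 / T\<^sup>2)"
        by (simp add: Lam_def power2_eq_square eval_nat_numeral)
      also have "\<dots> \<le> eps * (1 / 256) ^ Suc k * (r ^ 7 / T\<^sup>2)"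
        unfolding eta_def lam_def eps_def using r T by (intro mult_right_mono iteration_arith K_bounds(1)) auto
      finally show "?b
         \<le> eps * (1 / 256) ^ Suc k * r ^ 7 / T\<^sup>2" by simp
    qed
    finally show ?case .
  qed
  \<comment> \<open>The half ball lies in all balls of the iteration, so its energy at the final
    time is below every term of a null sequence.\<close>
  have "En T (ball_ivl a (r / 2)) \<le> ennreal (Lam k)" for k
  proof -
    have y0: "eps * (1 / 256) ^ k * r ^ 7 / T\<^sup>2 \<ge> 0" using e r T by simp
    have rhop: "0 < rho (Suc k)" using rhob(1)[of "Suc k"] r by simp
    have "En T (ball_ivl a (r / 2)) \<le> En T (ball_ivl a (rho (Suc k)))" using rhob(1)[of "Suc k"] by (intro En_mono) auto
    also have "\<dots> \<le> ennreal (Lam k)"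
      using vanish_step(1)[OF rhop rhob(3) rhob(2) T order_refl 0 Yk y0] by (simp only: dlt)
    finally show ?thesis .
  qed
  moreover have "(\<lambda>k. ennreal (Lam k)) \<longlonglongrightarrow> ennreal 0"
  proof (rule tendsto_ennrealI)
    have "(\<lambda>k. 16 * K * eps * (1 / 64) ^ k * r ^ 5 / T\<^sup>2) \<longlonglongrightarrow> 16 * K * eps * 0 * r ^ 5 / T\<^sup>2"
      using T by (intro tendsto_intros LIMSEQ_realpow_zero) auto
    then show "Lam \<longlonglongrightarrow> 0" by (simp add: Lam_def[abs_def] lam_def)
  qed
  ultimately have "En T (ball_ivl a (r / 2)) \<le> ennreal 0" by (intro LIMSEQ_le_const) auto
  then have z: "nnint (ball_ivl a (r / 2)) (\<lambda>x. (f T x + g T x)\<^sup>2) = 0" by (simp add: En_def)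
  have m: "(\<lambda>x. ennreal ((f T x + g T x)\<^sup>2) * indicator (ball_ivl a (r / 2)) x) \<in> borel_measurable lebesgue"
    using \<K>_D(1)[OF in_\<K>(1)] \<K>_D(1)[OF in_\<K>(2)] T
    by (intro borel_measurable_times_ennreal borel_measurable_indicator measurable_compose[OF _ measurable_ennreal] borel_measurable_power borel_measurable_add) auto
  have "AE x in lebesgue. ennreal ((f T x + g T x)\<^sup>2) * indicator (ball_ivl a (r / 2)) x = 0"
    using z by (subst (asm) nn_integral_0_iff_AE[OF m])
  then show ?thesis
  proof eventually_elim
    case (elim x)
    show ?case
    proof
      assume "x \<in> ball_ivl a (r / 2)"
      then have "ennreal ((f T x + g T x)\<^sup>2) = 0" using elim by simp
      then have "(f T x + g T x)\<^sup>2 \<le> 0" by (simp only: ennreal_eq_0_iff)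
      then show "f T x + g T x = 0" by simp
    qed
  qed
qed

lemma propagation:
  assumes r: "r > 0" and T: "T > 0"
    and 0: "AE x in lebesgue. x \<in> {a - r<..<a + r} \<longrightarrow> f0 x + g0 x = 0"
    and time: "T\<^sup>2 * energy R f0 g0 \<le> smallness K / (8 * K * (1 + 1 / R)) * r ^ 5"
  shows "AE x in lebesgue. x \<in> ball_ivl a (r / 2) \<longrightarrow> f T x + g T x = 0"
proof (rule extinction[OF r T 0])
  define eps where "eps = smallness K"
  have e: "eps > 0" "eps \<le> 1" using smallness_bounds K_bounds(1) by (auto simp: eps_def)
  \<comment> \<open>\<open>4 * K * c = eps\<close>, where 4 bounds the bracket
    \<open>1 + c / 2 + 2 * c\<close> that comes from \<open>Y_energy_bound\<close> with
    \<open>eta\<close> taken as \<open>r^2 / T\<close>.\<close>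
  define c where "c = eps / (4 * K)"
  have c: "c > 0" "c \<le> 1" using e K_bounds(1) by (auto simp: c_def divide_le_eq)
  define Lam where "Lam = c * r ^ 5 / T\<^sup>2"
  have Lam: "Lam > 0" using c r T by (simp add: Lam_def)
  have G: "1 + 1 / R > 0" using R by (simp add: add_pos_pos)
  have "2 * (1 + 1 / R) * (T\<^sup>2 * energy R f0 g0) \<le> 2 * (1 + 1 / R) * (eps / (8 * K * (1 + 1 / R)) * r ^ 5)"
    using time G by (intro mult_left_mono) (auto simp: eps_def)
  also have "\<dots> = c * r ^ 5"
  proof -
    define G' where "G' = 1 + 1 / R"
    have "G' \<noteq> 0" using G by (simp add: G'_def)
    then show ?thesis unfolding G'_def[symmetric] using K_bounds(1) by (simp add: c_def)
  qed
  finally have E: "2 * (1 + 1 / R) * energy R f0 g0 \<le> Lam"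
    using T by (simp add: Lam_def pos_le_divide_eq mult_ac)
  have "2 * energy R f0 g0 \<le> 2 * (1 + 1 / R) * energy R f0 g0" "2 * energy R f0 g0 / R \<le> 2 * (1 + 1 / R) * energy R f0 g0"
    using energy_nonneg R by (auto simp: algebra_simps)
  with E have "2 * energy R f0 g0 \<le> Lam" "2 * energy R f0 g0 / R \<le> Lam" by linarith+
  from this[THEN ennreal_leI] have ED: "Dn t A \<le> ennreal Lam" "En t A \<le> ennreal Lam" if "0 < t" for t A
    using global_energy[OF that, of A] by (auto intro: order_trans)
  define h where "h = r\<^sup>2 / T"
  have h: "h > 0" using r T by (simp add: h_def)
  let ?b = "2 * sup_const R Rmu * Lam * (T * h + T * Lam / ((a + r - (a - r)) * h) + (a + r - (a - r)) * Lam / h\<^sup>2)"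
  have "Y T (ball_ivl a r) \<le> ennreal (?b)"
    using r T h Lam ED by (intro Y_energy_bound) auto
  also have "\<dots> \<le> ennreal (eps * r ^ 7 / T\<^sup>2)"
  proof (rule ennreal_leI)
    have "T * h + T * Lam / ((a + r - (a - r)) * h) + (a + r - (a - r)) * Lam / h\<^sup>2 = r\<^sup>2 * (1 + c / 2 + 2 * c)"
      using r T by (simp add: h_def Lam_def field_simps power2_eq_square eval_nat_numeral)
    also have "\<dots> \<le> r\<^sup>2 * 4" using c by (intro mult_left_mono) auto
    finally have "?b
        \<le> (K * Lam) * (r\<^sup>2 * 4)"
      using K_bounds(1,3) Lam T h r by (intro mult_mono mult_right_mono) auto
    also have "\<dots> = eps * r ^ 7 / T\<^sup>2" using K_bounds(1) by (simp add: Lam_def c_def field_simps power2_eq_square eval_nat_numeral)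
    finally show "?b
        \<le> eps * r ^ 7 / T\<^sup>2" .
  qed
  finally show "Y T (ball_ivl a r) \<le> ennreal (smallness K * r ^ 7 / T\<^sup>2)" by (simp add: eps_def)
qed

text \<open>The mass bounds the cube integral up to a multiple of the dissipation, which by
  \<open>vanish_step\<close> costs the cube integral on a slightly larger ball. Radii growing from
  \<open>r / 2\<close> to \<open>r\<close> allow \<open>hole_filling\<close> to absorb that
  term.\<close>

lemma Y_half_ball:
  assumes r: "r > 0" and T: "T > 0"
    and 0: "AE x in lebesgue. x \<in> {a - r<..<a + r} \<longrightarrow> f0 x + g0 x = 0"
    and M: "M > 0" "(LINT x|lebesgue. f0 x) + (LINT x|lebesgue. g0 x) \<le> M"
  shows "Y T (ball_ivl a (r / 2)) \<le> ennreal (288 * K ^ 3 * M ^ 3 * T / r\<^sup>2)"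
proof -
  define rho where "rho k = r * (1 - 1 / 2 * (1 / 2) ^ k)" for k :: nat
  have rhob: "r / 2 \<le> rho k" "rho k \<le> r" "rho k < rho (Suc k)" for k
  proof -
    have "(1 / 2 :: real) ^ k \<le> 1" by (rule power_le_one) auto
    then have "r * (1 / 2) \<le> r * (1 - 1 / 2 * (1 / 2) ^ k)" using r by (intro mult_left_mono) auto
    then show "r / 2 \<le> rho k" by (simp add: rho_def)
    show "rho k \<le> r" "rho k < rho (Suc k)" using r by (auto simp: rho_def mult_left_le)
  qed
  define Lam where "Lam = 2 * energy R f0 g0 / R + 2 * energy R f0 g0 + 1"
  have "energy R f0 g0 / R \<ge> 0" using energy_nonneg R by simp
  then have Lam: "Lam > 0" "2 * energy R f0 g0 \<le> Lam" "2 * energy R f0 g0 / R \<le> Lam"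
    using energy_nonneg by (auto simp: Lam_def)
  from Lam(2,3)[THEN ennreal_leI] have ED: "Dn t A \<le> ennreal Lam" "En t A \<le> ennreal Lam" if "0 < t" for t A
    using global_energy[OF that, of A] by (auto intro: order_trans)
  \<comment> \<open>A finite bound independent of \<open>k\<close>, as \<open>hole_filling\<close>
    requires; it rests on the energy, but its value does not enter the result.\<close>
  define b where "b = 2 * sup_const R Rmu * Lam * (T * 1 + T * Lam / ((a + r - (a - r)) * 1) + (a + r - (a - r)) * Lam / 1\<^sup>2)"
  have Yr: "Y T (ball_ivl a r) \<le> ennreal b"
    unfolding b_def using r T Lam ED by (intro Y_energy_bound) auto
  have Yfin: "Y T (ball_ivl a (rho k)) \<le> ennreal b" for k
  proof -
    have "Y T (ball_ivl a (rho k)) \<le> Y T (ball_ivl a r)"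
      unfolding Y_def using rhob(2)[of k] by (intro nn_integral_mono mult_right_mono) (auto split: split_indicator)
    then show ?thesis using Yr by (rule order_trans)
  qed
  have b0: "b \<ge> 0" unfolding b_def using sup_const_ge[OF R Rmu] Lam r T by simp
  define y where "y k = enn2real (Y T (ball_ivl a (rho k)))" for k
  have y: "Y T (ball_ivl a (rho k)) = ennreal (y k)" "y k \<ge> 0" "y k \<le> b" for k
  proof -
    have "Y T (ball_ivl a (rho k)) < top" using Yfin[of k] by (rule le_less_trans) simp
    then show *: "Y T (ball_ivl a (rho k)) = ennreal (y k)" by (simp add: y_def)
    show "y k \<ge> 0" by (simp add: y_def)
    show "y k \<le> b" using Yfin[of k] b0 unfolding * by (simp add: ennreal_le_iff)
  qed
  have "y 0 \<le> 2 * (144 * K ^ 3 * M ^ 3 * T / r\<^sup>2)"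
  proof (rule hole_filling[OF _ y(3)])
    show "0 \<le> 144 * K ^ 3 * M ^ 3 * T / r\<^sup>2" using K_bounds(1) M T by simp
    fix k
    define dlt where "dlt = rho (Suc k) - rho k"
    have dlt: "dlt > 0" "dlt = r / 4 * (1 / 2) ^ k" "dlt \<le> r"
      using rhob(3)[of k] rhob(2)[of "Suc k"] rhob(1)[of k] r by (auto simp: dlt_def) (simp add: rho_def algebra_simps)
    have dlt2: "1 / dlt\<^sup>2 = 16 * 4 ^ k / r\<^sup>2"
      unfolding dlt(2) power_mult_distrib by (simp add: power_divide flip: power_mult) (simp add: power_mult mult.commute[of k])
    have rhop: "0 < rho k" using rhob(1)[of k] r by simp
    \<comment> \<open>Makes the coefficient of \<open>y (Suc k)\<close> equal to 1/8, which is small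
      enough against the growth \<open>4^k\<close> of the remainder.\<close>
    define s where "s = 8 * K\<^sup>2 * M / dlt\<^sup>2"
    have s: "s > 0" using K_bounds(1) M dlt by (simp add: s_def)
    define L where "L = a + rho k - (a - rho k)"
    have L: "L \<ge> r" using rhob(1)[of k] by (simp add: L_def)
    have D: "Dn T (ball_ivl a (rho k)) \<le> ennreal (K / dlt\<^sup>2 * y (Suc k))"
      unfolding dlt_def by (rule vanish_step(2)[OF rhop rhob(3) rhob(2) T order_refl 0]) (simp_all add: y)
    have mass: "nnint (ball_ivl a (rho k)) (\<lambda>x. f t x + g t x) \<le> ennreal M" if "0 < t" for t
      using mass_bound[of t "a - rho k" "a + rho k"] that M(2) by (auto intro: order_trans ennreal_leI)
    have "ennreal (y k) \<le> ennreal (sup_const R Rmu * M / s) * Dn T (ball_ivl a (rho k))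
       + ennreal (sup_const R Rmu * (M^3 / L\<^sup>2 + s * M\<^sup>2) * T)"
      unfolding y(1)[symmetric] L_def using T rhop s M mass by (intro Y_mass_bound) auto
    also have "\<dots> \<le> ennreal (K * M / s) * ennreal (K / dlt\<^sup>2 * y (Suc k)) + ennreal (K * (M^3 / dlt\<^sup>2 + s * M\<^sup>2) * T)"
    proof (intro add_mono mult_mono D ennreal_leI divide_right_mono mult_right_mono K_bounds)
      show "M ^ 3 / L\<^sup>2 \<le> M ^ 3 / dlt\<^sup>2" using L dlt M by (intro divide_left_mono power_mono) auto
    qed (use M s T K_bounds(1) in auto)
    also have "\<dots> = ennreal (K * M / s * (K / dlt\<^sup>2 * y (Suc k)) + K * (M^3 / dlt\<^sup>2 + s * M\<^sup>2) * T)"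
    proof -
      have nn: "0 \<le> K * M / s" "0 \<le> K / dlt\<^sup>2 * y (Suc k)" "0 \<le> K * (M^3 / dlt\<^sup>2 + s * M\<^sup>2) * T"
        using K_bounds(1) M s T y(2)[of "Suc k"] by auto
      show ?thesis
        by (simp only: ennreal_mult[OF nn(1,2), symmetric] ennreal_plus[OF mult_nonneg_nonneg[OF nn(1,2)] nn(3), symmetric])
    qed
    finally have le: "ennreal (y k) \<le> ennreal (K * M / s * (K / dlt\<^sup>2 * y (Suc k)) + K * (M^3 / dlt\<^sup>2 + s * M\<^sup>2) * T)" .
    have "0 \<le> K * M / s * (K / dlt\<^sup>2 * y (Suc k)) + K * (M^3 / dlt\<^sup>2 + s * M\<^sup>2) * T"
      using K_bounds(1) M s T y(2)[of "Suc k"] by (intro add_nonneg_nonneg mult_nonneg_nonneg) auto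
    from le[unfolded ennreal_le_iff[OF this]]
    have "y k \<le> K * M / s * (K / dlt\<^sup>2 * y (Suc k)) + K * (M^3 / dlt\<^sup>2 + s * M\<^sup>2) * T" .
    also have "K * M / s * (K / dlt\<^sup>2 * y (Suc k)) = y (Suc k) / 8"
      using K_bounds(1) M(1) dlt(1) by (simp add: s_def field_simps power2_eq_square)
    \<comment> \<open>The term with \<open>s\<close> contributes \<open>8 * K^3\<close> and the
      other one at most \<open>K^3\<close>; inserting \<open>16 * 4^k / r^2\<close> for
      \<open>1 / dlt^2\<close> then gives 144 = 9 * 16.\<close>
    also have "K * (M^3 / dlt\<^sup>2 + s * M\<^sup>2) * T \<le> 9 * K ^ 3 * M ^ 3 * T * (1 / dlt\<^sup>2)"
    proof -
      have "K * (M^3 / dlt\<^sup>2 + s * M\<^sup>2) * T = (K * 1 + 8 * K ^ 3) * (M ^ 3 * T / dlt\<^sup>2)"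
        by (simp add: s_def add_divide_distrib algebra_simps power2_eq_square power3_eq_cube)
      also have "\<dots> \<le> (K * K\<^sup>2 + 8 * K ^ 3) * (M ^ 3 * T / dlt\<^sup>2)"
        using K_bounds(1) M T by (intro mult_right_mono add_right_mono mult_left_mono one_le_power) auto
      also have "\<dots> = 9 * K ^ 3 * M ^ 3 * T * (1 / dlt\<^sup>2)" by (simp add: power2_eq_square power3_eq_cube)
      finally show ?thesis .
    qed
    also have "9 * K ^ 3 * M ^ 3 * T * (1 / dlt\<^sup>2) = 144 * K ^ 3 * M ^ 3 * T / r\<^sup>2 * 4 ^ k"
      unfolding dlt2 by simp
    finally show "y k \<le> y (Suc k) / 8 + 144 * K ^ 3 * M ^ 3 * T / r\<^sup>2 * 4 ^ k" by simp
  qed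
  then have "ennreal (y 0) \<le> ennreal (288 * K ^ 3 * M ^ 3 * T / r\<^sup>2)" by (intro ennreal_leI) simp
  then show ?thesis unfolding y(1)[symmetric] by (simp add: rho_def)
qed

text \<open>The first halving of the radius is spent on \<open>Y_half_ball\<close>, the second one
  on \<open>extinction\<close>.\<close>

lemma expansion:
  assumes r: "r > 0" and T: "T > 0"
    and 0: "AE x in lebesgue. x \<in> {a - r<..<a + r} \<longrightarrow> f0 x + g0 x = 0"
    and M: "M \<ge> 1" "(LINT x|lebesgue. f0 x) + (LINT x|lebesgue. g0 x) \<le> M"
    and far: "576 * K ^ 3 / smallness K * M * T powr (1/3) \<le> r"
  shows "AE x in lebesgue. x \<in> ball_ivl a (r / 4) \<longrightarrow> f T x + g T x = 0"
proof -
  define eps where "eps = smallness K"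
  have e: "eps > 0" "eps \<le> 1" using smallness_bounds K_bounds(1) by (auto simp: eps_def)
  \<comment> \<open>72 is 288 / 4, from \<open>r^2 = 4 * q^2\<close> with \<open>q = r / 2\<close>.
    The factor 8 in \<open>z\<close> is \<open>2^3\<close>, since \<open>c * M * T\<close> is
    compared with the cube of \<open>r / 2\<close>; together they make 576.\<close>
  define c where "c = 72 * K ^ 3 / eps"
  have "K ^ 3 \<ge> 1" using K_bounds(1) by (rule one_le_power)
  then have c: "c \<ge> 1" using e by (simp add: c_def le_divide_eq)
  define z where "z = 8 * (c * M)"
  have cM: "c * M \<ge> 1 * 1" using c M by (intro mult_mono) auto
  then have z: "z \<ge> 1" by (simp add: z_def)
  have "z * T powr (1/3) \<le> r" using far by (simp add: z_def c_def eps_def)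
  then have "(z * T powr (1/3)) ^ 3 \<le> r ^ 3" using z by (intro power_mono) auto
  moreover have "(T powr (1/3)) ^ 3 = T" using T by (simp add: powr_powr flip: powr_numeral)
  ultimately have "z ^ 3 * T \<le> r ^ 3" by (simp add: power_mult_distrib)
  \<comment> \<open>As \<open>z\<close> and \<open>c\<close> are at least 1, first powers may be
    replaced by third ones. This is the reason for \<open>M \<ge> 1\<close> and for a rate that is
    linear in \<open>M\<close>.\<close>
  moreover have "z * T \<le> z ^ 3 * T" using z T self_le_power[of z 3] by (intro mult_right_mono) auto
  moreover have "z * T = 8 * (c * M * T)" by (simp add: z_def)
  ultimately have r3: "8 * (c * M * T) \<le> r ^ 3" by linarith
  then have "(c * M * T) ^ 3 \<le> ((r / 2) ^ 3) ^ 3" using c M T by (intro power_mono) (auto simp: power_divide)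
  then have r9: "c ^ 3 * (M ^ 3 * T ^ 3) \<le> (r / 2) ^ 9" by (simp add: power_mult_distrib flip: power_mult)
  have "c * (M ^ 3 * T ^ 3) \<le> c ^ 3 * (M ^ 3 * T ^ 3)" using c M T self_le_power[of c 3] by (intro mult_right_mono) auto
  with r9 have "c * (M ^ 3 * T ^ 3) \<le> (r / 2) ^ 9" by linarith
  then have "eps * (c * (M ^ 3 * T ^ 3)) \<le> eps * (r / 2) ^ 9" using e by (intro mult_left_mono) auto
  moreover have "eps * (c * (M ^ 3 * T ^ 3)) = 72 * K ^ 3 * (M ^ 3 * T ^ 3)" using e by (simp add: c_def)
  ultimately have main: "72 * K ^ 3 * (M ^ 3 * T ^ 3) \<le> eps * (r / 2) ^ 9" by simp
  define q where "q = r / 2"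
  have q: "q > 0" using r by (simp add: q_def)
  have zero': "AE x in lebesgue. x \<in> {a - q<..<a + q} \<longrightarrow> f0 x + g0 x = 0"
    using 0 by eventually_elim (use r in \<open>auto simp: q_def\<close>)
  have "AE x in lebesgue. x \<in> ball_ivl a (q / 2) \<longrightarrow> f T x + g T x = 0"
  proof (rule extinction[OF q T zero'])
    have "Y T (ball_ivl a q) \<le> ennreal (288 * K ^ 3 * M ^ 3 * T / r\<^sup>2)"
      unfolding q_def using M by (intro Y_half_ball r T 0) auto
    also have "\<dots> \<le> ennreal (eps * q ^ 7 / T\<^sup>2)"
    proof (rule ennreal_leI)
      have "288 * K ^ 3 * M ^ 3 * T / r\<^sup>2 = 72 * K ^ 3 * (M ^ 3 * T ^ 3) / (q\<^sup>2 * T\<^sup>2)"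
        using T r by (simp add: q_def field_simps power2_eq_square power3_eq_cube)
      also have "\<dots> \<le> eps * q ^ 9 / (q\<^sup>2 * T\<^sup>2)" using main by (intro divide_right_mono) (auto simp: q_def)
      also have "\<dots> = eps * q ^ 7 / T\<^sup>2" using q T by (simp add: field_simps flip: power_add)
      finally show "288 * K ^ 3 * M ^ 3 * T / r\<^sup>2 \<le> eps * q ^ 7 / T\<^sup>2" .
    qed
    finally show "Y T (ball_ivl a q) \<le> ennreal (smallness K * q ^ 7 / T\<^sup>2)" by (simp add: eps_def)
  qed
  then show ?thesis by (simp add: q_def)
qed

end

text \<open>Squaring and clearing the denominator also covers vanishing energy, where the endpoint
  is infinite and the left-hand side is 0.\<close>

lemma propagation_timeD:
  assumes E: "energy R f0 g0 \<ge> 0" and C: "C > 0" and r: "r > 0" and T: "T > 0"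
    and le: "ereal T \<le> propagation_time C R f0 g0 r"
  shows "T\<^sup>2 * energy R f0 g0 \<le> C\<^sup>2 * r ^ 5"
proof (cases "energy R f0 g0 = 0")
  case True then show ?thesis using C r by simp
next
  case False
  define e where "e = sqrt (energy R f0 g0)"
  have e: "e > 0" "e\<^sup>2 = energy R f0 g0" using E False by (auto simp: e_def)
  have "T \<le> C * r powr (5/2) / e" using le e by (simp add: propagation_time_def e_def)
  then have "T * e \<le> C * r powr (5/2)" using e by (simp add: pos_le_divide_eq)
  then have "(T * e)\<^sup>2 \<le> (C * r powr (5/2))\<^sup>2" using T e by (intro power_mono) auto
  moreover have "(r powr (5/2))\<^sup>2 = r ^ 5" using r by (simp add: powr_powr flip: powr_numeral)
  ultimately show ?thesis by (simp add: power_mult_distrib e)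
qed

theorem theorem1p2:
  fixes R Rmu :: real
  assumes "R > 0" and "Rmu > 0"
  shows "\<exists>C>0. \<forall>f0\<in>\<K>. \<forall>g0\<in>\<K>.
    (\<forall>f g. energy_weak_solution R Rmu f0 g0 f g \<longrightarrow>
       (\<forall>a r0. a \<ge> 0 \<and> r0 > 0 \<and>
          ae_support (\<lambda>x. f0 x + g0 x) \<inter> {a - r0<..<a + r0} = {} \<longrightarrow>
          (\<forall>T>0. ereal T \<le> propagation_time C R f0 g0 r0 \<longrightarrow>
             ae_support (\<lambda>x. f T x + g T x) \<inter> {a - r0/2<..<a + r0/2} = {}))) \<and>
    (\<exists>C'>0. \<forall>f g. energy_weak_solution R Rmu f0 g0 f g \<longrightarrow>
       (\<forall>b0>0. ae_support (\<lambda>x. f0 x + g0 x) \<subseteq> {-b0..b0} \<longrightarrow>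
          (\<forall>T>0. ae_support (\<lambda>x. f T x + g T x)
                   \<subseteq> {-b0 - C' * T powr (1/3)..b0 + C' * T powr (1/3)})))"
proof -
  define K where "K = step_const R Rmu"
  have K: "K \<ge> 1" using assms by (simp add: K_def step_const_def sup_const_def)
  define eps where "eps = smallness K"
  have e: "eps > 0" using smallness_bounds K by (simp add: eps_def)
  \<comment> \<open>The square of \<open>C\<close> is the threshold in \<open>propagation\<close>,
    which is stated for \<open>T^2\<close> times the energy.\<close>
  define C where "C = sqrt (eps / (8 * K * (1 + 1 / R)))"
  have Carg: "eps / (8 * K * (1 + 1 / R)) > 0" using e K assms by (intro divide_pos_pos mult_pos_pos add_pos_pos) auto
  then have C: "C > 0" "C\<^sup>2 = eps / (8 * K * (1 + 1 / R))" by (auto simp: C_def)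
  show ?thesis
  proof (rule exI[of _ C], intro conjI C(1) ballI allI impI)
    fix f0 g0 f g a r0 T
    assume fg: "f0 \<in> \<K>" "g0 \<in> \<K>" and sol: "energy_weak_solution R Rmu f0 g0 f g"
      and a: "0 \<le> a \<and> 0 < r0 \<and> ae_support (\<lambda>x. f0 x + g0 x) \<inter> {a - r0<..<a + r0} = {}"
      and T: "0 < T" "ereal T \<le> propagation_time C R f0 g0 r0"
    interpret solution R Rmu f0 g0 f g by unfold_locales (use assms fg sol in auto)
    have "AE x in lebesgue. x \<in> {a - r0<..<a + r0} \<longrightarrow> f0 x + g0 x = 0"
      using a by (subst (asm) ae_support_disjoint_iff) auto
    moreover have "T\<^sup>2 * energy R f0 g0 \<le> smallness (step_const R Rmu) / (8 * step_const R Rmu * (1 + 1 / R)) * r0 ^ 5"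
      using propagation_timeD[OF energy_nonneg C(1) _ T] a by (simp add: C(2) eps_def K_def)
    ultimately have "AE x in lebesgue. x \<in> {a - r0/2..a + r0/2} \<longrightarrow> f T x + g T x = 0"
      using a T(1) by (intro propagation) auto
    then have "AE x in lebesgue. x \<in> {a - r0/2<..<a + r0/2} \<longrightarrow> f T x + g T x = 0"
      by eventually_elim auto
    then show "ae_support (\<lambda>x. f T x + g T x) \<inter> {a - r0/2<..<a + r0/2} = {}"
      by (subst ae_support_disjoint_iff) auto
  next
    fix f0 g0 assume fg: "f0 \<in> \<K>" "g0 \<in> \<K>"
    \<comment> \<open>Depends on the initial data only, so \<open>C'\<close> is fixed before the
      solution, \<open>b0\<close> and \<open>T\<close>.\<close>
    define M where "M = max 1 ((LINT x|lebesgue. f0 x) + (LINT x|lebesgue. g0 x))"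
    define C' where "C' = 576 * K ^ 3 / eps * M"
    have M: "M \<ge> 1" "(LINT x|lebesgue. f0 x) + (LINT x|lebesgue. g0 x) \<le> M" by (auto simp: M_def)
    have C': "C' > 0" using K e M by (simp add: C'_def)
    show "\<exists>C'>0. \<forall>f g. energy_weak_solution R Rmu f0 g0 f g \<longrightarrow>
       (\<forall>b0>0. ae_support (\<lambda>x. f0 x + g0 x) \<subseteq> {-b0..b0} \<longrightarrow>
          (\<forall>T>0. ae_support (\<lambda>x. f T x + g T x)
                   \<subseteq> {-b0 - C' * T powr (1/3)..b0 + C' * T powr (1/3)}))"
    proof (intro exI[of _ C'] conjI C' allI impI subsetI)
      fix f g b0 T x
      assume sol: "energy_weak_solution R Rmu f0 g0 f g" and b0: "0 < b0" "ae_support (\<lambda>x. f0 x + g0 x) \<subseteq> {-b0..b0}"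
        and T: "0 < T" and x: "x \<in> ae_support (\<lambda>x. f T x + g T x)"
      interpret solution R Rmu f0 g0 f g by unfold_locales (use assms fg sol in auto)
      \<comment> \<open>Applied with \<open>r\<close> the distance of \<open>x\<close> to
        \<open>{-b0..b0}\<close>: the ball of this radius around \<open>x\<close> avoids the initial
        support, and the solution vanishes on a ball with the same centre.\<close>
      have far: "x \<notin> ae_support (\<lambda>x. f T x + g T x)"
        if "r > 0" "C' * T powr (1/3) \<le> r" "{x - r<..<x + r} \<inter> {-b0..b0} = {}" for r
      proof -
        have "ae_support (\<lambda>x. f0 x + g0 x) \<inter> {x - r<..<x + r} = {}" using that(3) b0 by blast
        then have "AE y in lebesgue. y \<in> {x - r<..<x + r} \<longrightarrow> f0 y + g0 y = 0"
          by (subst (asm) ae_support_disjoint_iff) auto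
        then have "AE y in lebesgue. y \<in> {x - r/4..x + r/4} \<longrightarrow> f T y + g T y = 0"
          using that T M by (intro expansion) (auto simp: C'_def K_def eps_def)
        then have "AE y in lebesgue. y \<in> {x - r/4<..<x + r/4} \<longrightarrow> f T y + g T y = 0"
          by eventually_elim auto
        then have "ae_support (\<lambda>x. f T x + g T x) \<inter> {x - r/4<..<x + r/4} = {}"
          by (subst ae_support_disjoint_iff) auto
        moreover have "x \<in> {x - r/4<..<x + r/4}" using that(1) by simp
        ultimately show ?thesis by blast
      qed
      have pos: "0 \<le> C' * T powr (1/3)" using C' by simp
      show "x \<in> {-b0 - C' * T powr (1/3)..b0 + C' * T powr (1/3)}"
      proof (rule ccontr)
        assume "x \<notin> {-b0 - C' * T powr (1/3)..b0 + C' * T powr (1/3)}"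
        then consider "x < -b0 - C' * T powr (1/3)" | "b0 + C' * T powr (1/3) < x" by fastforce
        then show False
        proof cases
          case 1
          have "{x - (- b0 - x)<..<x + (- b0 - x)} \<inter> {-b0..b0} = {}" by auto
          then show ?thesis using far[of "- b0 - x"] x pos 1 by fastforce
        next
          case 2
          have "{x - (x - b0)<..<x + (x - b0)} \<inter> {-b0..b0} = {}" by auto
          then show ?thesis using far[of "x - b0"] x pos 2 by fastforce
        qed
      qed
    qed
  qed
qed

end
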